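(* The system $\mathsf{ACA}_0^\omega$ proves $\mathsf{NBI}\leftrightarrow\mathsf{NBI}^{\mathbb{R}}$ and $\mathsf{NBI}\to\mathsf{NBI}^{\mathbb{N}^{\mathbb{N}}}$.
   Context: Work in higher-order arithmetic: $\mathsf{ACA}_0^\omega$ is Kohlenbach's base theory $\mathsf{RCA}_0^\omega$ plus $(\exists^2)$: there is $\varphi^2\le_2 1$ with $(\exists n)(f(n)=0)\leftrightarrow \varphi(f)=0$ for all $f\in\mathbb{N}^{\mathbb{N}}$. Reals are fast-converging Cauchy sequences; functions on reals respect real equality. For $\mathsf{X}\in\{[0,1],\mathbb{R},\mathbb{N}^{\mathbb{N}}\}$, $\mathsf{NBI}^{\mathsf{X}}$ is the statement that there is no bijection $Y:\mathsf{X}\to\mathbb{N}$ (no $Y$ which is both injective and surjective). $\mathsf{NBI}$ denotes $\mathsf{NBI}^{[0,1]}$. *)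

theory Defs
  imports Main
begin

section \<open>The language of finite types\<close>

datatype ty = N | Fun ty ty  (infixr "\<^bold>\<rightarrow>" 65)

abbreviation ty1 :: ty where "ty1 \<equiv> N \<^bold>\<rightarrow> N"
abbreviation ty2 :: ty where "ty2 \<equiv> ty1 \<^bold>\<rightarrow> N"

text \<open>
  Locally nameless syntax: \<open>Free x \<rho>\<close> is the variable with name \<open>x\<close> and type \<open>\<rho>\<close>
  (the same name at another type is another variable), \<open>Bd k\<close> refers to the \<open>k\<close>-th enclosing
  quantifier. \<open>Pi\<close> and \<open>Sg\<close> are the combinators of all types, \<open>Rec\<close> is
  the recursor \<open>R\<^sub>0\<close> of type 0. Equality is primitive at type 0 only.
\<close>

datatype trm =
    Free nat ty
  | Bd nat
  | Zero
  | Succ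
  | Pi ty ty
  | Sg ty ty ty
  | Rec
  | App trm trm  (infixl "\<^bold>\<cdot>" 110)

datatype fm =
    Eq trm trm  (infix "\<^bold>=" 70)
  | Fls
  | Imp fm fm  (infixr "\<^bold>\<longrightarrow>" 50)
  | All ty fm

abbreviation Neg :: "fm \<Rightarrow> fm" where "Neg A \<equiv> A \<^bold>\<longrightarrow> Fls"
abbreviation Con :: "fm \<Rightarrow> fm \<Rightarrow> fm"  (infixr "\<^bold>\<and>" 60)
  where "A \<^bold>\<and> B \<equiv> Neg (A \<^bold>\<longrightarrow> Neg B)"
abbreviation Iff :: "fm \<Rightarrow> fm \<Rightarrow> fm"  (infixr "\<^bold>\<longleftrightarrow>" 50)
  where "A \<^bold>\<longleftrightarrow> B \<equiv> (A \<^bold>\<longrightarrow> B) \<^bold>\<and> (B \<^bold>\<longrightarrow> A)"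

primrec has_type :: "ty list \<Rightarrow> trm \<Rightarrow> ty \<Rightarrow> bool" where
  "has_type \<Gamma> (Free x \<rho>) \<tau> \<longleftrightarrow> \<tau> = \<rho>"
| "has_type \<Gamma> (Bd k) \<tau> \<longleftrightarrow> k < length \<Gamma> \<and> \<tau> = \<Gamma> ! k"
| "has_type \<Gamma> Zero \<tau> \<longleftrightarrow> \<tau> = N"
| "has_type \<Gamma> Succ \<tau> \<longleftrightarrow> \<tau> = N \<^bold>\<rightarrow> N"
| "has_type \<Gamma> (Pi \<rho> \<sigma>) \<tau> \<longleftrightarrow> \<tau> = \<rho> \<^bold>\<rightarrow> \<sigma> \<^bold>\<rightarrow> \<rho>"
| "has_type \<Gamma> (Sg \<delta> \<rho> \<sigma>) \<tau> \<longleftrightarrow>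
     \<tau> = (\<delta> \<^bold>\<rightarrow> \<rho> \<^bold>\<rightarrow> \<sigma>) \<^bold>\<rightarrow> (\<delta> \<^bold>\<rightarrow> \<rho>) \<^bold>\<rightarrow> \<delta> \<^bold>\<rightarrow> \<sigma>"
| "has_type \<Gamma> Rec \<tau> \<longleftrightarrow> \<tau> = N \<^bold>\<rightarrow> N \<^bold>\<rightarrow> (N \<^bold>\<rightarrow> N \<^bold>\<rightarrow> N) \<^bold>\<rightarrow> N"
| "has_type \<Gamma> (s \<^bold>\<cdot> t) \<tau> \<longleftrightarrow> (\<exists>\<sigma>. has_type \<Gamma> s (\<sigma> \<^bold>\<rightarrow> \<tau>) \<and> has_type \<Gamma> t \<sigma>)"

primrec wff :: "ty list \<Rightarrow> fm \<Rightarrow> bool" where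
  "wff \<Gamma> (s \<^bold>= t) \<longleftrightarrow> has_type \<Gamma> s N \<and> has_type \<Gamma> t N"
| "wff \<Gamma> Fls \<longleftrightarrow> True"
| "wff \<Gamma> (A \<^bold>\<longrightarrow> B) \<longleftrightarrow> wff \<Gamma> A \<and> wff \<Gamma> B"
| "wff \<Gamma> (All \<rho> A) \<longleftrightarrow> wff (\<rho> # \<Gamma>) A"

primrec qf :: "fm \<Rightarrow> bool" where
  "qf (s \<^bold>= t) \<longleftrightarrow> True"
| "qf Fls \<longleftrightarrow> True"
| "qf (A \<^bold>\<longrightarrow> B) \<longleftrightarrow> qf A \<and> qf B"
| "qf (All \<rho> A) \<longleftrightarrow> False"

primrec fv_trm :: "trm \<Rightarrow> (nat \<times> ty) set" where
  "fv_trm (Free x \<rho>) = {(x, \<rho>)}"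
| "fv_trm (Bd k) = {}"
| "fv_trm Zero = {}"
| "fv_trm Succ = {}"
| "fv_trm (Pi \<rho> \<sigma>) = {}"
| "fv_trm (Sg \<delta> \<rho> \<sigma>) = {}"
| "fv_trm Rec = {}"
| "fv_trm (s \<^bold>\<cdot> t) = fv_trm s \<union> fv_trm t"

primrec fv :: "fm \<Rightarrow> (nat \<times> ty) set" where
  "fv (s \<^bold>= t) = fv_trm s \<union> fv_trm t"
| "fv Fls = {}"
| "fv (A \<^bold>\<longrightarrow> B) = fv A \<union> fv B"
| "fv (All \<rho> A) = fv A"

text \<open>
  \<open>inst k u\<close> replaces the dangling index \<open>k\<close> by \<open>u\<close>; it is only used with terms \<open>u\<close>
  that have no dangling indices themselves, so no lifting is needed.
  \<open>abstr k x \<rho>\<close> turns a variable into the dangling index \<open>k\<close>.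
\<close>

primrec inst_trm :: "nat \<Rightarrow> trm \<Rightarrow> trm \<Rightarrow> trm" where
  "inst_trm k u (Free x \<rho>) = Free x \<rho>"
| "inst_trm k u (Bd j) = (if j = k then u else Bd j)"
| "inst_trm k u Zero = Zero"
| "inst_trm k u Succ = Succ"
| "inst_trm k u (Pi \<rho> \<sigma>) = Pi \<rho> \<sigma>"
| "inst_trm k u (Sg \<delta> \<rho> \<sigma>) = Sg \<delta> \<rho> \<sigma>"
| "inst_trm k u Rec = Rec"
| "inst_trm k u (s \<^bold>\<cdot> t) = inst_trm k u s \<^bold>\<cdot> inst_trm k u t"

primrec inst :: "nat \<Rightarrow> trm \<Rightarrow> fm \<Rightarrow> fm" where
  "inst k u (s \<^bold>= t) = (inst_trm k u s \<^bold>= inst_trm k u t)"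
| "inst k u Fls = Fls"
| "inst k u (A \<^bold>\<longrightarrow> B) = (inst k u A \<^bold>\<longrightarrow> inst k u B)"
| "inst k u (All \<rho> A) = All \<rho> (inst (Suc k) u A)"

primrec abstr_trm :: "nat \<Rightarrow> nat \<Rightarrow> ty \<Rightarrow> trm \<Rightarrow> trm" where
  "abstr_trm k x \<rho> (Free y \<sigma>) = (if y = x \<and> \<sigma> = \<rho> then Bd k else Free y \<sigma>)"
| "abstr_trm k x \<rho> (Bd j) = Bd j"
| "abstr_trm k x \<rho> Zero = Zero"
| "abstr_trm k x \<rho> Succ = Succ"
| "abstr_trm k x \<rho> (Pi \<sigma> \<tau>) = Pi \<sigma> \<tau>"
| "abstr_trm k x \<rho> (Sg \<delta> \<sigma> \<tau>) = Sg \<delta> \<sigma> \<tau>"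
| "abstr_trm k x \<rho> Rec = Rec"
| "abstr_trm k x \<rho> (s \<^bold>\<cdot> t) = abstr_trm k x \<rho> s \<^bold>\<cdot> abstr_trm k x \<rho> t"

primrec abstr :: "nat \<Rightarrow> nat \<Rightarrow> ty \<Rightarrow> fm \<Rightarrow> fm" where
  "abstr k x \<rho> (s \<^bold>= t) = (abstr_trm k x \<rho> s \<^bold>= abstr_trm k x \<rho> t)"
| "abstr k x \<rho> Fls = Fls"
| "abstr k x \<rho> (A \<^bold>\<longrightarrow> B) = (abstr k x \<rho> A \<^bold>\<longrightarrow> abstr k x \<rho> B)"
| "abstr k x \<rho> (All \<sigma> A) = All \<sigma> (abstr (Suc k) x \<rho> A)"

definition ALL' :: "nat \<Rightarrow> ty \<Rightarrow> fm \<Rightarrow> fm" where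
  "ALL' x \<rho> A = All \<rho> (abstr 0 x \<rho> A)"

definition EX' :: "nat \<Rightarrow> ty \<Rightarrow> fm \<Rightarrow> fm" where
  "EX' x \<rho> A = Neg (ALL' x \<rho> (Neg A))"

definition subst :: "nat \<Rightarrow> ty \<Rightarrow> trm \<Rightarrow> fm \<Rightarrow> fm" where
  "subst x \<rho> t A = inst 0 t (abstr 0 x \<rho> A)"

section \<open>Classical many-sorted natural deduction\<close>

text \<open>
  Axioms in \<open>T\<close> may contain free variables, which are read universally: the eigenvariable
  condition of \<open>AllI\<close> only concerns the open assumptions.
\<close>

inductive deriv :: "fm set \<Rightarrow> fm set \<Rightarrow> fm \<Rightarrow> bool" for T where
  Axiom: "A \<in> T \<Longrightarrow> wff [] A \<Longrightarrow> deriv T \<Delta> A"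
| Assm: "A \<in> \<Delta> \<Longrightarrow> wff [] A \<Longrightarrow> deriv T \<Delta> A"
| ImpI: "deriv T (insert A \<Delta>) B \<Longrightarrow> wff [] A \<Longrightarrow> deriv T \<Delta> (A \<^bold>\<longrightarrow> B)"
| ImpE: "deriv T \<Delta> (A \<^bold>\<longrightarrow> B) \<Longrightarrow> deriv T \<Delta> A \<Longrightarrow> deriv T \<Delta> B"
| RAA: "deriv T (insert (Neg A) \<Delta>) Fls \<Longrightarrow> wff [] A \<Longrightarrow> deriv T \<Delta> A"
| AllI: "deriv T \<Delta> (inst 0 (Free x \<rho>) A) \<Longrightarrow> wff [] (All \<rho> A) \<Longrightarrow>
    (x, \<rho>) \<notin> fv A \<Longrightarrow> (\<forall>B\<in>\<Delta>. (x, \<rho>) \<notin> fv B) \<Longrightarrow> deriv T \<Delta> (All \<rho> A)"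
| AllE: "deriv T \<Delta> (All \<rho> A) \<Longrightarrow> has_type [] t \<rho> \<Longrightarrow> deriv T \<Delta> (inst 0 t A)"

definition proves :: "fm set \<Rightarrow> fm \<Rightarrow> bool"  (infix "\<^bold>\<turnstile>" 40) where
  "T \<^bold>\<turnstile> A \<longleftrightarrow> deriv T {} A"

section \<open>Terms for elementary arithmetic\<close>

text \<open>
  Lambda abstraction over a named variable is compiled to combinators. \<open>typ_of\<close> is only
  meaningful on well-typed terms without dangling indices.
\<close>

primrec cod :: "ty \<Rightarrow> ty" where
  "cod N = N"
| "cod (\<sigma> \<^bold>\<rightarrow> \<tau>) = \<tau>"

primrec typ_of :: "trm \<Rightarrow> ty" where
  "typ_of (Free x \<rho>) = \<rho>"
| "typ_of (Bd k) = N"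
| "typ_of Zero = N"
| "typ_of Succ = N \<^bold>\<rightarrow> N"
| "typ_of (Pi \<rho> \<sigma>) = \<rho> \<^bold>\<rightarrow> \<sigma> \<^bold>\<rightarrow> \<rho>"
| "typ_of (Sg \<delta> \<rho> \<sigma>) = (\<delta> \<^bold>\<rightarrow> \<rho> \<^bold>\<rightarrow> \<sigma>) \<^bold>\<rightarrow> (\<delta> \<^bold>\<rightarrow> \<rho>) \<^bold>\<rightarrow> \<delta> \<^bold>\<rightarrow> \<sigma>"
| "typ_of Rec = N \<^bold>\<rightarrow> N \<^bold>\<rightarrow> (N \<^bold>\<rightarrow> N \<^bold>\<rightarrow> N) \<^bold>\<rightarrow> N"
| "typ_of (s \<^bold>\<cdot> t) = cod (typ_of s)"

fun lam :: "nat \<Rightarrow> ty \<Rightarrow> trm \<Rightarrow> trm" where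
  "lam x \<rho> (s \<^bold>\<cdot> t) =
     (if (x, \<rho>) \<in> fv_trm (s \<^bold>\<cdot> t)
      then Sg \<rho> (typ_of t) (cod (typ_of s)) \<^bold>\<cdot> lam x \<rho> s \<^bold>\<cdot> lam x \<rho> t
      else Pi (typ_of (s \<^bold>\<cdot> t)) \<rho> \<^bold>\<cdot> (s \<^bold>\<cdot> t))"
| "lam x \<rho> t =
     (if t = Free x \<rho> then Sg \<rho> (\<rho> \<^bold>\<rightarrow> \<rho>) \<rho> \<^bold>\<cdot> Pi \<rho> (\<rho> \<^bold>\<rightarrow> \<rho>) \<^bold>\<cdot> Pi \<rho> \<rho>
      else Pi (typ_of t) \<rho> \<^bold>\<cdot> t)"

text \<open>
  The functions below apply closed terms, so they may be used with dangling indices as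
  arguments. \<open>lam1\<close> and \<open>lam2\<close> abstract over variables 0 and 1. In a step term \<open>u\<close> of
  \<open>prim_rec t s u\<close>, variable 2 is the previous value and variable 3 the counter.
\<close>

abbreviation var :: "nat \<Rightarrow> trm" where "var i \<equiv> Free i N"
abbreviation lam1 :: "trm \<Rightarrow> trm" where "lam1 t \<equiv> lam 0 N t"
abbreviation lam2 :: "trm \<Rightarrow> trm" where "lam2 t \<equiv> lam 0 N (lam 1 N t)"
abbreviation prim_rec :: "trm \<Rightarrow> trm \<Rightarrow> trm \<Rightarrow> trm" where
  "prim_rec t s u \<equiv> Rec \<^bold>\<cdot> t \<^bold>\<cdot> s \<^bold>\<cdot> lam 2 N (lam 3 N u)"

primrec num :: "nat \<Rightarrow> trm" where
  "num 0 = Zero"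
| "num (Suc n) = Succ \<^bold>\<cdot> num n"

definition add :: "trm \<Rightarrow> trm \<Rightarrow> trm"  (infixl "\<^bold>+" 90) where
  "s \<^bold>+ t = lam2 (prim_rec (var 1) (var 0) (Succ \<^bold>\<cdot> var 2)) \<^bold>\<cdot> s \<^bold>\<cdot> t"

definition mult :: "trm \<Rightarrow> trm \<Rightarrow> trm"  (infixl "\<^bold>*" 95) where
  "s \<^bold>* t = lam2 (prim_rec (var 1) Zero (var 2 \<^bold>+ var 0)) \<^bold>\<cdot> s \<^bold>\<cdot> t"

definition pow2 :: "trm \<Rightarrow> trm" where
  "pow2 t = lam1 (prim_rec (var 0) (num 1) (var 2 \<^bold>+ var 2)) \<^bold>\<cdot> t"

definition pred :: "trm \<Rightarrow> trm" where
  "pred t = lam1 (prim_rec (var 0) Zero (var 3)) \<^bold>\<cdot> t"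

definition monus :: "trm \<Rightarrow> trm \<Rightarrow> trm"  (infixl "\<^bold>-" 90) where
  "s \<^bold>- t = lam2 (prim_rec (var 1) (var 0) (pred (var 2))) \<^bold>\<cdot> s \<^bold>\<cdot> t"

definition le :: "trm \<Rightarrow> trm \<Rightarrow> fm"  (infix "\<^bold>\<le>" 70) where
  "s \<^bold>\<le> t = (s \<^bold>- t \<^bold>= Zero)"

definition lt :: "trm \<Rightarrow> trm \<Rightarrow> fm"  (infix "\<^bold><" 70) where
  "s \<^bold>< t = (Succ \<^bold>\<cdot> s \<^bold>\<le> t)"

section \<open>The systems\<close>

primrec args :: "ty \<Rightarrow> ty list" where
  "args N = []"
| "args (\<sigma> \<^bold>\<rightarrow> \<tau>) = \<sigma> # args \<tau>"

text \<open>
  Extensional equality: \<open>s =\<^sub>\<rho> t\<close> stands for \<open>\<forall>z\<^sub>1\<dots>z\<^sub>k. s z\<^sub>1\<dots>z\<^sub>k =\<^sub>0 t z\<^sub>1\<dots>z\<^sub>k\<close>. The terms must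
  not have dangling indices.
\<close>

definition eq_at :: "ty \<Rightarrow> trm \<Rightarrow> trm \<Rightarrow> fm" where
  "eq_at \<rho> s t =
     (let zs = map Bd (rev [0..<length (args \<rho>)])
      in foldr All (args \<rho>) (foldl App s zs \<^bold>= foldl App t zs))"

inductive_set RCA0\<omega> :: "fm set" where
  refl: "has_type [] t N \<Longrightarrow> (t \<^bold>= t) \<in> RCA0\<omega>"
| sym: "has_type [] s N \<Longrightarrow> has_type [] t N \<Longrightarrow> (s \<^bold>= t \<^bold>\<longrightarrow> t \<^bold>= s) \<in> RCA0\<omega>"
| trans: "has_type [] r N \<Longrightarrow> has_type [] s N \<Longrightarrow> has_type [] t N \<Longrightarrow>
    (r \<^bold>= s \<^bold>\<longrightarrow> s \<^bold>= t \<^bold>\<longrightarrow> r \<^bold>= t) \<in> RCA0\<omega>"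
| extensionality: "has_type [] f (\<rho> \<^bold>\<rightarrow> \<tau>) \<Longrightarrow> has_type [] s \<rho> \<Longrightarrow> has_type [] t \<rho> \<Longrightarrow>
    (eq_at \<rho> s t \<^bold>\<longrightarrow> eq_at \<tau> (f \<^bold>\<cdot> s) (f \<^bold>\<cdot> t)) \<in> RCA0\<omega>"
| Succ_not_Zero: "has_type [] t N \<Longrightarrow> Neg (Succ \<^bold>\<cdot> t \<^bold>= Zero) \<in> RCA0\<omega>"
| Succ_inject: "has_type [] s N \<Longrightarrow> has_type [] t N \<Longrightarrow>
    (Succ \<^bold>\<cdot> s \<^bold>= Succ \<^bold>\<cdot> t \<^bold>\<longrightarrow> s \<^bold>= t) \<in> RCA0\<omega>"
| Pi: "has_type [] s \<rho> \<Longrightarrow> has_type [] t \<sigma> \<Longrightarrow> eq_at \<rho> (Pi \<rho> \<sigma> \<^bold>\<cdot> s \<^bold>\<cdot> t) s \<in> RCA0\<omega>"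
| Sg: "has_type [] r (\<delta> \<^bold>\<rightarrow> \<rho> \<^bold>\<rightarrow> \<tau>) \<Longrightarrow> has_type [] s (\<delta> \<^bold>\<rightarrow> \<rho>) \<Longrightarrow> has_type [] t \<delta> \<Longrightarrow>
    eq_at \<tau> (Sg \<delta> \<rho> \<tau> \<^bold>\<cdot> r \<^bold>\<cdot> s \<^bold>\<cdot> t) (r \<^bold>\<cdot> t \<^bold>\<cdot> (s \<^bold>\<cdot> t)) \<in> RCA0\<omega>"
| Rec_Zero: "has_type [] s N \<Longrightarrow> has_type [] r (N \<^bold>\<rightarrow> N \<^bold>\<rightarrow> N) \<Longrightarrow>
    (Rec \<^bold>\<cdot> Zero \<^bold>\<cdot> s \<^bold>\<cdot> r \<^bold>= s) \<in> RCA0\<omega>"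
| Rec_Succ: "has_type [] t N \<Longrightarrow> has_type [] s N \<Longrightarrow> has_type [] r (N \<^bold>\<rightarrow> N \<^bold>\<rightarrow> N) \<Longrightarrow>
    (Rec \<^bold>\<cdot> (Succ \<^bold>\<cdot> t) \<^bold>\<cdot> s \<^bold>\<cdot> r \<^bold>= r \<^bold>\<cdot> (Rec \<^bold>\<cdot> t \<^bold>\<cdot> s \<^bold>\<cdot> r) \<^bold>\<cdot> t) \<in> RCA0\<omega>"
| QF_induction: "wff [] A \<Longrightarrow> qf A \<Longrightarrow>
    (subst x N Zero A \<^bold>\<and> ALL' x N (A \<^bold>\<longrightarrow> subst x N (Succ \<^bold>\<cdot> Free x N) A) \<^bold>\<longrightarrow> ALL' x N A) \<in> RCA0\<omega>"
| QF_AC_1_0: "wff [] A \<Longrightarrow> qf A \<Longrightarrow> (z, ty2) \<notin> fv A \<Longrightarrow>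
    (ALL' x ty1 (EX' y N A) \<^bold>\<longrightarrow>
     EX' z ty2 (ALL' x ty1 (subst y N (Free z ty2 \<^bold>\<cdot> Free x ty1) A))) \<in> RCA0\<omega>"

text \<open>\<open>(\<exists>\<^sup>2)\<close>; the first conjunct is \<open>\<phi> \<le>\<^sub>2 1\<close>, i.e. the pointwise order at type 2.\<close>

definition Exists2 :: fm where
  "Exists2 = (let \<phi> = Free 0 ty2; f = Free 1 ty1; n = Free 2 N in
     EX' 0 ty2 (ALL' 1 ty1 (\<phi> \<^bold>\<cdot> f \<^bold>\<le> num 1) \<^bold>\<and>
       ALL' 1 ty1 (EX' 2 N (f \<^bold>\<cdot> n \<^bold>= Zero) \<^bold>\<longleftrightarrow> \<phi> \<^bold>\<cdot> f \<^bold>= Zero)))"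

definition ACA0\<omega> :: "fm set" where
  "ACA0\<omega> = insert Exists2 RCA0\<omega>"

section \<open>Rational and real numbers\<close>

text \<open>
  \<open>pair x y = (x + y)(x + y + 1)/2 + x\<close>. Its inverse uses \<open>tri_root c\<close>, the largest \<open>w\<close> with
  \<open>tri w \<le> c\<close>, where \<open>tri w = w(w + 1)/2\<close>.
\<close>

definition tri :: "trm \<Rightarrow> trm" where
  "tri t = lam1 (prim_rec (var 0) Zero (var 2 \<^bold>+ Succ \<^bold>\<cdot> var 3)) \<^bold>\<cdot> t"

definition tri_root :: "trm \<Rightarrow> trm" where
  "tri_root t = lam1 (prim_rec (var 0) Zero
     (var 2 \<^bold>+ (num 1 \<^bold>- (tri (Succ \<^bold>\<cdot> var 2) \<^bold>- Succ \<^bold>\<cdot> var 3)))) \<^bold>\<cdot> t"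

definition pair :: "trm \<Rightarrow> trm \<Rightarrow> trm" where
  "pair s t = tri (s \<^bold>+ t) \<^bold>+ s"

definition proj1 :: "trm \<Rightarrow> trm" where
  "proj1 t = t \<^bold>- tri (tri_root t)"

definition proj2 :: "trm \<Rightarrow> trm" where
  "proj2 t = tri_root t \<^bold>- proj1 t"

definition parity :: "trm \<Rightarrow> trm" where
  "parity t = lam1 (prim_rec (var 0) Zero (num 1 \<^bold>- var 2)) \<^bold>\<cdot> t"

definition half :: "trm \<Rightarrow> trm" where
  "half t = lam1 (prim_rec (var 0) Zero (var 2 \<^bold>+ parity (var 3))) \<^bold>\<cdot> t"

text \<open>
  Every number codes a rational: \<open>pair n m\<close> codes \<open>(n/2)/(m + 1)\<close> if \<open>n\<close> is even and
  \<open>-((n + 1)/2)/(m + 1)\<close> if \<open>n\<close> is odd. Thus \<open>q\<close> codes \<open>(pos q - neg q)/den q\<close>.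
\<close>

definition pos :: "trm \<Rightarrow> trm" where
  "pos q = (num 1 \<^bold>- parity (proj1 q)) \<^bold>* half (proj1 q)"

definition neg :: "trm \<Rightarrow> trm" where
  "neg q = parity (proj1 q) \<^bold>* (Succ \<^bold>\<cdot> half (proj1 q))"

definition den :: "trm \<Rightarrow> trm" where
  "den q = Succ \<^bold>\<cdot> proj2 q"

text \<open>The rational \<open>q - r\<close> is \<open>(cross q r - cross r q)/(den q * den r)\<close>.\<close>

definition cross :: "trm \<Rightarrow> trm \<Rightarrow> trm" where
  "cross q r = pos q \<^bold>* den r \<^bold>+ neg r \<^bold>* den q"

text \<open>\<open>q - r < a/2\<^sup>k\<close> and \<open>q - r \<le> a/2\<^sup>k\<close>, for rational codes \<open>q\<close>, \<open>r\<close> and numbers \<open>a\<close>, \<open>k\<close>\<close>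

definition diff_less :: "trm \<Rightarrow> trm \<Rightarrow> trm \<Rightarrow> trm \<Rightarrow> fm" where
  "diff_less q r a k =
     (cross q r \<^bold>* pow2 k \<^bold>< cross r q \<^bold>* pow2 k \<^bold>+ a \<^bold>* (den q \<^bold>* den r))"

definition diff_leq :: "trm \<Rightarrow> trm \<Rightarrow> trm \<Rightarrow> trm \<Rightarrow> fm" where
  "diff_leq q r a k =
     (cross q r \<^bold>* pow2 k \<^bold>\<le> cross r q \<^bold>* pow2 k \<^bold>+ a \<^bold>* (den q \<^bold>* den r))"

text \<open>
  The arguments of the following formulas must not have dangling indices.
  A real is a sequence \<open>x\<close> with \<open>\<forall>n i. \<bar>x n - x (n + i)\<bar> < 2\<^sup>-\<^sup>n\<close>; moreover \<open>x =\<^sub>\<real> y\<close> means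
  \<open>\<forall>n. \<bar>x n - y n\<bar> \<le> 2 \<cdot> 2\<^sup>-\<^sup>n\<close> and \<open>x \<le>\<^sub>\<real> y\<close> means \<open>\<forall>n. x n \<le> y n + 2 \<cdot> 2\<^sup>-\<^sup>n\<close>.
\<close>

definition is_real :: "trm \<Rightarrow> fm" where
  "is_real x = (let n = Bd 1; i = Bd 0 in
     All N (All N (diff_less (x \<^bold>\<cdot> n) (x \<^bold>\<cdot> (n \<^bold>+ i)) (num 1) n \<^bold>\<and>
                   diff_less (x \<^bold>\<cdot> (n \<^bold>+ i)) (x \<^bold>\<cdot> n) (num 1) n)))"

definition real_eq :: "trm \<Rightarrow> trm \<Rightarrow> fm" where
  "real_eq x y = (let n = Bd 0 in
     All N (diff_leq (x \<^bold>\<cdot> n) (y \<^bold>\<cdot> n) (num 2) n \<^bold>\<and> diff_leq (y \<^bold>\<cdot> n) (x \<^bold>\<cdot> n) (num 2) n))"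

definition real_leq :: "trm \<Rightarrow> trm \<Rightarrow> fm" where
  "real_leq x y = (let n = Bd 0 in All N (diff_leq (x \<^bold>\<cdot> n) (y \<^bold>\<cdot> n) (num 2) n))"

text \<open>\<open>pair (2 * m) 0\<close> codes the rational \<open>m\<close>.\<close>

definition real_nat :: "nat \<Rightarrow> trm" where
  "real_nat m = Pi N N \<^bold>\<cdot> pair (num (2 * m)) Zero"

definition in_unit :: "trm \<Rightarrow> fm" where
  "in_unit x = (is_real x \<^bold>\<and> real_leq (real_nat 0) x \<^bold>\<and> real_leq x (real_nat 1))"

section \<open>There is no bijection to the natural numbers\<close>

text \<open>
  A space is given by its elements among the objects of type 1 and its equality. A map from the
  space to the natural numbers is an object of type 2 that respects this equality on the space;
  its values elsewhere are irrelevant.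
\<close>

definition bijection_to_nat :: "(trm \<Rightarrow> fm) \<Rightarrow> (trm \<Rightarrow> trm \<Rightarrow> fm) \<Rightarrow> trm \<Rightarrow> fm" where
  "bijection_to_nat X E Y = (let x = Free 1 ty1; x' = Free 2 ty1; n = Free 3 N in
     ALL' 1 ty1 (ALL' 2 ty1 (X x \<^bold>\<longrightarrow> X x' \<^bold>\<longrightarrow> E x x' \<^bold>\<longrightarrow> Y \<^bold>\<cdot> x \<^bold>= Y \<^bold>\<cdot> x')) \<^bold>\<and>
     ALL' 1 ty1 (ALL' 2 ty1 (X x \<^bold>\<longrightarrow> X x' \<^bold>\<longrightarrow> Y \<^bold>\<cdot> x \<^bold>= Y \<^bold>\<cdot> x' \<^bold>\<longrightarrow> E x x')) \<^bold>\<and>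
     ALL' 3 N (EX' 1 ty1 (X x \<^bold>\<and> Y \<^bold>\<cdot> x \<^bold>= n)))"

definition no_bijection :: "(trm \<Rightarrow> fm) \<Rightarrow> (trm \<Rightarrow> trm \<Rightarrow> fm) \<Rightarrow> fm" where
  "no_bijection X E = Neg (EX' 0 ty2 (bijection_to_nat X E (Free 0 ty2)))"

definition NBI :: fm where
  "NBI = no_bijection in_unit real_eq"

definition NBI_real :: fm where
  "NBI_real = no_bijection is_real real_eq"

definition NBI_baire :: fm where
  "NBI_baire = no_bijection (\<lambda>x. Neg Fls) (eq_at ty1)"

end

theory Submission
  imports Defs "HOL-Library.Countable_Set" "HOL-Computational_Algebra.Fraction_Field"
begin

text \<open>
  By a Henkin completeness argument it suffices to verify the two formulas in the term model of a
  maximal consistent extension of the theory. Its objects of type 0 form a discretely ordered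
  semiring with induction for everything that is arithmetically definable from the objects of type
  1 and 2; the field of fractions of the ring of differences interprets the codes of rationals. A real is determined
  by its lower cut, and every definable cut is the cut of a real.

  An order isomorphism of the rationals onto those between 0 and 1 turns cuts of elements of
  \<open>[0,1]\<close> into possibly improper cuts, and shifting the cuts of the natural numbers absorbs the two
  improper ones. This gives mutually inverse definable maps between \<open>[0,1]\<close> and the real line, and
  composing them with a bijection to the natural numbers proves the equivalence. For the Baire
  space, a sequence \<open>f\<close> selects nested half-open intervals: \<open>f 0\<close> an integer part, and every
  further entry one of the countably many dyadic pieces \<open>[a + e (1 - 2\<^sup>-\<^sup>m), a + e (1 - 2\<^sup>-\<^sup>m\<^sup>-\<^sup>1))\<close> of
  the current interval \<open>[a, a + e)\<close>. This is a definable bijection from the real line to the Baire space.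
\<close>

text \<open>The numbers of the term model may be nonstandard. Neither \<open>nat\<close> nor
  \<open>real\<close> can stand for its objects, an induction is legitimate only for a predicate
  that the model itself defines, and a map counts only if an object of type 2 represents it. Maps
  and induction predicates therefore carry definability proofs; the notions \<open>D\<close>,
  \<open>DP\<close> and \<open>DK\<close> have closure rules that make these proofs syntax-directed.

  Cuts remove the dependence on Cauchy representatives: equality of reals becomes equality of
  predicates, and a map of cuts can be written as an arithmetical formula, whose quantifiers
  \<open>Exists2\<close> decides. Improper cuts arise at the end points of the unit interval: 0 goes
  to the empty cut and 1 to the whole field.

  The intervals for Baire space omit their right ends, where the pieces accumulate. So every
  sequence keeps a point, and no point gets two sequences.

  Type classes act on whole types, whereas a model depends on a truth predicate. One candidate for a
  counterexample is therefore fixed globally before its numbers are made an ordered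
  semiring.\<close>

lemma has_type_append: "has_type \<Gamma> t \<rho> \<Longrightarrow> has_type (\<Gamma> @ \<Gamma>') t \<rho>"
  by (induction t arbitrary: \<rho>) (auto simp: nth_append)

lemma inst_trm_id: "has_type \<Gamma> t \<rho> \<Longrightarrow> length \<Gamma> \<le> k \<Longrightarrow> inst_trm k u t = t"
  by (induction t arbitrary: \<rho>) auto

lemma inst_trm_closed [simp]: "has_type [] t \<rho> \<Longrightarrow> inst_trm k u t = t"
  by (erule inst_trm_id) simp

lemma inst_id: "wff \<Gamma> A \<Longrightarrow> length \<Gamma> \<le> k \<Longrightarrow> inst k u A = A"
  by (induction A arbitrary: \<Gamma> k) (auto simp: inst_trm_id)

lemma inst_closed: "wff [] A \<Longrightarrow> inst k u A = A"
  by (erule inst_id) simp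

lemma has_type_inst:
  "has_type (\<Gamma> @ [\<sigma>]) t \<rho> \<Longrightarrow> has_type [] u \<sigma> \<Longrightarrow> has_type \<Gamma> (inst_trm (length \<Gamma>) u t) \<rho>"
proof (induction t arbitrary: \<rho>)
  case (Bd k)
  then show ?case using has_type_append[of "[]" u \<sigma> \<Gamma>] by (auto simp: nth_append)
qed auto

lemma wff_inst: "wff (\<Gamma> @ [\<sigma>]) A \<Longrightarrow> has_type [] u \<sigma> \<Longrightarrow> wff \<Gamma> (inst (length \<Gamma>) u A)"
proof (induction A arbitrary: \<Gamma>)
  case (All \<rho> A)
  then show ?case using All.IH[of "\<rho> # \<Gamma>"] by simp
qed (auto intro: has_type_inst)

lemma wff_inst0: "wff [] (All \<rho> A) \<Longrightarrow> has_type [] t \<rho> \<Longrightarrow> wff [] (inst 0 t A)"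
  using wff_inst[of "[]" \<rho> A t] by simp

lemma finite_fv_trm: "finite (fv_trm t)"
  by (induction t) auto

lemma finite_fv: "finite (fv A)"
  by (induction A) (auto simp: finite_fv_trm)

lemma ex_fresh:
  assumes "finite V"
  obtains x :: nat where "(x, \<rho> :: ty) \<notin> V"
proof -
  have "finite ((\<lambda>x. (x, \<rho>)) -` V)"
    using assms by (rule finite_vimageI) (simp add: inj_on_def)
  then show thesis using ex_new_if_finite[OF infinite_UNIV_nat] that by blast
qed

lemma wff_append: "wff \<Gamma> A \<Longrightarrow> wff (\<Gamma> @ \<Gamma>') A"
  by (induction A arbitrary: \<Gamma>) (auto intro: has_type_append simp flip: append_Cons)

instance ty :: countable by countable_datatype
instance trm :: countable by countable_datatype
instance fm :: countable by countable_datatype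

section \<open>Completeness\<close>

context
  fixes T :: "fm set"
begin

text \<open>Modus ponens will be the only rule of entailment, so its deduction theorem rests on this
  scheme and the next one.\<close>

lemma deriv_K: "wff [] A \<Longrightarrow> wff [] B \<Longrightarrow> deriv T {} (A \<^bold>\<longrightarrow> B \<^bold>\<longrightarrow> A)"
  by (intro deriv.ImpI deriv.Assm) auto

lemma deriv_S:
  assumes "wff [] A" "wff [] B" "wff [] C"
  shows "deriv T {} ((A \<^bold>\<longrightarrow> B \<^bold>\<longrightarrow> C) \<^bold>\<longrightarrow> (A \<^bold>\<longrightarrow> B) \<^bold>\<longrightarrow> A \<^bold>\<longrightarrow> C)"
proof -
  let ?\<Delta> = "{A, A \<^bold>\<longrightarrow> B, A \<^bold>\<longrightarrow> B \<^bold>\<longrightarrow> C}"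
  have "deriv T ?\<Delta> (A \<^bold>\<longrightarrow> B \<^bold>\<longrightarrow> C)" "deriv T ?\<Delta> (A \<^bold>\<longrightarrow> B)" "deriv T ?\<Delta> A"
    using assms by (auto intro: deriv.Assm)
  then have "deriv T ?\<Delta> C" by (meson deriv.ImpE)
  then show ?thesis using assms by (auto intro!: deriv.ImpI)
qed

lemma deriv_DNE:
  assumes "wff [] A"
  shows "deriv T {} (Neg (Neg A) \<^bold>\<longrightarrow> A)"
proof -
  let ?\<Delta> = "{Neg A, Neg (Neg A)}"
  have "deriv T ?\<Delta> (Neg (Neg A))" "deriv T ?\<Delta> (Neg A)"
    using assms by (auto intro: deriv.Assm)
  then have "deriv T ?\<Delta> Fls" by (rule deriv.ImpE)
  then have "deriv T {Neg (Neg A)} A" using assms by (rule deriv.RAA)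
  then show ?thesis using assms by (intro deriv.ImpI) auto
qed

lemma deriv_AllE:
  assumes "wff [] (All \<rho> A)" "has_type [] t \<rho>"
  shows "deriv T {} (All \<rho> A \<^bold>\<longrightarrow> inst 0 t A)"
  using assms by (auto intro!: deriv.ImpI deriv.AllE[OF deriv.Assm])

text \<open>\<open>C\<close> has no dangling index, so the quantifier does not bind anything in it.
  This shift is what carries generalisation past an open assumption in
  \<open>ent_Gen\<close>.\<close>

lemma deriv_All_distrib:
  assumes "wff [] C" "wff [] (All \<rho> B)"
  shows "deriv T {} (All \<rho> (C \<^bold>\<longrightarrow> B) \<^bold>\<longrightarrow> C \<^bold>\<longrightarrow> All \<rho> B)"
proof -
  obtain y where y: "(y, \<rho>) \<notin> fv C \<union> fv B"
    using ex_fresh[of "fv C \<union> fv B"] by (auto simp: finite_fv)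
  have CB: "wff [] (All \<rho> (C \<^bold>\<longrightarrow> B))"
    using assms has_type_append by (simp) (metis append_Nil wff_append)
  let ?\<Delta> = "{C, All \<rho> (C \<^bold>\<longrightarrow> B)}"
  have "deriv T ?\<Delta> (inst 0 (Free y \<rho>) (C \<^bold>\<longrightarrow> B))"
    by (rule deriv.AllE) (use CB in \<open>auto intro: deriv.Assm\<close>)
  moreover have "deriv T ?\<Delta> C"
    using assms by (auto intro: deriv.Assm)
  ultimately have "deriv T ?\<Delta> (inst 0 (Free y \<rho>) B)"
    using assms by (auto simp: inst_closed intro: deriv.ImpE)
  then have "deriv T ?\<Delta> (All \<rho> B)"
    by (rule deriv.AllI) (use y assms in auto)
  then show ?thesis using assms CB by (auto intro!: deriv.ImpI)
qed

text \<open>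
  Entailment is closed under weakening by construction, whereas weakening in \<open>deriv\<close> would need
  a renaming of eigenvariables.
\<close>

inductive ent :: "fm set \<Rightarrow> fm \<Rightarrow> bool" for \<Delta> where
  theorem': "deriv T {} A \<Longrightarrow> wff [] A \<Longrightarrow> ent \<Delta> A"
| assm: "A \<in> \<Delta> \<Longrightarrow> wff [] A \<Longrightarrow> ent \<Delta> A"
| mp: "ent \<Delta> (A \<^bold>\<longrightarrow> B) \<Longrightarrow> ent \<Delta> A \<Longrightarrow> ent \<Delta> B"

lemma ent_wff: "ent \<Delta> A \<Longrightarrow> wff [] A"
  by (induction rule: ent.induct) auto

lemma ent_mono: "ent \<Delta> A \<Longrightarrow> \<Delta> \<subseteq> \<Delta>' \<Longrightarrow> ent \<Delta>' A"
  by (induction rule: ent.induct) (auto intro: ent.intros)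

lemma ent_deduct: "ent (insert A \<Delta>) B \<Longrightarrow> wff [] A \<Longrightarrow> ent \<Delta> (A \<^bold>\<longrightarrow> B)"
proof (induction rule: ent.induct)
  case (theorem' B)
  then have "deriv T {} (A \<^bold>\<longrightarrow> B)" by (intro deriv.ImpE[OF deriv_K])
  then show ?case using theorem' by (intro ent.theorem') auto
next
  case (assm B)
  show ?case
  proof (cases "B = A")
    case True
    then have "deriv T {} (A \<^bold>\<longrightarrow> B)"
      using assm by (intro deriv.ImpI deriv.Assm) auto
    then show ?thesis using assm True by (auto intro: ent.theorem')
  next
    case False
    then have "ent \<Delta> B" using assm by (auto intro: ent.assm)
    moreover have "ent \<Delta> (B \<^bold>\<longrightarrow> A \<^bold>\<longrightarrow> B)" using assm by (auto intro: ent.theorem' deriv_K)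
    ultimately show ?thesis by (rule ent.mp[rotated])
  qed
next
  case (mp B C)
  then have "wff [] B" "wff [] C" by (auto dest: ent_wff)
  then have "ent \<Delta> ((A \<^bold>\<longrightarrow> B \<^bold>\<longrightarrow> C) \<^bold>\<longrightarrow> (A \<^bold>\<longrightarrow> B) \<^bold>\<longrightarrow> A \<^bold>\<longrightarrow> C)"
    using mp.prems by (auto intro!: ent.theorem' deriv_S)
  from ent.mp[OF ent.mp[OF this]] show ?case using mp by simp
qed

lemma ent_finite: "ent \<Delta> A \<Longrightarrow> \<exists>\<Delta>'. finite \<Delta>' \<and> \<Delta>' \<subseteq> \<Delta> \<and> ent \<Delta>' A"
proof (induction rule: ent.induct)
  case (theorem' A)
  then show ?case by (auto intro!: exI[of _ "{}"] ent.theorem')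
next
  case (assm A)
  then show ?case by (auto intro!: exI[of _ "{A}"] ent.assm)
next
  case (mp A B)
  then obtain \<Delta>1 \<Delta>2 where "finite (\<Delta>1 \<union> \<Delta>2)" "\<Delta>1 \<union> \<Delta>2 \<subseteq> \<Delta>" "ent \<Delta>1 (A \<^bold>\<longrightarrow> B)" "ent \<Delta>2 A"
    by auto
  then show ?case by (meson ent.mp ent_mono sup_ge1 sup_ge2)
qed

lemma ent_empty: "ent {} A \<Longrightarrow> deriv T {} A"
proof (induction rule: ent.induct)
  case (mp A B)
  show ?case by (rule deriv.ImpE[OF mp.IH])
qed auto

lemma ent_RAA:
  assumes "ent (insert (Neg A) \<Delta>) Fls" "wff [] A"
  shows "ent \<Delta> A"
proof -
  have "ent \<Delta> (Neg (Neg A))" using assms by (intro ent_deduct) auto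
  moreover have "ent \<Delta> (Neg (Neg A) \<^bold>\<longrightarrow> A)" using assms by (intro ent.theorem' deriv_DNE) auto
  ultimately show ?thesis by (rule ent.mp[rotated])
qed

text \<open>The eigenvariable rule of the calculus is applied only without assumptions. Each
  assumption is moved into the formula by the deduction theorem and recovered after generalisation
  by the quantifier shift.\<close>

lemma ent_Gen:
  assumes "finite \<Delta>" "ent \<Delta> (inst 0 (Free x \<rho>) A)" "wff [] (All \<rho> A)"
    "(x, \<rho>) \<notin> fv A" "\<And>B. B \<in> \<Delta> \<Longrightarrow> (x, \<rho>) \<notin> fv B"
  shows "ent \<Delta> (All \<rho> A)"
  using assms
proof (induction \<Delta> arbitrary: A rule: finite_induct)
  case empty
  then have "deriv T {} (All \<rho> A)"
    by (intro deriv.AllI ent_empty) auto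
  then show ?case using empty by (auto intro: ent.theorem')
next
  case (insert C \<Delta>)
  show ?case
  proof (cases "wff [] C")
    case True
    then have "ent \<Delta> (C \<^bold>\<longrightarrow> inst 0 (Free x \<rho>) A)"
      using insert.prems by (intro ent_deduct) auto
    then have "ent \<Delta> (inst 0 (Free x \<rho>) (C \<^bold>\<longrightarrow> A))"
      using True by (simp add: inst_closed)
    moreover have "wff [\<rho>] C" using wff_append[OF True, of "[\<rho>]"] by simp
    ultimately have "ent \<Delta> (All \<rho> (C \<^bold>\<longrightarrow> A))"
      using insert.prems by (intro insert.IH) auto
    moreover have "ent \<Delta> (All \<rho> (C \<^bold>\<longrightarrow> A) \<^bold>\<longrightarrow> C \<^bold>\<longrightarrow> All \<rho> A)"
      using True insert.prems \<open>wff [\<rho>] C\<close> by (intro ent.theorem' deriv_All_distrib) auto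
    ultimately have "ent \<Delta> (C \<^bold>\<longrightarrow> All \<rho> A)" by (rule ent.mp[rotated])
    then have "ent (insert C \<Delta>) (C \<^bold>\<longrightarrow> All \<rho> A)" by (rule ent_mono) auto
    then show ?thesis using True ent.mp[OF _ ent.assm[of C "insert C \<Delta>"]] by simp
  next
    \<comment> \<open>An ill-formed member can never be used, since \<open>assm\<close> asks for
      well-formedness, so it is dropped.\<close>
    case False
    have "ent \<Delta> B" if "ent (insert C \<Delta>) B" for B
      using that by (induction rule: ent.induct) (use False in \<open>auto intro: ent.intros\<close>)
    then have "ent \<Delta> (All \<rho> A)" using insert.prems by (intro insert.IH) auto
    then show ?thesis by (rule ent_mono) auto
  qed
qed

section \<open>Henkin extension and truth predicate\<close>

definition witness :: "fm set \<Rightarrow> fm \<Rightarrow> fm set" where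
  "witness \<Delta> A = (case A of All \<rho> B \<Rightarrow>
     {Neg (inst 0 (Free (SOME x. \<forall>C\<in>insert B \<Delta>. (x, \<rho>) \<notin> fv C) \<rho>) B)} | _ \<Rightarrow> {})"

lemma consistent_witness:
  assumes "finite \<Delta>" "wff [] A" "\<not> ent (insert (Neg A) \<Delta>) Fls"
  shows "\<not> ent (witness (insert (Neg A) \<Delta>) A \<union> insert (Neg A) \<Delta>) Fls"
proof (cases A)
  case (All \<rho> B)
  let ?\<Delta> = "insert (Neg A) \<Delta>"
  define x where "x = (SOME x. \<forall>C\<in>insert B ?\<Delta>. (x, \<rho>) \<notin> fv C)"
  have fin: "finite (\<Union>(fv ` insert B ?\<Delta>))" using assms by (auto simp: finite_fv)
  obtain y where "(y, \<rho>) \<notin> \<Union>(fv ` insert B ?\<Delta>)" by (rule ex_fresh[OF fin])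
  then have "\<exists>x. \<forall>C\<in>insert B ?\<Delta>. (x, \<rho>) \<notin> fv C" by auto
  then have x: "\<forall>C\<in>insert B ?\<Delta>. (x, \<rho>) \<notin> fv C"
    unfolding x_def by (rule someI_ex)
  have A: "wff [] (All \<rho> B)" using assms All by simp
  show ?thesis
  proof
    assume "ent (witness ?\<Delta> A \<union> ?\<Delta>) Fls"
    then have "ent (insert (Neg (inst 0 (Free x \<rho>) B)) ?\<Delta>) Fls"
      by (simp add: witness_def All x_def insert_commute)
    then have "ent ?\<Delta> (inst 0 (Free x \<rho>) B)"
      using wff_inst0[OF A, of "Free x \<rho>"] by (rule ent_RAA) simp
    then have "ent ?\<Delta> (All \<rho> B)"
      using assms x A by (intro ent_Gen) auto
    moreover have "ent ?\<Delta> (Neg (All \<rho> B))"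
      using A All by (intro ent.assm) auto
    ultimately show False using assms ent.mp[of ?\<Delta> "All \<rho> B" Fls] by simp
  qed
qed (use assms in \<open>auto simp: witness_def\<close>)

text \<open>Stage \<open>n\<close> decides the formula with number \<open>n\<close>. A rejected
  universal formula receives its counterexample at once, while the set is still finite.\<close>

primrec henkin :: "fm \<Rightarrow> nat \<Rightarrow> fm set" where
  "henkin A 0 = {Neg A}"
| "henkin A (Suc n) = (let \<Delta> = henkin A n; B = from_nat n in
     if \<not> wff [] B then \<Delta>
     else if \<not> ent (insert B \<Delta>) Fls then insert B \<Delta>
     else witness (insert (Neg B) \<Delta>) B \<union> insert (Neg B) \<Delta>)"

lemma henkin_step_mono: "henkin A n \<subseteq> henkin A (Suc n)"
  by (auto simp: Let_def)

lemma henkin_mono: "m \<le> n \<Longrightarrow> henkin A m \<subseteq> henkin A n"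
  by (rule lift_Suc_mono_le[of "henkin A", OF henkin_step_mono])

lemma finite_henkin: "finite (henkin A n)"
  by (induction n) (auto simp: Let_def witness_def split: fm.splits)

lemma henkin_consistent:
  assumes "wff [] A" "\<not> deriv T {} A"
  shows "\<not> ent (henkin A n) Fls"
proof (induction n)
  case 0
  have "ent {} A" if "ent {Neg A} Fls"
    by (rule ent_RAA[OF that]) (use assms in simp)
  then show ?case using assms(2) ent_empty by auto
next
  case (Suc n)
  define \<Delta> where "\<Delta> = henkin A n"
  define B :: fm where "B = from_nat n"
  have *: "henkin A (Suc n) = (if \<not> wff [] B then \<Delta>
     else if \<not> ent (insert B \<Delta>) Fls then insert B \<Delta>
     else witness (insert (Neg B) \<Delta>) B \<union> insert (Neg B) \<Delta>)"
    by (simp add: \<Delta>_def B_def Let_def)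
  have "\<not> ent (insert (Neg B) \<Delta>) Fls" if "wff [] B" "ent (insert B \<Delta>) Fls"
  proof
    assume "ent (insert (Neg B) \<Delta>) Fls"
    then have "ent \<Delta> B" using that by (simp add: ent_RAA)
    moreover have "ent \<Delta> (Neg B)" using that by (intro ent_deduct)
    ultimately show False using Suc \<Delta>_def ent.mp[of \<Delta> B Fls] by simp
  qed
  then show ?case
    using consistent_witness[of \<Delta> B] Suc finite_henkin[of A n] unfolding * \<Delta>_def[symmetric] by auto
qed

text \<open>The objects are the typed terms, free variables included, so truth of a universal
  formula is truth of all its instances. The axioms of \<open>T\<close> become true through
  \<open>theorem'\<close>.\<close>

theorem henkin_completeness:
  assumes "wff [] A" "\<not> deriv T {} A"
  obtains Tr where
    "\<not> Tr A" "\<not> Tr Fls"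
    "\<And>B C. wff [] B \<Longrightarrow> wff [] C \<Longrightarrow> Tr (B \<^bold>\<longrightarrow> C) \<longleftrightarrow> (Tr B \<longrightarrow> Tr C)"
    "\<And>\<rho> B. wff [] (All \<rho> B) \<Longrightarrow>
       Tr (All \<rho> B) \<longleftrightarrow> (\<forall>t. has_type [] t \<rho> \<longrightarrow> Tr (inst 0 t B))"
    "\<And>B. B \<in> T \<Longrightarrow> wff [] B \<Longrightarrow> Tr B"
proof -
  define H where "H = (\<Union>n. henkin A n)"
  define Tr where "Tr = ent H"
  have cons: "\<not> Tr Fls"
  proof
    assume "Tr Fls"
    then obtain \<Delta> where \<Delta>: "finite \<Delta>" "\<Delta> \<subseteq> H" "ent \<Delta> Fls"
      unfolding Tr_def using ent_finite by blast
    have "\<exists>n. \<Delta> \<subseteq> henkin A n" using \<Delta>(1,2)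
    proof (induction \<Delta> rule: finite_induct)
      case (insert B \<Delta>)
      then obtain n m where "\<Delta> \<subseteq> henkin A n" "B \<in> henkin A m" by (auto simp: H_def)
      then show ?case using henkin_mono[of n "max n m" A] henkin_mono[of m "max n m" A]
        by (intro exI[of _ "max n m"]) auto
    qed simp
    then show False using henkin_consistent[OF assms] ent_mono \<Delta>(3) by blast
  qed
  have decide: "B \<in> H \<or> (Neg B \<in> H \<and> (\<forall>\<rho> C. B = All \<rho> C \<longrightarrow> (\<exists>x. Neg (inst 0 (Free x \<rho>) C) \<in> H)))"
    if "wff [] B" for B
  proof -
    \<comment> \<open>The formula \<open>B\<close> is treated at stage \<open>to_nat B\<close>, and
      the outcome is visible in the set that follows.\<close>
    have "henkin A (Suc (to_nat B)) \<subseteq> H" by (auto simp only: H_def)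
    then show ?thesis using that
      by (auto simp: Let_def witness_def split: if_splits fm.splits)
  qed
  have Tr_Neg: "Tr (Neg B) \<longleftrightarrow> \<not> Tr B" if "wff [] B" for B
  proof
    show "\<not> Tr B" if "Tr (Neg B)" using that cons ent.mp[of H B Fls] by (auto simp: Tr_def)
    show "Tr (Neg B)" if "\<not> Tr B"
      using that decide[OF \<open>wff [] B\<close>] \<open>wff [] B\<close> unfolding Tr_def by (auto intro: ent.assm)
  qed
  have Tr_Imp: "Tr (B \<^bold>\<longrightarrow> C) \<longleftrightarrow> (Tr B \<longrightarrow> Tr C)" if "wff [] B" "wff [] C" for B C
  proof
    assume L: "Tr B \<longrightarrow> Tr C"
    show "Tr (B \<^bold>\<longrightarrow> C)"
    proof (cases "Tr C")
      case True
      then show ?thesis unfolding Tr_def using that by (intro ent_deduct) (auto elim: ent_mono)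
    next
      case False
      then have "ent H (Neg B)" using L Tr_Neg[OF that(1)] by (simp add: Tr_def)
      then have "ent (insert (Neg C) (insert B H)) Fls"
        by (intro ent.mp[OF ent_mono[of H "Neg B"] ent.assm]) (use that in auto)
      then show ?thesis unfolding Tr_def using that by (intro ent_deduct[OF ent_RAA])
    qed
  qed (use ent.mp[of H B C] in \<open>simp add: Tr_def\<close>)
  have Tr_All: "Tr (All \<rho> B) \<longleftrightarrow> (\<forall>t. has_type [] t \<rho> \<longrightarrow> Tr (inst 0 t B))"
    if "wff [] (All \<rho> B)" for \<rho> B
  proof
    assume "Tr (All \<rho> B)"
    then show "\<forall>t. has_type [] t \<rho> \<longrightarrow> Tr (inst 0 t B)"
      using that wff_inst0[OF that] ent.mp[OF ent.theorem'[OF deriv_AllE[OF that]]]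
      by (auto simp: Tr_def)
  next
    assume *: "\<forall>t. has_type [] t \<rho> \<longrightarrow> Tr (inst 0 t B)"
    show "Tr (All \<rho> B)"
    proof (rule ccontr)
      assume "\<not> Tr (All \<rho> B)"
      then have "All \<rho> B \<notin> H" using that by (auto simp: Tr_def intro: ent.assm)
      then have "\<exists>x. Neg (inst 0 (Free x \<rho>) B) \<in> H" using decide[OF that] by blast
      then obtain x where x: "Neg (inst 0 (Free x \<rho>) B) \<in> H" ..
      have w: "wff [] (inst 0 (Free x \<rho>) B)" by (rule wff_inst0[OF that]) simp
      then have "Tr (Neg (inst 0 (Free x \<rho>) B))" unfolding Tr_def using x by (auto intro: ent.assm)
      then show False using * Tr_Neg[OF w] by simp
    qed
  qed
  have "Tr B" if "B \<in> T" "wff [] B" for B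
    unfolding Tr_def using that by (auto intro: ent.theorem' deriv.Axiom)
  moreover have "\<not> Tr A"
  proof -
    have "Neg A \<in> H" by (auto simp: H_def intro!: exI[of _ 0])
    then show ?thesis using Tr_Neg[OF assms(1)] assms(1) by (auto simp: Tr_def intro: ent.assm)
  qed
  ultimately show thesis using that cons Tr_Imp Tr_All by blast
qed

end

section \<open>The term model\<close>

lemma wff_foldr_All: "wff \<Gamma> (foldr All \<rho>s A) \<longleftrightarrow> wff (rev \<rho>s @ \<Gamma>) A"
  by (induction \<rho>s arbitrary: \<Gamma>) auto

lemma inst_foldr_All: "inst k u (foldr All \<rho>s A) = foldr All \<rho>s (inst (k + length \<rho>s) u A)"
  by (induction \<rho>s arbitrary: k) auto

lemma inst_trm_foldl_App: "inst_trm k u (foldl App s ts) = foldl App (inst_trm k u s) (map (inst_trm k u) ts)"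
  by (induction ts arbitrary: s) auto

lemma has_type_foldl_Bd:
  "has_type (rev (args \<rho>) @ \<Gamma>) s \<rho> \<Longrightarrow>
   has_type (rev (args \<rho>) @ \<Gamma>) (foldl App s (map Bd (rev [0..<length (args \<rho>)]))) N"
proof (induction \<rho> arbitrary: s \<Gamma>)
  case (Fun \<sigma> \<tau>)
  have "has_type (rev (args \<tau>) @ \<sigma> # \<Gamma>) (s \<^bold>\<cdot> Bd (length (args \<tau>))) \<tau>"
    using Fun.prems by (auto simp: nth_append)
  from Fun.IH(2)[OF this] show ?case by simp
qed simp

lemma has_type_weaken: "has_type [] t \<rho> \<Longrightarrow> has_type \<Gamma> t \<rho>"
  using has_type_append[of "[]" t \<rho> \<Gamma>] by simp

lemma wff_eq_at [simp]: "has_type [] s \<rho> \<Longrightarrow> has_type [] t \<rho> \<Longrightarrow> wff [] (eq_at \<rho> s t)"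
  using has_type_foldl_Bd[of \<rho> "[]"] by (auto simp: eq_at_def Let_def wff_foldr_All has_type_weaken)

lemma eq_at_N [simp]: "eq_at N s t = (s \<^bold>= t)"
  by (simp add: eq_at_def)

text \<open>\<open>eq_at\<close> introduces all arguments at once; peeling off the first one makes
  induction on the type possible.\<close>

lemma eq_at_Fun:
  assumes "has_type [] s (\<sigma> \<^bold>\<rightarrow> \<tau>)" "has_type [] t (\<sigma> \<^bold>\<rightarrow> \<tau>)"
  obtains A where "eq_at (\<sigma> \<^bold>\<rightarrow> \<tau>) s t = All \<sigma> A" "\<And>u. inst 0 u A = eq_at \<tau> (s \<^bold>\<cdot> u) (t \<^bold>\<cdot> u)"
proof -
  let ?n = "length (args \<tau>)"
  let ?zs = "map Bd (rev [0..<?n])"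
  let ?A = "foldr All (args \<tau>) (foldl App (s \<^bold>\<cdot> Bd ?n) ?zs \<^bold>= foldl App (t \<^bold>\<cdot> Bd ?n) ?zs)"
  have zs: "map (inst_trm ?n u) ?zs = ?zs" for u by (rule map_idI) auto
  have "inst 0 u ?A = eq_at \<tau> (s \<^bold>\<cdot> u) (t \<^bold>\<cdot> u)" for u
    by (simp add: inst_foldr_All inst_trm_foldl_App zs eq_at_def Let_def
        inst_trm_closed[OF assms(1)] inst_trm_closed[OF assms(2)] del: map_map)
  moreover have "eq_at (\<sigma> \<^bold>\<rightarrow> \<tau>) s t = All \<sigma> ?A"
    by (simp add: eq_at_def Let_def)
  ultimately show thesis using that by blast
qed

section \<open>Simultaneous substitution and compiled abstraction\<close>

primrec sub :: "(nat \<times> ty \<Rightarrow> trm) \<Rightarrow> trm \<Rightarrow> trm" where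
  "sub \<theta> (Free x \<rho>) = \<theta> (x, \<rho>)"
| "sub \<theta> (Bd k) = Bd k"
| "sub \<theta> Zero = Zero"
| "sub \<theta> Succ = Succ"
| "sub \<theta> (Pi \<rho> \<sigma>) = Pi \<rho> \<sigma>"
| "sub \<theta> (Sg \<delta> \<rho> \<sigma>) = Sg \<delta> \<rho> \<sigma>"
| "sub \<theta> Rec = Rec"
| "sub \<theta> (s \<^bold>\<cdot> t) = sub \<theta> s \<^bold>\<cdot> sub \<theta> t"

abbreviation ids :: "nat \<times> ty \<Rightarrow> trm" where "ids \<equiv> \<lambda>(x, \<rho>). Free x \<rho>"

definition typed :: "(nat \<times> ty \<Rightarrow> trm) \<Rightarrow> bool" where
  "typed \<theta> \<longleftrightarrow> (\<forall>x \<rho>. has_type [] (\<theta> (x, \<rho>)) \<rho>)"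

lemma typed_ids [simp]: "typed ids"
  by (simp add: typed_def)

lemma typed_upd [simp]: "typed \<theta> \<Longrightarrow> has_type [] u \<rho> \<Longrightarrow> typed (\<theta>((x, \<rho>) := u))"
  by (simp add: typed_def)

lemma sub_ids [simp]: "sub ids t = t"
  by (induction t) auto

lemma has_type_sub: "typed \<theta> \<Longrightarrow> has_type [] t \<tau> \<Longrightarrow> has_type [] (sub \<theta> t) \<tau>"
  by (induction t arbitrary: \<tau>) (auto simp: typed_def)

lemma sub_agree: "(\<And>v. v \<in> fv_trm t \<Longrightarrow> \<theta> v = \<theta>' v) \<Longrightarrow> sub \<theta> t = sub \<theta>' t"
  by (induction t) auto

lemma sub_closed: "fv_trm t = {} \<Longrightarrow> sub \<theta> t = t"
  using sub_agree[of t \<theta> ids] by simp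

lemma typ_of_eq: "has_type [] t \<tau> \<Longrightarrow> typ_of t = \<tau>"
  by (induction t arbitrary: \<tau>) force+

lemma has_type_lam: "has_type [] t \<tau> \<Longrightarrow> has_type [] (lam x \<rho> t) (\<rho> \<^bold>\<rightarrow> \<tau>)"
proof (induction t arbitrary: \<tau>)
  case (App s t)
  then obtain \<sigma> where "has_type [] s (\<sigma> \<^bold>\<rightarrow> \<tau>)" "has_type [] t \<sigma>" by auto
  then show ?case using App.IH typ_of_eq[of s] typ_of_eq[of t] by auto
qed auto

lemma fv_lam [simp]: "fv_trm (lam x \<rho> t) = fv_trm t - {(x, \<rho>)}"
  by (induction t) auto

lemma has_type_AppI: "has_type \<Gamma> s (\<sigma> \<^bold>\<rightarrow> \<tau>) \<Longrightarrow> has_type \<Gamma> t \<sigma> \<Longrightarrow> has_type \<Gamma> (s \<^bold>\<cdot> t) \<tau>"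
  by auto

lemma has_type_const:
  "has_type \<Gamma> (Free x \<rho>) \<rho>" "has_type \<Gamma> Zero N" "has_type \<Gamma> Succ ty1" "has_type \<Gamma> (Pi \<rho> \<sigma>) (\<rho> \<^bold>\<rightarrow> \<sigma> \<^bold>\<rightarrow> \<rho>)"
  "has_type \<Gamma> (Sg \<delta> \<rho> \<sigma>) ((\<delta> \<^bold>\<rightarrow> \<rho> \<^bold>\<rightarrow> \<sigma>) \<^bold>\<rightarrow> (\<delta> \<^bold>\<rightarrow> \<rho>) \<^bold>\<rightarrow> \<delta> \<^bold>\<rightarrow> \<sigma>)"
  "has_type \<Gamma> Rec (N \<^bold>\<rightarrow> N \<^bold>\<rightarrow> (N \<^bold>\<rightarrow> N \<^bold>\<rightarrow> N) \<^bold>\<rightarrow> N)"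
  by auto

lemmas has_type_intros = has_type_AppI has_type_const

declare has_type.simps(8) [simp del]

lemma has_type_numeral [simp]: "has_type \<Gamma> (num n) N"
  by (induction n) (auto simp: has_type.simps(8))

text \<open>
  The type 0 objects of the term model are enumerated by a copy of the natural numbers, which
  later receives the arithmetic of the model as class operations.
\<close>

datatype elt = Elt (index: nat)

locale term_model =
  fixes Tr :: "fm \<Rightarrow> bool"
  assumes not_Fls [simp]: "\<not> Tr Fls"
    and Tr_Imp: "\<And>A B. wff [] A \<Longrightarrow> wff [] B \<Longrightarrow> Tr (A \<^bold>\<longrightarrow> B) \<longleftrightarrow> (Tr A \<longrightarrow> Tr B)"
    and Tr_All: "\<And>\<rho> A. wff [] (All \<rho> A) \<Longrightarrow>
      Tr (All \<rho> A) \<longleftrightarrow> (\<forall>t. has_type [] t \<rho> \<longrightarrow> Tr (inst 0 t A))"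
    and Tr_axiom: "\<And>A. A \<in> RCA0\<omega> \<Longrightarrow> wff [] A \<Longrightarrow> Tr A"
    and Tr_Exists2: "Tr Exists2"
begin

definition eqv :: "ty \<Rightarrow> trm \<Rightarrow> trm \<Rightarrow> bool" where
  "eqv \<rho> s t \<longleftrightarrow> Tr (eq_at \<rho> s t)"

lemma eqv_N: "eqv N s t \<longleftrightarrow> Tr (s \<^bold>= t)"
  by (simp add: eqv_def)

lemma eqv_Fun:
  assumes "has_type [] s (\<sigma> \<^bold>\<rightarrow> \<tau>)" "has_type [] t (\<sigma> \<^bold>\<rightarrow> \<tau>)"
  shows "eqv (\<sigma> \<^bold>\<rightarrow> \<tau>) s t \<longleftrightarrow> (\<forall>u. has_type [] u \<sigma> \<longrightarrow> eqv \<tau> (s \<^bold>\<cdot> u) (t \<^bold>\<cdot> u))"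
proof -
  obtain A where A: "eq_at (\<sigma> \<^bold>\<rightarrow> \<tau>) s t = All \<sigma> A" "\<And>u. inst 0 u A = eq_at \<tau> (s \<^bold>\<cdot> u) (t \<^bold>\<cdot> u)"
    using eq_at_Fun[OF assms] by blast
  show ?thesis using Tr_All[of \<sigma> A] wff_eq_at[OF assms] by (simp add: eqv_def A)
qed

lemma eqv_refl: "has_type [] t \<rho> \<Longrightarrow> eqv \<rho> t t"
proof (induction \<rho> arbitrary: t)
  case N
  then show ?case using Tr_axiom[OF RCA0\<omega>.refl[OF N]] by (simp add: eqv_N)
next
  case (Fun \<sigma> \<tau>)
  then show ?case by (auto simp: eqv_Fun intro: has_type_intros)
qed

lemma eqv_sym: "has_type [] s \<rho> \<Longrightarrow> has_type [] t \<rho> \<Longrightarrow> eqv \<rho> s t \<Longrightarrow> eqv \<rho> t s"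
proof (induction \<rho> arbitrary: s t)
  case N
  then show ?case using Tr_axiom[OF RCA0\<omega>.sym[OF N(1,2)]] by (simp add: eqv_N Tr_Imp)
next
  case (Fun \<sigma> \<tau>)
  have "eqv \<tau> (t \<^bold>\<cdot> u) (s \<^bold>\<cdot> u)" if "has_type [] u \<sigma>" for u
    by (rule Fun.IH(2)[of "s \<^bold>\<cdot> u"]) (use Fun.prems that in \<open>auto simp: eqv_Fun intro: has_type_intros\<close>)
  with Fun.prems show ?case by (auto simp: eqv_Fun)
qed

lemma eqv_trans:
  "has_type [] r \<rho> \<Longrightarrow> has_type [] s \<rho> \<Longrightarrow> has_type [] t \<rho> \<Longrightarrow> eqv \<rho> r s \<Longrightarrow> eqv \<rho> s t \<Longrightarrow> eqv \<rho> r t"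
proof (induction \<rho> arbitrary: r s t)
  case N
  then show ?case using Tr_axiom[OF RCA0\<omega>.trans[OF N(1-3)]] by (simp add: eqv_N Tr_Imp)
next
  case (Fun \<sigma> \<tau>)
  have "eqv \<tau> (r \<^bold>\<cdot> u) (t \<^bold>\<cdot> u)" if "has_type [] u \<sigma>" for u
    by (rule Fun.IH(2)[of "r \<^bold>\<cdot> u" "s \<^bold>\<cdot> u" "t \<^bold>\<cdot> u"]) (use Fun.prems that in \<open>auto simp: eqv_Fun intro: has_type_intros\<close>)
  with Fun.prems show ?case by (auto simp: eqv_Fun)
qed

text \<open>Replacing the argument is the axiom of extensionality; replacing the function is the
  meaning of equality at a function type.\<close>

lemma eqv_App:
  assumes "has_type [] f (\<sigma> \<^bold>\<rightarrow> \<tau>)" "has_type [] g (\<sigma> \<^bold>\<rightarrow> \<tau>)" "has_type [] s \<sigma>" "has_type [] t \<sigma>"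
    "eqv (\<sigma> \<^bold>\<rightarrow> \<tau>) f g" "eqv \<sigma> s t"
  shows "eqv \<tau> (f \<^bold>\<cdot> s) (g \<^bold>\<cdot> t)"
proof (rule eqv_trans)
  show "eqv \<tau> (f \<^bold>\<cdot> s) (f \<^bold>\<cdot> t)"
    using Tr_axiom[OF RCA0\<omega>.extensionality[OF assms(1,3,4)]] assms
      has_type_AppI[OF assms(1,3)] has_type_AppI[OF assms(1,4)]
    by (simp add: eqv_def Tr_Imp)
  show "eqv \<tau> (f \<^bold>\<cdot> t) (g \<^bold>\<cdot> t)"
    using assms by (auto simp: eqv_Fun)
qed (use assms in \<open>auto intro: has_type_intros\<close>)

lemma eqv_Pi: "has_type [] s \<rho> \<Longrightarrow> has_type [] t \<sigma> \<Longrightarrow> eqv \<rho> (Pi \<rho> \<sigma> \<^bold>\<cdot> s \<^bold>\<cdot> t) s"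
  unfolding eqv_def by (rule Tr_axiom[OF RCA0\<omega>.Pi]) (auto intro!: wff_eq_at intro: has_type_intros)

lemma eqv_Sg:
  "has_type [] r (\<delta> \<^bold>\<rightarrow> \<rho> \<^bold>\<rightarrow> \<tau>) \<Longrightarrow> has_type [] s (\<delta> \<^bold>\<rightarrow> \<rho>) \<Longrightarrow> has_type [] t \<delta> \<Longrightarrow>
   eqv \<tau> (Sg \<delta> \<rho> \<tau> \<^bold>\<cdot> r \<^bold>\<cdot> s \<^bold>\<cdot> t) (r \<^bold>\<cdot> t \<^bold>\<cdot> (s \<^bold>\<cdot> t))"
  unfolding eqv_def by (rule Tr_axiom[OF RCA0\<omega>.Sg]) (auto intro!: wff_eq_at intro: has_type_intros)

lemma eqv_identity:
  assumes "has_type [] t \<rho>"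
  shows "eqv \<rho> (Sg \<rho> (\<rho> \<^bold>\<rightarrow> \<rho>) \<rho> \<^bold>\<cdot> Pi \<rho> (\<rho> \<^bold>\<rightarrow> \<rho>) \<^bold>\<cdot> Pi \<rho> \<rho> \<^bold>\<cdot> t) t"
  by (rule eqv_trans[OF _ _ _ eqv_Sg eqv_Pi]) (use assms in \<open>auto intro: has_type_intros\<close>)

text \<open>Beta conversion. It is stated for an arbitrary \<open>\<theta>\<close> so that nested
  abstractions can be evaluated one argument at a time; no capture can occur because
  \<open>lam\<close> leaves no binder behind.\<close>

lemma sub_lam:
  assumes "typed \<theta>" "has_type [] u \<rho>"
  shows "has_type [] t \<tau> \<Longrightarrow> eqv \<tau> (sub \<theta> (lam x \<rho> t) \<^bold>\<cdot> u) (sub (\<theta>((x, \<rho>) := u)) t)"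
proof (induction t arbitrary: \<tau>)
  case (App s t)
  let ?\<theta> = "\<theta>((x, \<rho>) := u)"
  from App.prems obtain \<sigma> where st: "has_type [] s (\<sigma> \<^bold>\<rightarrow> \<tau>)" "has_type [] t \<sigma>" by (auto simp: has_type.simps(8))
  note ty = has_type_sub[OF assms(1)] has_type_sub[OF typed_upd[OF assms]] has_type_lam st assms(2)
  show ?case
  proof (cases "(x, \<rho>) \<in> fv_trm (s \<^bold>\<cdot> t)")
    case True
    have tys: "has_type [] (sub \<theta> (lam x \<rho> s)) (\<rho> \<^bold>\<rightarrow> \<sigma> \<^bold>\<rightarrow> \<tau>)" "has_type [] (sub \<theta> (lam x \<rho> t)) (\<rho> \<^bold>\<rightarrow> \<sigma>)"
      "has_type [] (sub ?\<theta> s) (\<sigma> \<^bold>\<rightarrow> \<tau>)" "has_type [] (sub ?\<theta> t) \<sigma>"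
      using st ty by blast+
    have "eqv \<tau> (Sg \<rho> \<sigma> \<tau> \<^bold>\<cdot> sub \<theta> (lam x \<rho> s) \<^bold>\<cdot> sub \<theta> (lam x \<rho> t) \<^bold>\<cdot> u) (sub ?\<theta> s \<^bold>\<cdot> sub ?\<theta> t)"
    proof (rule eqv_trans[OF _ _ _ eqv_Sg])
      show "eqv \<tau> (sub \<theta> (lam x \<rho> s) \<^bold>\<cdot> u \<^bold>\<cdot> (sub \<theta> (lam x \<rho> t) \<^bold>\<cdot> u)) (sub ?\<theta> s \<^bold>\<cdot> sub ?\<theta> t)"
        by (rule eqv_App[OF _ _ _ _ App.IH(1)[OF st(1)] App.IH(2)[OF st(2)]])
          (use tys assms in \<open>auto simp: fun_upd_def intro: has_type_intros\<close>)
    qed (use tys assms in \<open>auto intro: has_type_intros\<close>)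
    then show ?thesis using True st typ_of_eq[OF st(1)] typ_of_eq[OF st(2)] by (simp add: fun_upd_def)
  next
    case False
    then have "sub ?\<theta> (s \<^bold>\<cdot> t) = sub \<theta> (s \<^bold>\<cdot> t)" by (intro sub_agree) auto
    moreover have "eqv \<tau> (Pi \<tau> \<rho> \<^bold>\<cdot> sub \<theta> (s \<^bold>\<cdot> t) \<^bold>\<cdot> u) (sub \<theta> (s \<^bold>\<cdot> t))"
      by (rule eqv_Pi) (use assms App.prems has_type_sub in blast)+
    ultimately show ?thesis using False typ_of_eq[OF App.prems] by (simp add: fun_upd_def)
  qed
next
  case (Free y \<sigma>)
  then show ?case using assms by (auto simp: typed_def eqv_identity intro!: eqv_Pi)
qed (use assms in \<open>auto intro!: eqv_Pi\<close>)

subsection \<open>Values\<close>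

definition cls :: "trm \<Rightarrow> trm set" where
  "cls t = {s. has_type [] s N \<and> Tr (s \<^bold>= t)}"

definition enum :: "trm set \<Rightarrow> elt" where
  "enum = (SOME f. bij_betw f (cls ` {t. has_type [] t N}) UNIV)"

definition val :: "trm \<Rightarrow> elt" where
  "val t = enum (cls t)"

definition rep :: "elt \<Rightarrow> trm" where
  "rep n = (SOME t. has_type [] t N \<and> val t = n)"

lemma cls_eq:
  assumes "has_type [] s N" "has_type [] t N"
  shows "cls s = cls t \<longleftrightarrow> Tr (s \<^bold>= t)"
proof
  assume "cls s = cls t"
  then have "s \<in> cls t" using assms eqv_refl[OF assms(1)] by (auto simp: cls_def eqv_N)
  then show "Tr (s \<^bold>= t)" by (simp add: cls_def)
next
  assume "Tr (s \<^bold>= t)"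
  then have st: "eqv N s t" "eqv N t s"
    using assms eqv_sym[of s N t] by (auto simp: eqv_N)
  then have "eqv N r s \<longleftrightarrow> eqv N r t" if "has_type [] r N" for r
    using eqv_trans[OF that assms _ st(1)] eqv_trans[OF that assms(2,1) _ st(2)] by blast
  then show "cls s = cls t" by (auto simp: cls_def eqv_N)
qed

lemma num_inject: "Tr (num m \<^bold>= num n) \<Longrightarrow> m = n"
proof (induction m arbitrary: n)
  case 0
  show ?case
  proof (cases n)
    case (Suc k)
    have "Tr (Neg (Succ \<^bold>\<cdot> num k \<^bold>= Zero))" by (rule Tr_axiom[OF RCA0\<omega>.Succ_not_Zero]) (auto simp: has_type.simps(8))
    then show ?thesis using 0 Suc eqv_sym[of Zero N "num n"]
      by (simp add: eqv_N Tr_Imp has_type.simps(8))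
  qed simp
next
  case (Suc m)
  show ?case
  proof (cases n)
    case 0
    have "Tr (Neg (Succ \<^bold>\<cdot> num m \<^bold>= Zero))" by (rule Tr_axiom[OF RCA0\<omega>.Succ_not_Zero]) (auto simp: has_type.simps(8))
    then show ?thesis using 0 Suc by (simp add: Tr_Imp has_type.simps(8))
  next
    case (Suc k)
    have "Tr (Succ \<^bold>\<cdot> num m \<^bold>= Succ \<^bold>\<cdot> num k \<^bold>\<longrightarrow> num m \<^bold>= num k)"
      by (rule Tr_axiom[OF RCA0\<omega>.Succ_inject]) (auto simp: has_type.simps(8))
    then show ?thesis using Suc Suc.prems Suc.IH by (simp add: Tr_Imp has_type.simps(8))
  qed
qed

text \<open>Terms are countable and numerals are pairwise different, so the classes are countably
  infinite. Enumerating them turns equality in the model into equality on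
  \<open>elt\<close>.\<close>

lemma bij_enum: "bij_betw enum (cls ` {t. has_type [] t N}) UNIV"
proof -
  have "inj (\<lambda>n. cls (num n))"
    by (rule injI) (simp add: cls_eq num_inject)
  then have "infinite (range (\<lambda>n. cls (num n)))"
    by (metis finite_image_iff infinite_UNIV_nat)
  then have "infinite (cls ` {t. has_type [] t N})" by (rule contrapos_nn) (auto elim: finite_subset[rotated])
  then have "bij_betw (to_nat_on (cls ` {t. has_type [] t N})) (cls ` {t. has_type [] t N}) UNIV"
    by (intro to_nat_on_infinite) auto
  moreover have "bij Elt" by (rule bijI') (auto intro: elt.exhaust)
  ultimately have "\<exists>f. bij_betw f (cls ` {t. has_type [] t N}) (UNIV :: elt set)"
    by (blast intro: bij_betw_trans)
  then show ?thesis unfolding enum_def by (rule someI_ex)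
qed

lemma val_eq:
  assumes "has_type [] s N" "has_type [] t N"
  shows "val s = val t \<longleftrightarrow> Tr (s \<^bold>= t)"
proof -
  have "enum (cls s) = enum (cls t) \<longleftrightarrow> cls s = cls t"
    by (rule inj_on_eq_iff[OF bij_betw_imp_inj_on[OF bij_enum]]) (use assms in auto)
  then show ?thesis by (simp add: val_def cls_eq assms)
qed

lemma rep: "has_type [] (rep n) N \<and> val (rep n) = n"
proof -
  have "n \<in> enum ` cls ` {t. has_type [] t N}"
    by (simp add: bij_betw_imp_surj_on[OF bij_enum])
  then have "\<exists>t. has_type [] t N \<and> val t = n" unfolding val_def by blast
  then show ?thesis unfolding rep_def by (rule someI_ex)
qed

lemma has_type_rep [simp]: "has_type [] (rep n) N" and val_rep [simp]: "val (rep n) = n"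
  using rep by auto

lemma val_eqv: "has_type [] s N \<Longrightarrow> has_type [] t N \<Longrightarrow> eqv N s t \<Longrightarrow> val s = val t"
  by (simp add: val_eq eqv_N)

lemma eqv_rep: "has_type [] s N \<Longrightarrow> eqv N (rep (val s)) s"
  by (simp add: eqv_N flip: val_eq)

definition val1 :: "trm \<Rightarrow> elt \<Rightarrow> elt" where
  "val1 f n = val (f \<^bold>\<cdot> rep n)"

lemma val_cong:
  assumes "has_type [] f (\<sigma> \<^bold>\<rightarrow> N)" "has_type [] g (\<sigma> \<^bold>\<rightarrow> N)" "has_type [] s \<sigma>" "has_type [] t \<sigma>"
    "eqv (\<sigma> \<^bold>\<rightarrow> N) f g" "eqv \<sigma> s t"
  shows "val (f \<^bold>\<cdot> s) = val (g \<^bold>\<cdot> t)"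
  by (rule val_eqv) (use assms eqv_App[OF assms] in \<open>auto intro: has_type_intros\<close>)

lemma val1_val: "has_type [] f ty1 \<Longrightarrow> has_type [] s N \<Longrightarrow> val1 f (val s) = val (f \<^bold>\<cdot> s)"
  unfolding val1_def by (rule val_cong[where \<sigma> = N]) (auto intro: eqv_refl eqv_rep)

text \<open>Thanks to this, objects of type 1 can be handled as functions on
  \<open>elt\<close>.\<close>

lemma val1_eq:
  assumes "has_type [] f ty1" "has_type [] g ty1"
  shows "val1 f = val1 g \<longleftrightarrow> eqv ty1 f g"
proof
  assume *: "val1 f = val1 g"
  have "Tr (f \<^bold>\<cdot> u \<^bold>= g \<^bold>\<cdot> u)" if "has_type [] u N" for u
    using fun_cong[OF *, of "val u"] assms that has_type_AppI[OF _ that]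
    by (simp add: val1_val val_eq)
  then show "eqv ty1 f g" using assms by (simp add: eqv_Fun eqv_N)
next
  assume "eqv ty1 f g"
  then show "val1 f = val1 g"
    unfolding val1_def using assms by (auto intro!: val_cong[where \<sigma> = N] eqv_refl)
qed

end

text \<open>
  The types 0, 1 and 2 of a model. The sequence \<open>cs n f\<close> starts with \<open>n\<close> and goes on with \<open>f\<close>,
  so that an object of type 1 can code a sequence preceded by finitely many numbers, and objects of
  type 2 represent functionals of several arguments. Members of \<open>M2\<close> only matter on \<open>M1\<close>.
  Induction is for disjunctions of equations because equality is definable only after some arithmetic.
\<close>

locale raw =
  fixes Z :: 'n and S prd :: "'n \<Rightarrow> 'n" and add mul mon :: "'n \<Rightarrow> 'n \<Rightarrow> 'n"
    and pw tri trr par hlf :: "'n \<Rightarrow> 'n" and cs :: "'n \<Rightarrow> ('n \<Rightarrow> 'n) \<Rightarrow> 'n \<Rightarrow> 'n"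
    and M1 :: "('n \<Rightarrow> 'n) set" and M2 :: "(('n \<Rightarrow> 'n) \<Rightarrow> 'n) set"
  assumes S_neq_Z [simp]: "S n \<noteq> Z"
    and S_inj: "S m = S n \<Longrightarrow> m = n"
    and prd_Z [simp]: "prd Z = Z" and prd_S [simp]: "prd (S n) = n"
    and add_Z [simp]: "add m Z = m" and add_S [simp]: "add m (S n) = S (add m n)"
    and mul_Z [simp]: "mul m Z = Z" and mul_S [simp]: "mul m (S n) = add (mul m n) m"
    and mon_Z [simp]: "mon m Z = m" and mon_S [simp]: "mon m (S n) = prd (mon m n)"
    and pw_Z [simp]: "pw Z = S Z" and pw_S [simp]: "pw (S n) = add (pw n) (pw n)"
    and tri_Z [simp]: "tri Z = Z" and tri_S [simp]: "tri (S n) = add (tri n) (S n)"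
    and trr_Z [simp]: "trr Z = Z"
    and trr_S [simp]: "trr (S n) = add (trr n) (mon (S Z) (mon (tri (S (trr n))) (S n)))"
    and par_Z [simp]: "par Z = Z" and par_S [simp]: "par (S n) = mon (S Z) (par n)"
    and hlf_Z [simp]: "hlf Z = Z" and hlf_S [simp]: "hlf (S n) = add (hlf n) (par n)"
    and cs_Z [simp]: "f \<in> M1 \<Longrightarrow> cs n f Z = n" and cs_S [simp]: "f \<in> M1 \<Longrightarrow> cs n f (S k) = f k"
    and M1_basic: "{S, prd, pw, tri, trr, par, hlf} \<subseteq> M1"
    and M1_cs [simp]: "f \<in> M1 \<Longrightarrow> cs n f \<in> M1"
    and M1_section: "F \<in> M2 \<Longrightarrow> x \<in> M1 \<Longrightarrow> (\<lambda>n. F (cs n x)) \<in> M1"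
    and M1_induct: "{f, g, f', g'} \<subseteq> M1 \<Longrightarrow> f Z = g Z \<or> f' Z = g' Z \<Longrightarrow>
      (\<And>n. f n = g n \<or> f' n = g' n \<Longrightarrow> f (S n) = g (S n) \<or> f' (S n) = g' (S n)) \<Longrightarrow>
      f n = g n \<or> f' n = g' n"
    and M2_const: "(\<lambda>x. c) \<in> M2"
    and M2_comp: "f \<in> M1 \<Longrightarrow> F \<in> M2 \<Longrightarrow> (\<lambda>x. f (F x)) \<in> M2"
    and M2_arith: "F \<in> M2 \<Longrightarrow> G \<in> M2 \<Longrightarrow> (\<lambda>x. add (F x) (G x)) \<in> M2"
      "F \<in> M2 \<Longrightarrow> G \<in> M2 \<Longrightarrow> (\<lambda>x. mul (F x) (G x)) \<in> M2"
      "F \<in> M2 \<Longrightarrow> G \<in> M2 \<Longrightarrow> (\<lambda>x. mon (F x) (G x)) \<in> M2"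
    and M2_apply: "F \<in> M2 \<Longrightarrow> (\<lambda>x. x (F x)) \<in> M2"
    and M2_subst: "F \<in> M2 \<Longrightarrow> G \<in> M2 \<Longrightarrow> (\<lambda>x. G (\<lambda>n. F (cs n x))) \<in> M2"
    and M2_rec: "F \<in> M2 \<Longrightarrow> G \<in> M2 \<Longrightarrow> \<exists>R\<in>M2. \<forall>x\<in>M1. R (cs Z x) = F x \<and>
      (\<forall>n. R (cs (S n) x) = G (cs n (cs (R (cs n x)) x)))"
    and M2_choice: "F \<in> M2 \<Longrightarrow> \<forall>x\<in>M1. \<exists>n. F (cs n x) = Z \<Longrightarrow>
      \<exists>G\<in>M2. \<forall>x\<in>M1. F (cs (G x) x) = Z"
    and M2_exists: "\<exists>\<phi>\<in>M2. \<forall>f\<in>M1. \<phi> f = Z \<longleftrightarrow> (\<exists>n. f n = Z)"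

section \<open>Closed terms for arithmetic\<close>

definition addT where "addT = lam2 (prim_rec (var 1) (var 0) (Succ \<^bold>\<cdot> var 2))"
definition multT where "multT = lam2 (prim_rec (var 1) Zero (var 2 \<^bold>+ var 0))"
definition pow2T where "pow2T = lam1 (prim_rec (var 0) (num 1) (var 2 \<^bold>+ var 2))"
definition predT where "predT = lam1 (prim_rec (var 0) Zero (var 3))"
definition monusT where "monusT = lam2 (prim_rec (var 1) (var 0) (pred (var 2)))"
definition triT where "triT = lam1 (prim_rec (var 0) Zero (var 2 \<^bold>+ Succ \<^bold>\<cdot> var 3))"
definition tri_rootT where "tri_rootT = lam1 (prim_rec (var 0) Zero
  (var 2 \<^bold>+ (num 1 \<^bold>- (tri (Succ \<^bold>\<cdot> var 2) \<^bold>- Succ \<^bold>\<cdot> var 3))))"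
definition parityT where "parityT = lam1 (prim_rec (var 0) Zero (num 1 \<^bold>- var 2))"
definition halfT where "halfT = lam1 (prim_rec (var 0) Zero (var 2 \<^bold>+ parity (var 3)))"

text \<open>In these forms the operators are closed terms, so substitution, instantiation and
  abstraction pass over them without unfolding compiled combinators.\<close>

lemma op_eqs:
  "s \<^bold>+ t = addT \<^bold>\<cdot> s \<^bold>\<cdot> t" "s \<^bold>* t = multT \<^bold>\<cdot> s \<^bold>\<cdot> t" "s \<^bold>- t = monusT \<^bold>\<cdot> s \<^bold>\<cdot> t"
  "pow2 t = pow2T \<^bold>\<cdot> t" "pred t = predT \<^bold>\<cdot> t" "tri t = triT \<^bold>\<cdot> t"
  "tri_root t = tri_rootT \<^bold>\<cdot> t" "parity t = parityT \<^bold>\<cdot> t" "half t = halfT \<^bold>\<cdot> t"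
  by (simp_all add: add_def addT_def mult_def multT_def monus_def monusT_def pow2_def pow2T_def
      pred_def predT_def Defs.tri_def triT_def tri_root_def tri_rootT_def parity_def parityT_def
      half_def halfT_def del: lam.simps)

lemma fv_num [simp]: "fv_trm (num n) = {}"
  by (induction n) auto

lemma fv_ops [simp]:
  "fv_trm addT = {}" "fv_trm multT = {}" "fv_trm monusT = {}" "fv_trm pow2T = {}" "fv_trm predT = {}"
  "fv_trm triT = {}" "fv_trm tri_rootT = {}" "fv_trm parityT = {}" "fv_trm halfT = {}"
proof -
  note [simp del] = lam.simps
  show "fv_trm addT = {}" by (auto simp: addT_def)
  note [simp] = this
  show "fv_trm multT = {}" by (auto simp: multT_def op_eqs)
  show "fv_trm pow2T = {}" by (auto simp: pow2T_def op_eqs)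
  show "fv_trm predT = {}" by (auto simp: predT_def)
  note [simp] = this
  show "fv_trm monusT = {}" by (auto simp: monusT_def op_eqs)
  note [simp] = this
  show "fv_trm triT = {}" by (auto simp: triT_def op_eqs)
  note [simp] = this
  show "fv_trm tri_rootT = {}" by (auto simp: tri_rootT_def op_eqs)
  show "fv_trm parityT = {}" by (auto simp: parityT_def op_eqs)
  note [simp] = this
  show "fv_trm halfT = {}" by (auto simp: halfT_def op_eqs)
qed

lemma has_type_ops0:
  "has_type [] addT (N \<^bold>\<rightarrow> N \<^bold>\<rightarrow> N)" "has_type [] multT (N \<^bold>\<rightarrow> N \<^bold>\<rightarrow> N)" "has_type [] monusT (N \<^bold>\<rightarrow> N \<^bold>\<rightarrow> N)"
  "has_type [] pow2T ty1" "has_type [] predT ty1" "has_type [] triT ty1" "has_type [] tri_rootT ty1"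
  "has_type [] parityT ty1" "has_type [] halfT ty1"
proof -
  note I = has_type_lam has_type_intros has_type_numeral
  show *: "has_type [] addT (N \<^bold>\<rightarrow> N \<^bold>\<rightarrow> N)" unfolding addT_def by (rule I)+
  note I = I this
  show "has_type [] multT (N \<^bold>\<rightarrow> N \<^bold>\<rightarrow> N)" unfolding multT_def op_eqs by (rule I)+
  show "has_type [] pow2T ty1" unfolding pow2T_def op_eqs by (rule I)+
  show "has_type [] predT ty1" unfolding predT_def op_eqs by (rule I)+
  note I = I this
  show "has_type [] monusT (N \<^bold>\<rightarrow> N \<^bold>\<rightarrow> N)" unfolding monusT_def op_eqs by (rule I)+
  note I = I this
  show "has_type [] triT ty1" unfolding triT_def op_eqs by (rule I)+
  note I = I this
  show "has_type [] tri_rootT ty1" unfolding tri_rootT_def op_eqs by (rule I)+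
  show "has_type [] parityT ty1" unfolding parityT_def op_eqs by (rule I)+
  note I = I this
  show "has_type [] halfT ty1" unfolding halfT_def op_eqs by (rule I)+
qed

lemmas has_type_ops = has_type_ops0[THEN has_type_weaken]

lemma has_type_simps [simp]:
  "has_type \<Gamma> f ty1 \<Longrightarrow> has_type \<Gamma> s N \<Longrightarrow> has_type \<Gamma> (f \<^bold>\<cdot> s) N"
  "has_type \<Gamma> f (N \<^bold>\<rightarrow> ty1) \<Longrightarrow> has_type \<Gamma> s N \<Longrightarrow> has_type \<Gamma> (f \<^bold>\<cdot> s) ty1"
  "has_type \<Gamma> f ty2 \<Longrightarrow> has_type \<Gamma> x ty1 \<Longrightarrow> has_type \<Gamma> (f \<^bold>\<cdot> x) N"
  "has_type \<Gamma> f (ty1 \<^bold>\<rightarrow> ty1) \<Longrightarrow> has_type \<Gamma> x ty1 \<Longrightarrow> has_type \<Gamma> (f \<^bold>\<cdot> x) ty1"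
  "has_type \<Gamma> f (N \<^bold>\<rightarrow> ty1 \<^bold>\<rightarrow> ty1) \<Longrightarrow> has_type \<Gamma> s N \<Longrightarrow> has_type \<Gamma> (f \<^bold>\<cdot> s) (ty1 \<^bold>\<rightarrow> ty1)"
  "has_type \<Gamma> f (ty1 \<^bold>\<rightarrow> N \<^bold>\<rightarrow> ty1) \<Longrightarrow> has_type \<Gamma> x ty1 \<Longrightarrow> has_type \<Gamma> (f \<^bold>\<cdot> x) (N \<^bold>\<rightarrow> ty1)"
  by (auto intro: has_type_AppI)

context term_model
begin

section \<open>Evaluation of terms defined with the recursor\<close>

lemma eqv_Rec_Zero:
  "has_type [] s N \<Longrightarrow> has_type [] r (N \<^bold>\<rightarrow> N \<^bold>\<rightarrow> N) \<Longrightarrow> eqv N (Rec \<^bold>\<cdot> Zero \<^bold>\<cdot> s \<^bold>\<cdot> r) s"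
  unfolding eqv_N
  by (rule Tr_axiom[OF RCA0\<omega>.Rec_Zero]) (auto simp: has_type.simps(8))

lemma eqv_Rec_Succ:
  "has_type [] t N \<Longrightarrow> has_type [] s N \<Longrightarrow> has_type [] r (N \<^bold>\<rightarrow> N \<^bold>\<rightarrow> N) \<Longrightarrow>
   eqv N (Rec \<^bold>\<cdot> (Succ \<^bold>\<cdot> t) \<^bold>\<cdot> s \<^bold>\<cdot> r) (r \<^bold>\<cdot> (Rec \<^bold>\<cdot> t \<^bold>\<cdot> s \<^bold>\<cdot> r) \<^bold>\<cdot> t)"
  unfolding eqv_N
  by (rule Tr_axiom[OF RCA0\<omega>.Rec_Succ]) (auto simp: has_type.simps(8))

lemma val_Rec_Zero:
  assumes "has_type [] s N" "has_type [] r (N \<^bold>\<rightarrow> N \<^bold>\<rightarrow> N)"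
  shows "val (Rec \<^bold>\<cdot> Zero \<^bold>\<cdot> s \<^bold>\<cdot> r) = val s"
  by (rule val_eqv[OF _ _ eqv_Rec_Zero]) (rule has_type_intros assms)+

lemma val_Rec_Succ:
  assumes "has_type [] t N" "has_type [] s N" "has_type [] r (N \<^bold>\<rightarrow> N \<^bold>\<rightarrow> N)"
  shows "val (Rec \<^bold>\<cdot> (Succ \<^bold>\<cdot> t) \<^bold>\<cdot> s \<^bold>\<cdot> r) = val (r \<^bold>\<cdot> (Rec \<^bold>\<cdot> t \<^bold>\<cdot> s \<^bold>\<cdot> r) \<^bold>\<cdot> t)"
  by (rule val_eqv[OF _ _ eqv_Rec_Succ]) (rule has_type_intros assms)+

lemma val_App2:
  assumes "has_type [] f (N \<^bold>\<rightarrow> N \<^bold>\<rightarrow> N)" "has_type [] s N" "has_type [] t N" "has_type [] s' N" "has_type [] t' N"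
    "val s = val s'" "val t = val t'"
  shows "val (f \<^bold>\<cdot> s \<^bold>\<cdot> t) = val (f \<^bold>\<cdot> s' \<^bold>\<cdot> t')"
proof (rule val_cong[where \<sigma> = N])
  show "eqv ty1 (f \<^bold>\<cdot> s) (f \<^bold>\<cdot> s')"
    by (rule eqv_App[where \<sigma> = N]) (use assms in \<open>auto simp: eqv_N val_eq intro: eqv_refl\<close>)
qed (use assms in \<open>auto simp: eqv_N val_eq intro: has_type_intros\<close>)

lemma sub_lam2:
  assumes "typed \<theta>" "has_type [] a \<rho>" "has_type [] b \<sigma>" "has_type [] u \<tau>"
  shows "eqv \<tau> (sub \<theta> (lam x \<rho> (lam y \<sigma> u)) \<^bold>\<cdot> a \<^bold>\<cdot> b) (sub (\<theta>((x, \<rho>) := a, (y, \<sigma>) := b)) u)"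
proof (rule eqv_trans)
  let ?\<theta> = "\<theta>((x, \<rho>) := a)"
  note T = has_type_AppI[OF has_type_AppI] has_type_AppI has_type_sub has_type_lam typed_upd assms
  show "eqv \<tau> (sub \<theta> (lam x \<rho> (lam y \<sigma> u)) \<^bold>\<cdot> a \<^bold>\<cdot> b) (sub ?\<theta> (lam y \<sigma> u) \<^bold>\<cdot> b)"
    by (rule eqv_App[OF _ _ _ _ sub_lam eqv_refl]) (rule T)+
  show "eqv \<tau> (sub ?\<theta> (lam y \<sigma> u) \<^bold>\<cdot> b) (sub (\<theta>((x, \<rho>) := a, (y, \<sigma>) := b)) u)"
    by (rule sub_lam) (rule T)+
  show "has_type [] (sub \<theta> (lam x \<rho> (lam y \<sigma> u)) \<^bold>\<cdot> a \<^bold>\<cdot> b) \<tau>"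
    "has_type [] (sub ?\<theta> (lam y \<sigma> u) \<^bold>\<cdot> b) \<tau>" "has_type [] (sub (\<theta>((x, \<rho>) := a, (y, \<sigma>) := b)) u) \<tau>"
    by (rule T)+
qed

text \<open>Variable 0 is the recursion argument. The conditions on free variables keep it out of
  \<open>z\<close> and \<open>u\<close>, so start and step are fixed closed terms and the recursor
  equations apply.\<close>

lemma rec1:
  assumes T: "T = lam1 (prim_rec (var 0) z u)"
    and "has_type [] z N" "fv_trm z = {}" "has_type [] u N" "fv_trm u \<subseteq> {(2, N), (3, N)}"
  shows "val (T \<^bold>\<cdot> Zero) = val z"
    and "has_type [] n N \<Longrightarrow> val (T \<^bold>\<cdot> (Succ \<^bold>\<cdot> n)) = val (sub (ids((2, N) := T \<^bold>\<cdot> n, (3, N) := n)) u)"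
proof -
  let ?r = "lam 2 N (lam 3 N u)"
  note I = has_type_intros has_type_lam assms(2,4) typed_upd typed_ids has_type_sub
  have Tty: "has_type [] T ty1" unfolding T by (rule I)+
  have fv: "fv_trm ?r = {}" using assms(5) by auto
  have A: "eqv N (T \<^bold>\<cdot> k) (Rec \<^bold>\<cdot> k \<^bold>\<cdot> z \<^bold>\<cdot> ?r)" if k: "has_type [] k N" for k
  proof -
    have "eqv N (sub ids T \<^bold>\<cdot> k) (sub (ids((0, N) := k)) (prim_rec (var 0) z u))"
      unfolding T by (rule sub_lam) (rule I k)+
    then show ?thesis by (simp add: sub_closed[OF fv] sub_closed[OF assms(3)] del: lam.simps)
  qed
  have B: "val (T \<^bold>\<cdot> k) = val (Rec \<^bold>\<cdot> k \<^bold>\<cdot> z \<^bold>\<cdot> ?r)" if k: "has_type [] k N" for k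
    by (rule val_eqv[OF _ _ A[OF k]]) (rule I k Tty)+
  show "val (T \<^bold>\<cdot> Zero) = val z"
    by (subst B) (rule val_Rec_Zero I)+
  assume n: "has_type [] n N"
  have "val (T \<^bold>\<cdot> (Succ \<^bold>\<cdot> n)) = val (?r \<^bold>\<cdot> (Rec \<^bold>\<cdot> n \<^bold>\<cdot> z \<^bold>\<cdot> ?r) \<^bold>\<cdot> n)"
    by (subst B, ((rule I n)+)[1], rule val_Rec_Succ) (rule I n)+
  also have "\<dots> = val (?r \<^bold>\<cdot> (T \<^bold>\<cdot> n) \<^bold>\<cdot> n)"
    by (rule val_App2) (rule I n Tty B[OF n, symmetric] HOL.refl)+
  also have "\<dots> = val (sub (ids((2, N) := T \<^bold>\<cdot> n, (3, N) := n)) u)"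
    using sub_lam2[of ids "T \<^bold>\<cdot> n" N n N u N 2 3, OF typed_ids has_type_AppI[OF Tty n] n assms(4)]
    by (intro val_eqv) ((rule I n Tty)+, simp add: sub_closed[OF fv] del: lam.simps fv_trm.simps)
  finally show "val (T \<^bold>\<cdot> (Succ \<^bold>\<cdot> n)) = \<dots>" .
qed

text \<open>Variable 0 is now a parameter, which \<open>z\<close> and \<open>u\<close> may mention,
  and variable 1 is the recursion argument. Substituting \<open>s\<close> beforehand again gives the
  recursor a fixed start and step.\<close>

lemma rec2:
  assumes T: "T = lam2 (prim_rec (var 1) z u)"
    and "has_type [] z N" "fv_trm z \<subseteq> {(0, N)}" "has_type [] u N" "fv_trm u \<subseteq> {(0, N), (2, N), (3, N)}"
    and s: "has_type [] s N"
  shows "val (T \<^bold>\<cdot> s \<^bold>\<cdot> Zero) = val (sub (ids((0, N) := s)) z)"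
    and "has_type [] n N \<Longrightarrow>
      val (T \<^bold>\<cdot> s \<^bold>\<cdot> (Succ \<^bold>\<cdot> n)) = val (sub (ids((0, N) := s, (2, N) := T \<^bold>\<cdot> s \<^bold>\<cdot> n, (3, N) := n)) u)"
proof -
  let ?\<theta> = "ids((0, N) := s)"
  let ?l = "lam 2 N (lam 3 N u)"
  let ?r = "sub ?\<theta> ?l" and ?z = "sub ?\<theta> z"
  note I = has_type_intros has_type_lam assms(2,4) typed_upd typed_ids has_type_sub s
  have Tty: "has_type [] T (N \<^bold>\<rightarrow> N \<^bold>\<rightarrow> N)" unfolding T by (rule I)+
  have A: "eqv N (T \<^bold>\<cdot> s \<^bold>\<cdot> k) (Rec \<^bold>\<cdot> k \<^bold>\<cdot> ?z \<^bold>\<cdot> ?r)" if k: "has_type [] k N" for k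
  proof -
    have "eqv N (sub ids T \<^bold>\<cdot> s \<^bold>\<cdot> k) (sub (?\<theta>((1, N) := k)) (prim_rec (var 1) z u))"
      unfolding T by (rule sub_lam2) (rule I k)+
    moreover have "sub (?\<theta>((1, N) := k)) z = ?z" "sub (?\<theta>((1, N) := k)) ?l = ?r"
      using assms(3,5) by (auto intro!: sub_agree)
    ultimately show ?thesis by (simp del: lam.simps)
  qed
  have B: "val (T \<^bold>\<cdot> s \<^bold>\<cdot> k) = val (Rec \<^bold>\<cdot> k \<^bold>\<cdot> ?z \<^bold>\<cdot> ?r)" if k: "has_type [] k N" for k
    by (rule val_eqv[OF _ _ A[OF k]]) (rule I k Tty)+
  show "val (T \<^bold>\<cdot> s \<^bold>\<cdot> Zero) = val ?z"
    by (subst B) (rule val_Rec_Zero I)+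
  assume n: "has_type [] n N"
  have "val (T \<^bold>\<cdot> s \<^bold>\<cdot> (Succ \<^bold>\<cdot> n)) = val (?r \<^bold>\<cdot> (Rec \<^bold>\<cdot> n \<^bold>\<cdot> ?z \<^bold>\<cdot> ?r) \<^bold>\<cdot> n)"
    by (subst B, ((rule I n)+)[1], rule val_Rec_Succ) (rule I n)+
  also have "\<dots> = val (?r \<^bold>\<cdot> (T \<^bold>\<cdot> s \<^bold>\<cdot> n) \<^bold>\<cdot> n)"
    by (rule val_App2) (rule I n Tty B[OF n, symmetric] HOL.refl)+
  also have "\<dots> = val (sub (?\<theta>((2, N) := T \<^bold>\<cdot> s \<^bold>\<cdot> n, (3, N) := n)) u)"
    by (rule val_eqv[OF _ _ sub_lam2]) (rule I n Tty)+
  finally show "val (T \<^bold>\<cdot> s \<^bold>\<cdot> (Succ \<^bold>\<cdot> n)) = \<dots>" .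
qed


definition val2 :: "trm \<Rightarrow> elt \<Rightarrow> elt \<Rightarrow> elt" where
  "val2 f m n = val (f \<^bold>\<cdot> rep m \<^bold>\<cdot> rep n)"

lemma val2_val:
  "has_type [] f (N \<^bold>\<rightarrow> N \<^bold>\<rightarrow> N) \<Longrightarrow> has_type [] s N \<Longrightarrow> has_type [] t N \<Longrightarrow>
   val (f \<^bold>\<cdot> s \<^bold>\<cdot> t) = val2 f (val s) (val t)"
  unfolding val2_def by (rule val_App2) auto

lemma val_ops:
  assumes "has_type [] s N" "has_type [] t N"
  shows "val (addT \<^bold>\<cdot> s \<^bold>\<cdot> t) = val2 addT (val s) (val t)" "val (multT \<^bold>\<cdot> s \<^bold>\<cdot> t) = val2 multT (val s) (val t)"
    "val (monusT \<^bold>\<cdot> s \<^bold>\<cdot> t) = val2 monusT (val s) (val t)"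
  using assms by (simp_all add: val2_val has_type_ops)

lemma val_ops1:
  assumes "has_type [] s N"
  shows "val (Succ \<^bold>\<cdot> s) = val1 Succ (val s)" "val (predT \<^bold>\<cdot> s) = val1 predT (val s)"
    "val (pow2T \<^bold>\<cdot> s) = val1 pow2T (val s)"  "val (triT \<^bold>\<cdot> s) = val1 triT (val s)"
    "val (tri_rootT \<^bold>\<cdot> s) = val1 tri_rootT (val s)" "val (parityT \<^bold>\<cdot> s) = val1 parityT (val s)"
    "val (halfT \<^bold>\<cdot> s) = val1 halfT (val s)"
  using assms by (simp_all add: val1_val has_type_ops)

lemma rec_values:
  fixes m n
  defines "Z \<equiv> val Zero" and "S \<equiv> val1 Succ"
  shows "val2 addT m Z = m" "val2 addT m (S n) = S (val2 addT m n)"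
    "val2 multT m Z = Z" "val2 multT m (S n) = val2 addT (val2 multT m n) m"
    "val2 monusT m Z = m" "val2 monusT m (S n) = val1 predT (val2 monusT m n)"
    "val1 predT Z = Z" "val1 predT (S n) = n"
    "val1 pow2T Z = S Z" "val1 pow2T (S n) = val2 addT (val1 pow2T n) (val1 pow2T n)"
    "val1 triT Z = Z" "val1 triT (S n) = val2 addT (val1 triT n) (S n)"
    "val1 tri_rootT Z = Z" "val1 tri_rootT (S n) = val2 addT (val1 tri_rootT n)
       (val2 monusT (S Z) (val2 monusT (val1 triT (S (val1 tri_rootT n))) (S n)))"
    "val1 parityT Z = Z" "val1 parityT (S n) = val2 monusT (S Z) (val1 parityT n)"
    "val1 halfT Z = Z" "val1 halfT (S n) = val2 addT (val1 halfT n) (val1 parityT n)"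
proof -
  obtain s t where st: "has_type [] s N" "has_type [] t N" and mn: "m = val s" "n = val t"
    using has_type_rep val_rep by metis
  note [simp] = has_type_ops st sub_closed val_ops val_ops1 op_eqs mn Z_def S_def
  note [simp del] = lam.simps
  show "val2 addT m Z = m"
    using rec2(1)[OF addT_def, of s] by simp
  show "val2 addT m (S n) = S (val2 addT m n)"
    using rec2(2)[OF addT_def, of s t] by simp
  show "val2 multT m Z = Z"
    using rec2(1)[OF multT_def, of s] by simp
  show "val2 multT m (S n) = val2 addT (val2 multT m n) m"
    using rec2(2)[OF multT_def, of s t] by simp
  show "val2 monusT m Z = m"
    using rec2(1)[OF monusT_def, of s] by simp
  show "val2 monusT m (S n) = val1 predT (val2 monusT m n)"
    using rec2(2)[OF monusT_def, of s t] by simp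
  show "val1 predT Z = Z"
    using rec1(1)[OF predT_def] by simp
  show "val1 predT (S n) = n"
    using rec1(2)[OF predT_def, of t] by simp
  show "val1 pow2T Z = S Z"
    using rec1(1)[OF pow2T_def] by simp
  show "val1 pow2T (S n) = val2 addT (val1 pow2T n) (val1 pow2T n)"
    using rec1(2)[OF pow2T_def, of t] by simp
  show "val1 triT Z = Z"
    using rec1(1)[OF triT_def] by simp
  show "val1 triT (S n) = val2 addT (val1 triT n) (S n)"
    using rec1(2)[OF triT_def, of t] by simp
  show "val1 tri_rootT Z = Z"
    using rec1(1)[OF tri_rootT_def] by simp
  show "val1 tri_rootT (S n) = val2 addT (val1 tri_rootT n)
       (val2 monusT (S Z) (val2 monusT (val1 triT (S (val1 tri_rootT n))) (S n)))"
    using rec1(2)[OF tri_rootT_def, of t] by simp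
  show "val1 parityT Z = Z"
    using rec1(1)[OF parityT_def] by simp
  show "val1 parityT (S n) = val2 monusT (S Z) (val1 parityT n)"
    using rec1(2)[OF parityT_def, of t] by simp
  show "val1 halfT Z = Z"
    using rec1(1)[OF halfT_def] by simp
  show "val1 halfT (S n) = val2 addT (val1 halfT n) (val1 parityT n)"
    using rec1(2)[OF halfT_def, of t] by simp
qed

subsection \<open>Combinatory completeness\<close>

text \<open>The operation \<open>F\<close> on terms is represented by an object of the model up to
  equality. The closure rules below act on such operations directly, so later constructions do not
  have to choose variable names and compile them with \<open>lam\<close>.\<close>

definition int1 :: "ty \<Rightarrow> ty \<Rightarrow> (trm \<Rightarrow> trm) \<Rightarrow> bool" where
  "int1 \<rho> \<tau> F \<longleftrightarrow> (\<exists>t. has_type [] t (\<rho> \<^bold>\<rightarrow> \<tau>) \<and>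
     (\<forall>a. has_type [] a \<rho> \<longrightarrow> has_type [] (F a) \<tau> \<and> eqv \<tau> (t \<^bold>\<cdot> a) (F a)))"

definition int2 :: "ty \<Rightarrow> ty \<Rightarrow> ty \<Rightarrow> (trm \<Rightarrow> trm \<Rightarrow> trm) \<Rightarrow> bool" where
  "int2 \<rho> \<sigma> \<tau> F \<longleftrightarrow> (\<exists>t. has_type [] t (\<rho> \<^bold>\<rightarrow> \<sigma> \<^bold>\<rightarrow> \<tau>) \<and>
     (\<forall>a b. has_type [] a \<rho> \<longrightarrow> has_type [] b \<sigma> \<longrightarrow> has_type [] (F a b) \<tau> \<and> eqv \<tau> (t \<^bold>\<cdot> a \<^bold>\<cdot> b) (F a b)))"

definition int3 :: "ty \<Rightarrow> ty \<Rightarrow> ty \<Rightarrow> ty \<Rightarrow> (trm \<Rightarrow> trm \<Rightarrow> trm \<Rightarrow> trm) \<Rightarrow> bool" where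
  "int3 \<rho> \<sigma> \<upsilon> \<tau> F \<longleftrightarrow> (\<exists>t. has_type [] t (\<rho> \<^bold>\<rightarrow> \<sigma> \<^bold>\<rightarrow> \<upsilon> \<^bold>\<rightarrow> \<tau>) \<and>
     (\<forall>a b c. has_type [] a \<rho> \<longrightarrow> has_type [] b \<sigma> \<longrightarrow> has_type [] c \<upsilon> \<longrightarrow>
        has_type [] (F a b c) \<tau> \<and> eqv \<tau> (t \<^bold>\<cdot> a \<^bold>\<cdot> b \<^bold>\<cdot> c) (F a b c)))"

lemma int1_const: "has_type [] c \<tau> \<Longrightarrow> int1 \<rho> \<tau> (\<lambda>a. c)"
  unfolding int1_def
  by (rule exI[of _ "Pi \<tau> \<rho> \<^bold>\<cdot> c"]) (auto intro: has_type_intros eqv_Pi)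

lemma int1_id: "int1 \<rho> \<rho> (\<lambda>a. a)"
  unfolding int1_def
  by (rule exI[of _ "Sg \<rho> (\<rho> \<^bold>\<rightarrow> \<rho>) \<rho> \<^bold>\<cdot> Pi \<rho> (\<rho> \<^bold>\<rightarrow> \<rho>) \<^bold>\<cdot> Pi \<rho> \<rho>"])
    (auto intro: eqv_identity has_type_intros)

lemma int1_app:
  assumes "int1 \<rho> (\<sigma> \<^bold>\<rightarrow> \<tau>) F" "int1 \<rho> \<sigma> G"
  shows "int1 \<rho> \<tau> (\<lambda>a. F a \<^bold>\<cdot> G a)"
proof -
  obtain f g where f: "has_type [] f (\<rho> \<^bold>\<rightarrow> \<sigma> \<^bold>\<rightarrow> \<tau>)" "\<And>a. has_type [] a \<rho> \<Longrightarrow> has_type [] (F a) (\<sigma> \<^bold>\<rightarrow> \<tau>)"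
      "\<And>a. has_type [] a \<rho> \<Longrightarrow> eqv (\<sigma> \<^bold>\<rightarrow> \<tau>) (f \<^bold>\<cdot> a) (F a)"
    and g: "has_type [] g (\<rho> \<^bold>\<rightarrow> \<sigma>)" "\<And>a. has_type [] a \<rho> \<Longrightarrow> has_type [] (G a) \<sigma>"
      "\<And>a. has_type [] a \<rho> \<Longrightarrow> eqv \<sigma> (g \<^bold>\<cdot> a) (G a)"
    using assms unfolding int1_def by metis
  show ?thesis
    unfolding int1_def
  proof (rule exI[of _ "Sg \<rho> \<sigma> \<tau> \<^bold>\<cdot> f \<^bold>\<cdot> g"], intro conjI allI impI)
    fix a assume a: "has_type [] a \<rho>"
    note I = has_type_intros f g a
    show "has_type [] (F a \<^bold>\<cdot> G a) \<tau>" by (rule I)+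
    show "eqv \<tau> (Sg \<rho> \<sigma> \<tau> \<^bold>\<cdot> f \<^bold>\<cdot> g \<^bold>\<cdot> a) (F a \<^bold>\<cdot> G a)"
    proof (rule eqv_trans[OF _ _ _ eqv_Sg])
      show "eqv \<tau> (f \<^bold>\<cdot> a \<^bold>\<cdot> (g \<^bold>\<cdot> a)) (F a \<^bold>\<cdot> G a)"
        by (rule eqv_App[OF _ _ _ _ f(3) g(3)]) (rule I)+
    qed (rule I)+
  qed (rule has_type_intros f g)+
qed

lemma int2I:
  assumes "int1 \<rho> (\<sigma> \<^bold>\<rightarrow> \<tau>) F"
    "\<And>a b. has_type [] a \<rho> \<Longrightarrow> has_type [] b \<sigma> \<Longrightarrow> has_type [] (G a b) \<tau>"
    "\<And>a b. has_type [] a \<rho> \<Longrightarrow> has_type [] b \<sigma> \<Longrightarrow> eqv \<tau> (F a \<^bold>\<cdot> b) (G a b)"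
  shows "int2 \<rho> \<sigma> \<tau> G"
proof -
  obtain f where f: "has_type [] f (\<rho> \<^bold>\<rightarrow> \<sigma> \<^bold>\<rightarrow> \<tau>)" "\<And>a. has_type [] a \<rho> \<Longrightarrow> has_type [] (F a) (\<sigma> \<^bold>\<rightarrow> \<tau>)"
      "\<And>a. has_type [] a \<rho> \<Longrightarrow> eqv (\<sigma> \<^bold>\<rightarrow> \<tau>) (f \<^bold>\<cdot> a) (F a)"
    using assms(1) unfolding int1_def by metis
  have "eqv \<tau> (f \<^bold>\<cdot> a \<^bold>\<cdot> b) (G a b)" if ab: "has_type [] a \<rho>" "has_type [] b \<sigma>" for a b
  proof (rule eqv_trans[OF _ _ _ _ assms(3)[OF ab]])
    show "eqv \<tau> (f \<^bold>\<cdot> a \<^bold>\<cdot> b) (F a \<^bold>\<cdot> b)"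
      by (rule eqv_App[OF _ _ _ _ f(3) eqv_refl]) (rule has_type_intros f ab)+
  qed (rule has_type_intros f ab assms(2))+
  then show ?thesis using f(1) assms(2) unfolding int2_def by blast
qed

lemma int3I:
  assumes "int2 \<rho> \<sigma> (\<upsilon> \<^bold>\<rightarrow> \<tau>) F"
    "\<And>a b c. has_type [] a \<rho> \<Longrightarrow> has_type [] b \<sigma> \<Longrightarrow> has_type [] c \<upsilon> \<Longrightarrow> has_type [] (G a b c) \<tau>"
    "\<And>a b c. has_type [] a \<rho> \<Longrightarrow> has_type [] b \<sigma> \<Longrightarrow> has_type [] c \<upsilon> \<Longrightarrow> eqv \<tau> (F a b \<^bold>\<cdot> c) (G a b c)"
  shows "int3 \<rho> \<sigma> \<upsilon> \<tau> G"
proof -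
  obtain f where f: "has_type [] f (\<rho> \<^bold>\<rightarrow> \<sigma> \<^bold>\<rightarrow> \<upsilon> \<^bold>\<rightarrow> \<tau>)"
      "\<And>a b. has_type [] a \<rho> \<Longrightarrow> has_type [] b \<sigma> \<Longrightarrow> has_type [] (F a b) (\<upsilon> \<^bold>\<rightarrow> \<tau>)"
      "\<And>a b. has_type [] a \<rho> \<Longrightarrow> has_type [] b \<sigma> \<Longrightarrow> eqv (\<upsilon> \<^bold>\<rightarrow> \<tau>) (f \<^bold>\<cdot> a \<^bold>\<cdot> b) (F a b)"
    using assms(1) unfolding int2_def by metis
  have "eqv \<tau> (f \<^bold>\<cdot> a \<^bold>\<cdot> b \<^bold>\<cdot> c) (G a b c)"
    if abc: "has_type [] a \<rho>" "has_type [] b \<sigma>" "has_type [] c \<upsilon>" for a b c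
  proof (rule eqv_trans[OF _ _ _ _ assms(3)[OF abc]])
    show "eqv \<tau> (f \<^bold>\<cdot> a \<^bold>\<cdot> b \<^bold>\<cdot> c) (F a b \<^bold>\<cdot> c)"
      by (rule eqv_App[OF _ _ _ _ f(3) eqv_refl]) (rule has_type_intros f abc)+
  qed (rule has_type_intros f abc assms(2))+
  then show ?thesis using f(1) assms(2) unfolding int3_def by blast
qed

lemma int1_type: "int1 \<rho> \<tau> F \<Longrightarrow> has_type [] a \<rho> \<Longrightarrow> has_type [] (F a) \<tau>"
  unfolding int1_def by blast

lemma int2_type: "int2 \<rho> \<sigma> \<tau> F \<Longrightarrow> has_type [] a \<rho> \<Longrightarrow> has_type [] b \<sigma> \<Longrightarrow> has_type [] (F a b) \<tau>"
  unfolding int2_def by blast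

lemma int2_1: "int1 \<rho> \<tau> F \<Longrightarrow> int2 \<rho> \<sigma> \<tau> (\<lambda>a b. F a)"
  by (rule int2I[OF int1_app[OF int1_const[of "Pi \<tau> \<sigma>"]]])
    (auto intro: has_type_intros eqv_Pi int1_type)

lemma int2_2: "int2 \<rho> \<sigma> \<sigma> (\<lambda>a b. b)"
  by (rule int2I[OF int1_const[of "Sg \<sigma> (\<sigma> \<^bold>\<rightarrow> \<sigma>) \<sigma> \<^bold>\<cdot> Pi \<sigma> (\<sigma> \<^bold>\<rightarrow> \<sigma>) \<^bold>\<cdot> Pi \<sigma> \<sigma>"]])
    (auto intro: eqv_identity has_type_intros)

lemma int2_app:
  assumes "int2 \<rho> \<sigma> (\<upsilon> \<^bold>\<rightarrow> \<tau>) F" "int2 \<rho> \<sigma> \<upsilon> G"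
  shows "int2 \<rho> \<sigma> \<tau> (\<lambda>a b. F a b \<^bold>\<cdot> G a b)"
proof -
  obtain f where f: "has_type [] f (\<rho> \<^bold>\<rightarrow> \<sigma> \<^bold>\<rightarrow> \<upsilon> \<^bold>\<rightarrow> \<tau>)"
      "\<And>a b. has_type [] a \<rho> \<Longrightarrow> has_type [] b \<sigma> \<Longrightarrow> has_type [] (F a b) (\<upsilon> \<^bold>\<rightarrow> \<tau>)"
      "\<And>a b. has_type [] a \<rho> \<Longrightarrow> has_type [] b \<sigma> \<Longrightarrow> eqv (\<upsilon> \<^bold>\<rightarrow> \<tau>) (f \<^bold>\<cdot> a \<^bold>\<cdot> b) (F a b)"
    using assms(1) unfolding int2_def by metis
  obtain g where g: "has_type [] g (\<rho> \<^bold>\<rightarrow> \<sigma> \<^bold>\<rightarrow> \<upsilon>)"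
      "\<And>a b. has_type [] a \<rho> \<Longrightarrow> has_type [] b \<sigma> \<Longrightarrow> has_type [] (G a b) \<upsilon>"
      "\<And>a b. has_type [] a \<rho> \<Longrightarrow> has_type [] b \<sigma> \<Longrightarrow> eqv \<upsilon> (g \<^bold>\<cdot> a \<^bold>\<cdot> b) (G a b)"
    using assms(2) unfolding int2_def by metis
  show ?thesis
  proof (rule int2I[where F = "\<lambda>a. Sg \<sigma> \<upsilon> \<tau> \<^bold>\<cdot> (f \<^bold>\<cdot> a) \<^bold>\<cdot> (g \<^bold>\<cdot> a)"])
    show "int1 \<rho> (\<sigma> \<^bold>\<rightarrow> \<tau>) (\<lambda>a. Sg \<sigma> \<upsilon> \<tau> \<^bold>\<cdot> (f \<^bold>\<cdot> a) \<^bold>\<cdot> (g \<^bold>\<cdot> a))"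
      by (rule int1_app int1_const int1_id has_type_intros f g)+
    fix a b assume ab: "has_type [] a \<rho>" "has_type [] b \<sigma>"
    note I = has_type_intros f g ab
    show "has_type [] (F a b \<^bold>\<cdot> G a b) \<tau>" by (rule I)+
    show "eqv \<tau> (Sg \<sigma> \<upsilon> \<tau> \<^bold>\<cdot> (f \<^bold>\<cdot> a) \<^bold>\<cdot> (g \<^bold>\<cdot> a) \<^bold>\<cdot> b) (F a b \<^bold>\<cdot> G a b)"
    proof (rule eqv_trans[OF _ _ _ eqv_Sg])
      show "eqv \<tau> (f \<^bold>\<cdot> a \<^bold>\<cdot> b \<^bold>\<cdot> (g \<^bold>\<cdot> a \<^bold>\<cdot> b)) (F a b \<^bold>\<cdot> G a b)"
        by (rule eqv_App[OF _ _ _ _ f(3) g(3)]) (rule I)+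
    qed (rule I)+
  qed
qed

lemma int3_12: "int2 \<rho> \<sigma> \<tau> F \<Longrightarrow> int3 \<rho> \<sigma> \<upsilon> \<tau> (\<lambda>a b c. F a b)"
  by (rule int3I[OF int2_app[OF int2_1[OF int1_const[of "Pi \<tau> \<upsilon>"]]]])
    (auto intro: has_type_intros eqv_Pi int2_type)

lemma int3_3: "int3 \<rho> \<sigma> \<upsilon> \<upsilon> (\<lambda>a b c. c)"
  by (rule int3I[OF int2_1[OF int1_const[of "Sg \<upsilon> (\<upsilon> \<^bold>\<rightarrow> \<upsilon>) \<upsilon> \<^bold>\<cdot> Pi \<upsilon> (\<upsilon> \<^bold>\<rightarrow> \<upsilon>) \<^bold>\<cdot> Pi \<upsilon> \<upsilon>"]]])
    (auto intro: eqv_identity has_type_intros)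

lemma int3_app:
  assumes "int3 \<rho> \<sigma> \<upsilon> (\<chi> \<^bold>\<rightarrow> \<tau>) F" "int3 \<rho> \<sigma> \<upsilon> \<chi> G"
  shows "int3 \<rho> \<sigma> \<upsilon> \<tau> (\<lambda>a b c. F a b c \<^bold>\<cdot> G a b c)"
proof -
  obtain f where f: "has_type [] f (\<rho> \<^bold>\<rightarrow> \<sigma> \<^bold>\<rightarrow> \<upsilon> \<^bold>\<rightarrow> \<chi> \<^bold>\<rightarrow> \<tau>)"
      "\<And>a b c. has_type [] a \<rho> \<Longrightarrow> has_type [] b \<sigma> \<Longrightarrow> has_type [] c \<upsilon> \<Longrightarrow> has_type [] (F a b c) (\<chi> \<^bold>\<rightarrow> \<tau>)"
      "\<And>a b c. has_type [] a \<rho> \<Longrightarrow> has_type [] b \<sigma> \<Longrightarrow> has_type [] c \<upsilon> \<Longrightarrow>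
         eqv (\<chi> \<^bold>\<rightarrow> \<tau>) (f \<^bold>\<cdot> a \<^bold>\<cdot> b \<^bold>\<cdot> c) (F a b c)"
    using assms(1) unfolding int3_def by metis
  obtain g where g: "has_type [] g (\<rho> \<^bold>\<rightarrow> \<sigma> \<^bold>\<rightarrow> \<upsilon> \<^bold>\<rightarrow> \<chi>)"
      "\<And>a b c. has_type [] a \<rho> \<Longrightarrow> has_type [] b \<sigma> \<Longrightarrow> has_type [] c \<upsilon> \<Longrightarrow> has_type [] (G a b c) \<chi>"
      "\<And>a b c. has_type [] a \<rho> \<Longrightarrow> has_type [] b \<sigma> \<Longrightarrow> has_type [] c \<upsilon> \<Longrightarrow>
         eqv \<chi> (g \<^bold>\<cdot> a \<^bold>\<cdot> b \<^bold>\<cdot> c) (G a b c)"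
    using assms(2) unfolding int3_def by metis
  show ?thesis
  proof (rule int3I[where F = "\<lambda>a b. Sg \<upsilon> \<chi> \<tau> \<^bold>\<cdot> (f \<^bold>\<cdot> a \<^bold>\<cdot> b) \<^bold>\<cdot> (g \<^bold>\<cdot> a \<^bold>\<cdot> b)"])
    have const: "int2 \<rho> \<sigma> \<phi> (\<lambda>a b. c)" if "has_type [] c \<phi>" for c \<phi>
      by (rule int2_1[OF int1_const[OF that]])
    have fst: "int2 \<rho> \<sigma> \<rho> (\<lambda>a b. a)" by (rule int2_1[OF int1_id])
    show "int2 \<rho> \<sigma> (\<upsilon> \<^bold>\<rightarrow> \<tau>) (\<lambda>a b. Sg \<upsilon> \<chi> \<tau> \<^bold>\<cdot> (f \<^bold>\<cdot> a \<^bold>\<cdot> b) \<^bold>\<cdot> (g \<^bold>\<cdot> a \<^bold>\<cdot> b))"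
      by (rule int2_app int2_2 fst const has_type_intros f g)+
    fix a b c assume ab: "has_type [] a \<rho>" "has_type [] b \<sigma>" "has_type [] c \<upsilon>"
    note I = has_type_intros f g ab
    show "has_type [] (F a b c \<^bold>\<cdot> G a b c) \<tau>" by (rule I)+
    show "eqv \<tau> (Sg \<upsilon> \<chi> \<tau> \<^bold>\<cdot> (f \<^bold>\<cdot> a \<^bold>\<cdot> b) \<^bold>\<cdot> (g \<^bold>\<cdot> a \<^bold>\<cdot> b) \<^bold>\<cdot> c) (F a b c \<^bold>\<cdot> G a b c)"
    proof (rule eqv_trans[OF _ _ _ eqv_Sg])
      show "eqv \<tau> (f \<^bold>\<cdot> a \<^bold>\<cdot> b \<^bold>\<cdot> c \<^bold>\<cdot> (g \<^bold>\<cdot> a \<^bold>\<cdot> b \<^bold>\<cdot> c)) (F a b c \<^bold>\<cdot> G a b c)"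
        by (rule eqv_App[OF _ _ _ _ f(3) g(3)]) (rule I)+
    qed (rule I)+
  qed
qed

end

lemma abstr_trm_fresh: "(x, \<rho>) \<notin> fv_trm t \<Longrightarrow> abstr_trm k x \<rho> t = t"
  by (induction t) auto

lemma has_type_abstr: "has_type \<Gamma> t \<tau> \<Longrightarrow> has_type (\<Gamma> @ [\<rho>]) (abstr_trm (length \<Gamma>) x \<rho> t) \<tau>"
  by (induction t arbitrary: \<tau>) (auto simp: nth_append has_type.simps(8))

lemma wff_abstr: "wff \<Gamma> A \<Longrightarrow> wff (\<Gamma> @ [\<rho>]) (abstr (length \<Gamma>) x \<rho> A)"
proof (induction A arbitrary: \<Gamma>)
  case (All \<sigma> A)
  then show ?case using All.IH[of "\<sigma> # \<Gamma>"] by simp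
qed (auto intro: has_type_abstr)

lemma wff_ALL': "wff [] A \<Longrightarrow> wff [] (ALL' x \<rho> A)"
  using wff_abstr[of "[]" A \<rho> x] by (simp add: ALL'_def)

lemma wff_subst: "wff [] A \<Longrightarrow> has_type [] t \<rho> \<Longrightarrow> wff [] (subst x \<rho> t A)"
  using wff_ALL'[of A x \<rho>] wff_inst0[of \<rho> "abstr 0 x \<rho> A" t] by (simp add: subst_def ALL'_def)

lemma has_type_Cons: "has_type [] t \<tau> \<Longrightarrow> has_type (\<rho> # \<Gamma>) t \<tau>"
  by (rule has_type_weaken)

lemmas inst_ops [simp] = has_type_ops0[THEN inst_trm_closed]

context term_model
begin

lemma Tr_Neg: "wff [] A \<Longrightarrow> Tr (Neg A) \<longleftrightarrow> \<not> Tr A"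
  by (simp add: Tr_Imp)

lemma Tr_Con: "wff [] A \<Longrightarrow> wff [] B \<Longrightarrow> Tr (A \<^bold>\<and> B) \<longleftrightarrow> Tr A \<and> Tr B"
  by (simp add: Tr_Imp)

lemma Tr_Eq: "has_type [] s N \<Longrightarrow> has_type [] t N \<Longrightarrow> Tr (s \<^bold>= t) \<longleftrightarrow> val s = val t"
  by (simp add: val_eq)

lemma Tr_ALL': "wff [] A \<Longrightarrow> Tr (ALL' x \<rho> A) \<longleftrightarrow> (\<forall>t. has_type [] t \<rho> \<longrightarrow> Tr (subst x \<rho> t A))"
  using wff_ALL'[of A x \<rho>] by (simp add: ALL'_def Tr_All subst_def)

section \<open>Objects of type 1 and 2 and their closure properties\<close>

definition M1 :: "(elt \<Rightarrow> elt) set" where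
  "M1 = val1 ` {f. has_type [] f ty1}"

definition M2 :: "((elt \<Rightarrow> elt) \<Rightarrow> elt) set" where
  "M2 = {F. \<exists>t. has_type [] t ty2 \<and> (\<forall>s. has_type [] s ty1 \<longrightarrow> F (val1 s) = val (t \<^bold>\<cdot> s))}"

lemma M1I: "has_type [] f ty1 \<Longrightarrow> val1 f \<in> M1"
  by (simp add: M1_def)

lemma M1E:
  assumes "f \<in> M1"
  obtains t where "has_type [] t ty1" "f = val1 t"
  using assms by (auto simp: M1_def)

lemma M2I:
  assumes "int1 ty1 N F" "\<And>s. has_type [] s ty1 \<Longrightarrow> G (val1 s) = val (F s)"
  shows "G \<in> M2"
proof -
  obtain t where t: "has_type [] t ty2" "\<And>s. has_type [] s ty1 \<Longrightarrow> has_type [] (F s) N"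
      "\<And>s. has_type [] s ty1 \<Longrightarrow> eqv N (t \<^bold>\<cdot> s) (F s)"
    using assms(1) unfolding int1_def by metis
  then have "val (t \<^bold>\<cdot> s) = val (F s)" if "has_type [] s ty1" for s
    by (rule_tac val_eqv) (use that in auto)
  then show ?thesis using t(1) assms(2) by (auto simp: M2_def)
qed

lemma M2E:
  assumes "F \<in> M2"
  obtains t where "has_type [] t ty2" "\<And>s. has_type [] s ty1 \<Longrightarrow> F (val1 s) = val (t \<^bold>\<cdot> s)"
  using assms by (auto simp: M2_def)

text \<open>By extensionality \<open>t\<close> gives equal values on arguments with the same
  \<open>val1\<close>, so it induces a functional on \<open>M1\<close>.\<close>

lemma M2_term:
  assumes "has_type [] t ty2"
  obtains F where "F \<in> M2" "\<And>s. has_type [] s ty1 \<Longrightarrow> F (val1 s) = val (t \<^bold>\<cdot> s)"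
proof -
  define F where "F f = val (t \<^bold>\<cdot> (SOME s. has_type [] s ty1 \<and> val1 s = f))" for f
  have F: "F (val1 s) = val (t \<^bold>\<cdot> s)" if s: "has_type [] s ty1" for s
  proof -
    define s' where "s' = (SOME s'. has_type [] s' ty1 \<and> val1 s' = val1 s)"
    have "\<exists>s'. has_type [] s' ty1 \<and> val1 s' = val1 s" using s by auto
    then have s': "has_type [] s' ty1 \<and> val1 s' = val1 s" unfolding s'_def by (rule someI_ex)
    then have "val (t \<^bold>\<cdot> s') = val (t \<^bold>\<cdot> s)"
      using val_cong[OF assms assms _ s eqv_refl[OF assms], of s'] val1_eq[of s' s] s by simp
    then show ?thesis by (simp add: F_def s'_def)
  qed
  with assms have "F \<in> M2" by (auto simp: M2_def)
  then show thesis using F that by blast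
qed

lemma val1_cong: "has_type [] f ty1 \<Longrightarrow> has_type [] g ty1 \<Longrightarrow> eqv ty1 f g \<Longrightarrow> val1 f = val1 g"
  by (simp add: val1_eq)

text \<open>\<open>Pi ty1 N\<close> applied to \<open>f\<close> is a step function that forgets the
  previous value and applies \<open>f\<close> to the counter. The recursor thus returns
  \<open>n\<close> at zero and the value of \<open>f\<close> at \<open>k\<close> for the successor
  of \<open>k\<close>.\<close>

lemma consT_exists:
  "\<exists>t. has_type [] t (N \<^bold>\<rightarrow> ty1 \<^bold>\<rightarrow> ty1) \<and> (\<forall>n f k. has_type [] n N \<longrightarrow> has_type [] f ty1 \<longrightarrow> has_type [] k N \<longrightarrow>
     val (t \<^bold>\<cdot> n \<^bold>\<cdot> f \<^bold>\<cdot> k) = val (Rec \<^bold>\<cdot> k \<^bold>\<cdot> n \<^bold>\<cdot> (Pi ty1 N \<^bold>\<cdot> f)))"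
proof -
  have 1: "int3 N ty1 N N (\<lambda>n f k. n)"
    by (rule int3_12[OF int2_1[OF int1_id]])
  have 2: "int3 N ty1 N ty1 (\<lambda>n f k. f)"
    by (rule int3_12[OF int2_2])
  have C: "int3 N ty1 N \<tau> (\<lambda>n f k. c)" if "has_type [] c \<tau>" for c \<tau>
    by (rule int3_12[OF int2_1[OF int1_const[OF that]]])
  have "int3 N ty1 N N (\<lambda>n f k. Rec \<^bold>\<cdot> k \<^bold>\<cdot> n \<^bold>\<cdot> (Pi ty1 N \<^bold>\<cdot> f))"
    by (rule int3_app 1 2 int3_3 C has_type_intros)+
  then obtain t where t: "has_type [] t (N \<^bold>\<rightarrow> ty1 \<^bold>\<rightarrow> ty1)"
    "\<And>n f k. has_type [] n N \<Longrightarrow> has_type [] f ty1 \<Longrightarrow> has_type [] k N \<Longrightarrow>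
       has_type [] (Rec \<^bold>\<cdot> k \<^bold>\<cdot> n \<^bold>\<cdot> (Pi ty1 N \<^bold>\<cdot> f)) N \<and>
       eqv N (t \<^bold>\<cdot> n \<^bold>\<cdot> f \<^bold>\<cdot> k) (Rec \<^bold>\<cdot> k \<^bold>\<cdot> n \<^bold>\<cdot> (Pi ty1 N \<^bold>\<cdot> f))"
    unfolding int3_def by metis
  have "val (t \<^bold>\<cdot> n \<^bold>\<cdot> f \<^bold>\<cdot> k) = val (Rec \<^bold>\<cdot> k \<^bold>\<cdot> n \<^bold>\<cdot> (Pi ty1 N \<^bold>\<cdot> f))"
    if "has_type [] n N" "has_type [] f ty1" "has_type [] k N" for n f k
    using t(1) t(2)[OF that] that by (intro val_eqv) auto
  with t(1) show ?thesis by blast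
qed

definition consT :: trm where
  "consT = (SOME t. has_type [] t (N \<^bold>\<rightarrow> ty1 \<^bold>\<rightarrow> ty1) \<and>
     (\<forall>n f k. has_type [] n N \<longrightarrow> has_type [] f ty1 \<longrightarrow> has_type [] k N \<longrightarrow>
       val (t \<^bold>\<cdot> n \<^bold>\<cdot> f \<^bold>\<cdot> k) = val (Rec \<^bold>\<cdot> k \<^bold>\<cdot> n \<^bold>\<cdot> (Pi ty1 N \<^bold>\<cdot> f))))"

lemma has_type_consT [simp]: "has_type [] consT (N \<^bold>\<rightarrow> ty1 \<^bold>\<rightarrow> ty1)"
  and val_consT: "has_type [] n N \<Longrightarrow> has_type [] f ty1 \<Longrightarrow> has_type [] k N \<Longrightarrow>
       val (consT \<^bold>\<cdot> n \<^bold>\<cdot> f \<^bold>\<cdot> k) = val (Rec \<^bold>\<cdot> k \<^bold>\<cdot> n \<^bold>\<cdot> (Pi ty1 N \<^bold>\<cdot> f))"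
  using someI_ex[OF consT_exists] unfolding consT_def[symmetric] by auto

lemma has_type_PiN [simp]: "has_type [] f ty1 \<Longrightarrow> has_type [] (Pi ty1 N \<^bold>\<cdot> f) (N \<^bold>\<rightarrow> N \<^bold>\<rightarrow> N)"
  by (rule has_type_AppI[OF has_type_const(4)])

lemma val_consT_Zero: "has_type [] n N \<Longrightarrow> has_type [] f ty1 \<Longrightarrow> val (consT \<^bold>\<cdot> n \<^bold>\<cdot> f \<^bold>\<cdot> Zero) = val n"
  by (simp add: val_consT val_Rec_Zero)

lemma val_consT_Succ:
  assumes "has_type [] n N" "has_type [] f ty1" "has_type [] k N"
  shows "val (consT \<^bold>\<cdot> n \<^bold>\<cdot> f \<^bold>\<cdot> (Succ \<^bold>\<cdot> k)) = val (f \<^bold>\<cdot> k)"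
proof -
  let ?r = "Pi ty1 N \<^bold>\<cdot> f"
  have R: "has_type [] (Rec \<^bold>\<cdot> k \<^bold>\<cdot> n \<^bold>\<cdot> ?r) N" by (rule has_type_intros assms)+
  have "val (consT \<^bold>\<cdot> n \<^bold>\<cdot> f \<^bold>\<cdot> (Succ \<^bold>\<cdot> k)) = val (?r \<^bold>\<cdot> (Rec \<^bold>\<cdot> k \<^bold>\<cdot> n \<^bold>\<cdot> ?r) \<^bold>\<cdot> k)"
    using assms by (simp add: val_consT val_Rec_Succ)
  also have "\<dots> = val (f \<^bold>\<cdot> k)"
    by (rule val_cong[OF _ _ _ _ eqv_Pi eqv_refl]) (rule has_type_intros assms R)+
  finally show ?thesis .
qed

definition cs :: "elt \<Rightarrow> (elt \<Rightarrow> elt) \<Rightarrow> elt \<Rightarrow> elt" where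
  "cs n f = val1 (consT \<^bold>\<cdot> rep n \<^bold>\<cdot> (SOME t. has_type [] t ty1 \<and> val1 t = f))"

lemma val1_consT:
  assumes "has_type [] n N" "has_type [] f ty1"
  shows "val1 (consT \<^bold>\<cdot> n \<^bold>\<cdot> f) = cs (val n) (val1 f)"
proof -
  define g where "g = (SOME t. has_type [] t ty1 \<and> val1 t = val1 f)"
  have "\<exists>t. has_type [] t ty1 \<and> val1 t = val1 f" using assms by auto
  then have g: "has_type [] g ty1 \<and> val1 g = val1 f" unfolding g_def by (rule someI_ex)
  have "eqv ty1 (consT \<^bold>\<cdot> rep (val n) \<^bold>\<cdot> g) (consT \<^bold>\<cdot> n \<^bold>\<cdot> f)"
    by (rule eqv_App[where \<sigma> = ty1, OF _ _ _ _ eqv_App[where \<sigma> = N]])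
      (use g assms in \<open>auto simp: val1_eq intro: eqv_refl eqv_rep\<close>)
  then have "val1 (consT \<^bold>\<cdot> rep (val n) \<^bold>\<cdot> g) = val1 (consT \<^bold>\<cdot> n \<^bold>\<cdot> f)"
    by (rule val1_cong[rotated 2]) (use g assms in auto)
  then show ?thesis by (simp add: cs_def g_def)
qed

text \<open>The section is obtained by one term uniformly in \<open>s\<close>. Both substitution
  into functionals and the use of the choice axiom rely on this uniformity.\<close>

lemma section_term:
  assumes "F \<in> M2"
  obtains h where "has_type [] h (ty1 \<^bold>\<rightarrow> ty1)"
    "\<And>s. has_type [] s ty1 \<Longrightarrow> val1 (h \<^bold>\<cdot> s) = (\<lambda>n. F (cs n (val1 s)))"
proof -
  obtain t where t: "has_type [] t ty2" "\<And>s. has_type [] s ty1 \<Longrightarrow> F (val1 s) = val (t \<^bold>\<cdot> s)"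
    using M2E[OF assms] by blast
  have "int2 ty1 N N (\<lambda>s n. t \<^bold>\<cdot> (consT \<^bold>\<cdot> n \<^bold>\<cdot> s))"
    by (rule int2_app int2_2 int2_1[OF int1_id] int2_1[OF int1_const] t has_type_consT)+
  then obtain h where h: "has_type [] h (ty1 \<^bold>\<rightarrow> ty1)"
    "\<And>s n. has_type [] s ty1 \<Longrightarrow> has_type [] n N \<Longrightarrow> eqv N (h \<^bold>\<cdot> s \<^bold>\<cdot> n) (t \<^bold>\<cdot> (consT \<^bold>\<cdot> n \<^bold>\<cdot> s))"
    unfolding int2_def by blast
  have "val1 (h \<^bold>\<cdot> s) n = F (cs n (val1 s))" if s: "has_type [] s ty1" for s n
  proof -
    have "val (h \<^bold>\<cdot> s \<^bold>\<cdot> rep n) = val (t \<^bold>\<cdot> (consT \<^bold>\<cdot> rep n \<^bold>\<cdot> s))"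
      by (rule val_eqv[OF _ _ h(2)]) (use s h(1) t(1) in auto)
    then show ?thesis using t(2)[of "consT \<^bold>\<cdot> rep n \<^bold>\<cdot> s"] s by (simp add: val1_def[of "h \<^bold>\<cdot> s"] val1_consT)
  qed
  then show thesis using h(1) that by blast
qed

lemma subst_Imp: "subst x \<rho> t (A \<^bold>\<longrightarrow> B) = (subst x \<rho> t A \<^bold>\<longrightarrow> subst x \<rho> t B)"
  by (simp add: subst_def)

lemma Tr_induct:
  assumes "wff [] A" "qf A" "Tr (subst x N Zero A)"
    "\<And>a. has_type [] a N \<Longrightarrow> Tr (subst x N a A) \<Longrightarrow> Tr (subst x N a (subst x N (Succ \<^bold>\<cdot> Free x N) A))"
    "has_type [] a N"
  shows "Tr (subst x N a A)"
proof -
  let ?S = "subst x N (Succ \<^bold>\<cdot> Free x N) A"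
  have S: "wff [] ?S" by (rule wff_subst[OF assms(1)]) simp
  have 0: "wff [] (subst x N Zero A)" by (rule wff_subst[OF assms(1)]) simp
  have AS: "wff [] (A \<^bold>\<longrightarrow> ?S)" using assms(1) S by simp
  have C: "wff [] (subst x N Zero A \<^bold>\<and> ALL' x N (A \<^bold>\<longrightarrow> ?S))" using 0 wff_ALL'[OF AS] by simp
  have "Tr (subst x N Zero A \<^bold>\<and> ALL' x N (A \<^bold>\<longrightarrow> ?S) \<^bold>\<longrightarrow> ALL' x N A)"
    by (rule Tr_axiom[OF RCA0\<omega>.QF_induction]) (use assms(1,2) C wff_ALL'[OF assms(1)] in auto)
  moreover have "Tr (ALL' x N (A \<^bold>\<longrightarrow> ?S))"
    unfolding Tr_ALL'[OF AS] subst_Imp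
    using assms(1,4) S by (simp add: Tr_Imp wff_subst)
  ultimately have "Tr (ALL' x N A)"
    using assms(3) Tr_Imp[OF C wff_ALL'[OF assms(1)]] Tr_Con[OF 0 wff_ALL'[OF AS]] by blast
  then show ?thesis using assms(5) by (simp add: Tr_ALL'[OF assms(1)])
qed

lemma M1_induct:
  assumes "{f, g, h, k} \<subseteq> M1" "f (val Zero) = g (val Zero) \<or> h (val Zero) = k (val Zero)"
    "\<And>n. f n = g n \<or> h n = k n \<Longrightarrow> f (val1 Succ n) = g (val1 Succ n) \<or> h (val1 Succ n) = k (val1 Succ n)"
  shows "f n = g n \<or> h n = k n"
proof -
  obtain s where s: "has_type [] s ty1" and f: "f = val1 s" using assms(1) by (auto simp: M1_def)
  obtain t where t: "has_type [] t ty1" and g: "g = val1 t" using assms(1) by (auto simp: M1_def)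
  obtain u where u: "has_type [] u ty1" and h: "h = val1 u" using assms(1) by (auto simp: M1_def)
  obtain v where v: "has_type [] v ty1" and k: "k = val1 v" using assms(1) by (auto simp: M1_def)
  obtain x where "(x, N) \<notin> fv_trm s \<union> fv_trm t \<union> fv_trm u \<union> fv_trm v"
    by (rule ex_fresh[of "fv_trm s \<union> fv_trm t \<union> fv_trm u \<union> fv_trm v"]) (auto simp: finite_fv_trm)
  then have x: "(x, N) \<notin> fv_trm s" "(x, N) \<notin> fv_trm t" "(x, N) \<notin> fv_trm u" "(x, N) \<notin> fv_trm v" by auto
  let ?P = "\<lambda>a. val (s \<^bold>\<cdot> a) \<noteq> val (t \<^bold>\<cdot> a) \<longrightarrow> val (u \<^bold>\<cdot> a) = val (v \<^bold>\<cdot> a)"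
  \<comment> \<open>The disjunction is expressed by an implication to obtain a quantifier-free
    formula of the object language.\<close>
  let ?A = "Neg (s \<^bold>\<cdot> Free x N \<^bold>= t \<^bold>\<cdot> Free x N) \<^bold>\<longrightarrow> u \<^bold>\<cdot> Free x N \<^bold>= v \<^bold>\<cdot> Free x N"
  note [simp] = has_type_weaken[OF s] abstr_trm_fresh[OF x(1)] s inst_trm_closed[OF s] Tr_Eq
    has_type_weaken[OF t] abstr_trm_fresh[OF x(2)] t inst_trm_closed[OF t]
    has_type_weaken[OF u] abstr_trm_fresh[OF x(3)] u inst_trm_closed[OF u]
    has_type_weaken[OF v] abstr_trm_fresh[OF x(4)] v inst_trm_closed[OF v]
  have wf: "wff [] ?A" by simp
  have 1: "Tr (subst x N a ?A) \<longleftrightarrow> ?P a" if "has_type [] a N" for a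
    using that by (simp add: subst_def Tr_Imp)
  have 2: "Tr (subst x N a (subst x N (Succ \<^bold>\<cdot> Free x N) ?A)) \<longleftrightarrow> ?P (Succ \<^bold>\<cdot> a)"
    if "has_type [] a N" for a
    using that by (simp add: subst_def Tr_Imp)
  have "?P Zero \<Longrightarrow> (\<And>a. has_type [] a N \<Longrightarrow> ?P a \<Longrightarrow> ?P (Succ \<^bold>\<cdot> a)) \<Longrightarrow> has_type [] a N \<Longrightarrow> ?P a" for a
    using Tr_induct[of ?A x a, unfolded 1[OF has_type_const(2)]] wf 1 2 by simp
  moreover have "?P Zero"
    using assms(2) s t u v by (simp add: f g h k val1_val disj_imp)
  moreover have "?P (Succ \<^bold>\<cdot> a)" if "?P a" "has_type [] a N" for a
    using assms(3)[of "val a"] that s t u v by (auto simp: f g h k val1_val simp flip: val_ops1)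
  ultimately have "?P (rep n)" using has_type_rep by blast
  then show ?thesis by (auto simp: f g h k val1_def)
qed

text \<open>The choice axiom is applied to an atomic formula: the section term \<open>t\<close> of
  \<open>F\<close> takes the value zero at \<open>x\<close> and \<open>y\<close>.\<close>

lemma M2_choice:
  assumes "F \<in> M2" "\<forall>f\<in>M1. \<exists>n. F (cs n f) = val Zero"
  shows "\<exists>G\<in>M2. \<forall>f\<in>M1. F (cs (G f) f) = val Zero"
proof -
  obtain t where t: "has_type [] t (ty1 \<^bold>\<rightarrow> ty1)"
    "\<And>s. has_type [] s ty1 \<Longrightarrow> val1 (t \<^bold>\<cdot> s) = (\<lambda>n. F (cs n (val1 s)))"
    by (rule section_term[OF assms(1)]) blast
  have val_t: "val (t \<^bold>\<cdot> s \<^bold>\<cdot> n) = F (cs (val n) (val1 s))" if "has_type [] s ty1" "has_type [] n N" for s n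
    using val1_val[of "t \<^bold>\<cdot> s" n] t that by simp
  obtain x where x: "(x, ty1) \<notin> fv_trm t" by (rule ex_fresh[OF finite_fv_trm])
  obtain y where y: "(y, N) \<notin> fv_trm t" by (rule ex_fresh[OF finite_fv_trm])
  obtain z where z: "(z, ty2) \<notin> fv_trm t" by (rule ex_fresh[OF finite_fv_trm])
  let ?A = "t \<^bold>\<cdot> Free x ty1 \<^bold>\<cdot> Free y N \<^bold>= Zero"
  note [simp] = has_type_weaken[OF t(1)] abstr_trm_fresh[OF x] abstr_trm_fresh[OF y]
    abstr_trm_fresh[OF z] t(1) inst_trm_closed[OF t(1)] Tr_Eq has_type_Cons
  have "Tr (ALL' x ty1 (EX' y N ?A) \<^bold>\<longrightarrow>
     EX' z ty2 (ALL' x ty1 (subst y N (Free z ty2 \<^bold>\<cdot> Free x ty1) ?A)))"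
    by (rule Tr_axiom[OF RCA0\<omega>.QF_AC_1_0]) (use z in \<open>simp_all add: subst_def ALL'_def EX'_def\<close>)
  then have ac: "(\<And>s. has_type [] s ty1 \<Longrightarrow> \<exists>n. has_type [] n N \<and> val (t \<^bold>\<cdot> s \<^bold>\<cdot> n) = val Zero) \<Longrightarrow>
      \<exists>g. has_type [] g ty2 \<and> (\<forall>s. has_type [] s ty1 \<longrightarrow> val (t \<^bold>\<cdot> s \<^bold>\<cdot> (g \<^bold>\<cdot> s)) = val Zero)"
    by (simp add: subst_def ALL'_def EX'_def Tr_Imp Tr_All)
  have "\<exists>n. has_type [] n N \<and> val (t \<^bold>\<cdot> s \<^bold>\<cdot> n) = val Zero" if s: "has_type [] s ty1" for s
  proof -
    obtain n where "F (cs n (val1 s)) = val Zero" using assms(2) M1I[OF s] by blast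
    then show ?thesis using val_t[OF s, of "rep n"] by (intro exI[of _ "rep n"]) simp
  qed
  from ac[OF this] obtain g where g: "has_type [] g ty2"
    "\<And>s. has_type [] s ty1 \<Longrightarrow> val (t \<^bold>\<cdot> s \<^bold>\<cdot> (g \<^bold>\<cdot> s)) = val Zero" by blast
  obtain G where G: "G \<in> M2" "\<And>s. has_type [] s ty1 \<Longrightarrow> G (val1 s) = val (g \<^bold>\<cdot> s)"
    using M2_term[OF g(1)] by blast
  have "F (cs (G f) f) = val Zero" if "f \<in> M1" for f
    using M1E[OF that] G(2) g val_t by (metis has_type_simps(3))
  then show ?thesis using G(1) by blast
qed

lemma M2_exists: "\<exists>\<phi>\<in>M2. \<forall>f\<in>M1. \<phi> f = val Zero \<longleftrightarrow> (\<exists>n. f n = val Zero)"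
proof -
  note [simp] = Tr_Eq has_type_ops has_type_Cons
  have "\<exists>p. has_type [] p ty2 \<and> (\<forall>f. has_type [] f ty1 \<longrightarrow>
      (\<exists>n. has_type [] n N \<and> val (f \<^bold>\<cdot> n) = val Zero) \<longleftrightarrow> val (p \<^bold>\<cdot> f) = val Zero)"
    using Tr_Exists2
    by (auto simp: Exists2_def Let_def ALL'_def EX'_def Tr_Imp Tr_All le_def op_eqs abstr_trm_fresh has_type_numeral)
  then obtain p where p: "has_type [] p ty2" "\<And>f. has_type [] f ty1 \<Longrightarrow>
      (\<exists>n. has_type [] n N \<and> val (f \<^bold>\<cdot> n) = val Zero) \<longleftrightarrow> val (p \<^bold>\<cdot> f) = val Zero" by blast
  obtain \<phi> where phi: "\<phi> \<in> M2" "\<And>s. has_type [] s ty1 \<Longrightarrow> \<phi> (val1 s) = val (p \<^bold>\<cdot> s)"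
    using M2_term[OF p(1)] by blast
  have "\<phi> f = val Zero \<longleftrightarrow> (\<exists>n. f n = val Zero)" if "f \<in> M1" for f
  proof -
    obtain t where t: "has_type [] t ty1" and f: "f = val1 t" by (rule M1E[OF \<open>f \<in> M1\<close>])
    have "(\<exists>n. has_type [] n N \<and> val (t \<^bold>\<cdot> n) = val Zero) \<longleftrightarrow> (\<exists>n. f n = val Zero)"
      unfolding f using val1_val[OF t] by (metis has_type_rep val_rep)
    then show ?thesis using p(2)[OF t] phi(2)[OF t] f by simp
  qed
  then show ?thesis using phi(1) by blast
qed

text \<open>The recursor is of type 0 and the parameter \<open>f\<close> of type 1. Counter and
  parameter travel together in one sequence, from which the term \<open>tl\<close> recovers the
  parameter.\<close>

lemma M2_rec:
  assumes "F \<in> M2" "G \<in> M2"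
  shows "\<exists>R\<in>M2. \<forall>f\<in>M1. R (cs (val Zero) f) = F f \<and>
    (\<forall>n. R (cs (val1 Succ n) f) = G (cs n (cs (R (cs n f)) f)))"
proof -
  obtain f where f: "has_type [] f ty2" "\<And>s. has_type [] s ty1 \<Longrightarrow> F (val1 s) = val (f \<^bold>\<cdot> s)"
    using M2E[OF assms(1)] by blast
  obtain g where g: "has_type [] g ty2" "\<And>s. has_type [] s ty1 \<Longrightarrow> G (val1 s) = val (g \<^bold>\<cdot> s)"
    using M2E[OF assms(2)] by blast
  have "int2 ty1 N N (\<lambda>s n. s \<^bold>\<cdot> (Succ \<^bold>\<cdot> n))"
    by (rule int2_app int2_2 int2_1[OF int1_id] int2_1[OF int1_const] has_type_const)+
  then obtain tl where tl: "has_type [] tl (ty1 \<^bold>\<rightarrow> ty1)"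
    "\<And>s n. has_type [] s ty1 \<Longrightarrow> has_type [] n N \<Longrightarrow> eqv N (tl \<^bold>\<cdot> s \<^bold>\<cdot> n) (s \<^bold>\<cdot> (Succ \<^bold>\<cdot> n))"
    unfolding int2_def by blast
  have tl_cons: "eqv ty1 (tl \<^bold>\<cdot> (consT \<^bold>\<cdot> n \<^bold>\<cdot> s)) s" if "has_type [] s ty1" "has_type [] n N" for s n
  proof -
    have "val (tl \<^bold>\<cdot> (consT \<^bold>\<cdot> n \<^bold>\<cdot> s) \<^bold>\<cdot> k) = val (s \<^bold>\<cdot> k)" if k: "has_type [] k N" for k
      using val_eqv[OF _ _ tl(2)[of "consT \<^bold>\<cdot> n \<^bold>\<cdot> s" k]] that \<open>has_type [] s ty1\<close> \<open>has_type [] n N\<close> tl(1)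
      by (simp add: val_consT_Succ)
    then show ?thesis using that tl(1) by (simp add: eqv_Fun eqv_N val_eq[symmetric])
  qed
  have fst: "int3 ty1 N N ty1 (\<lambda>s u v. s)" by (rule int3_12[OF int2_1[OF int1_id]])
  have snd: "int3 ty1 N N N (\<lambda>s u v. u)" by (rule int3_12[OF int2_2])
  have const: "int3 ty1 N N \<tau> (\<lambda>s u v. c)" if "has_type [] c \<tau>" for c \<tau>
    by (rule int3_12[OF int2_1[OF int1_const[OF that]]])
  have "int3 ty1 N N N (\<lambda>s u v. g \<^bold>\<cdot> (consT \<^bold>\<cdot> v \<^bold>\<cdot> (consT \<^bold>\<cdot> u \<^bold>\<cdot> s)))"
    by (rule int3_app fst snd int3_3 const has_type_consT g)+
  then obtain r where r: "has_type [] r (ty1 \<^bold>\<rightarrow> N \<^bold>\<rightarrow> N \<^bold>\<rightarrow> N)"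
    "\<And>s u v. has_type [] s ty1 \<Longrightarrow> has_type [] u N \<Longrightarrow> has_type [] v N \<Longrightarrow>
       eqv N (r \<^bold>\<cdot> s \<^bold>\<cdot> u \<^bold>\<cdot> v) (g \<^bold>\<cdot> (consT \<^bold>\<cdot> v \<^bold>\<cdot> (consT \<^bold>\<cdot> u \<^bold>\<cdot> s)))"
    unfolding int3_def by blast
  \<comment> \<open>The head of \<open>y\<close> is the counter and its tail the parameter; the step
    \<open>r\<close> prepends the previous value and then the counter, as \<open>G\<close>
    expects.\<close>
  let ?R = "\<lambda>y. Rec \<^bold>\<cdot> (y \<^bold>\<cdot> Zero) \<^bold>\<cdot> (f \<^bold>\<cdot> (tl \<^bold>\<cdot> y)) \<^bold>\<cdot> (r \<^bold>\<cdot> (tl \<^bold>\<cdot> y))"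
  have "int1 ty1 N ?R"
    by (rule int1_app int1_id int1_const has_type_const f tl r)+
  then obtain t where t: "has_type [] t ty2" "\<And>y. has_type [] y ty1 \<Longrightarrow> eqv N (t \<^bold>\<cdot> y) (?R y)"
    unfolding int1_def by blast
  obtain R where R: "R \<in> M2" "\<And>s. has_type [] s ty1 \<Longrightarrow> R (val1 s) = val (t \<^bold>\<cdot> s)"
    using M2_term[OF t(1)] by blast
  let ?Q = "\<lambda>n s. Rec \<^bold>\<cdot> n \<^bold>\<cdot> (f \<^bold>\<cdot> s) \<^bold>\<cdot> (r \<^bold>\<cdot> s)"
  have Rs: "R (cs (val n) (val1 s)) = val (?Q n s)" if s: "has_type [] s ty1" and n: "has_type [] n N" for s n
  proof -
    let ?y = "consT \<^bold>\<cdot> n \<^bold>\<cdot> s"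
    note I = has_type_intros has_type_consT f(1) tl(1) r(1) t(1) s n
    have "eqv N (?y \<^bold>\<cdot> Zero) n"
      using val_consT_Zero[OF n s] n s by (simp add: eqv_N val_eq[symmetric])
    have "eqv N (?R ?y) (?Q n s)"
      by (rule eqv_App[OF _ _ _ _ eqv_App[OF _ _ _ _ eqv_App[OF _ _ _ _ eqv_refl]] eqv_App[OF _ _ _ _ eqv_refl tl_cons]]
          eqv_App[OF _ _ _ _ eqv_refl tl_cons] \<open>eqv N (?y \<^bold>\<cdot> Zero) n\<close> I)+
    then have "val (t \<^bold>\<cdot> ?y) = val (?Q n s)"
      by (intro val_eqv eqv_trans[OF _ _ _ t(2)[of ?y]]) (rule I | assumption)+
    then show ?thesis using R(2)[of ?y] n s by (simp add: val1_consT)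
  qed
  have "R (cs (val Zero) f') = F f' \<and>
    (\<forall>n. R (cs (val1 Succ n) f') = G (cs n (cs (R (cs n f')) f')))" if "f' \<in> M1" for f'
  proof -
    obtain s where s: "has_type [] s ty1" and f': "f' = val1 s"
      by (rule M1E[OF \<open>f' \<in> M1\<close>])
    note I = has_type_intros has_type_consT f(1) g(1) r(1) s has_type_rep
    have "R (cs (val Zero) (val1 s)) = F (val1 s)"
      unfolding Rs[OF s has_type_const(2)] f(2)[OF s] by (rule val_Rec_Zero) (rule I)+
    moreover have "R (cs (val1 Succ n) (val1 s)) = G (cs n (cs (R (cs n (val1 s))) (val1 s)))" for n
    proof -
      have Q: "has_type [] (?Q (rep n) s) N" by (rule I)+
      have "R (cs (val1 Succ n) (val1 s)) = val (?Q (Succ \<^bold>\<cdot> rep n) s)"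
        unfolding val1_def[of Succ] by (rule Rs) (rule I)+
      also have "\<dots> = val (r \<^bold>\<cdot> s \<^bold>\<cdot> ?Q (rep n) s \<^bold>\<cdot> rep n)" by (rule val_Rec_Succ) (rule I)+
      also have "\<dots> = val (g \<^bold>\<cdot> (consT \<^bold>\<cdot> rep n \<^bold>\<cdot> (consT \<^bold>\<cdot> ?Q (rep n) s \<^bold>\<cdot> s)))"
        by (rule val_eqv[OF _ _ r(2)]) (rule I)+
      also have "\<dots> = G (val1 (consT \<^bold>\<cdot> rep n \<^bold>\<cdot> (consT \<^bold>\<cdot> ?Q (rep n) s \<^bold>\<cdot> s)))"
        by (rule g(2)[symmetric]) (rule I)+
      also have "\<dots> = G (cs n (cs (R (cs n (val1 s))) (val1 s)))"
        using Q s Rs[OF s has_type_rep, of n] by (simp add: val1_consT)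
      finally show ?thesis .
    qed
    ultimately show ?thesis unfolding f' by blast
  qed
  then show ?thesis using R(1) by blast
qed

lemma cs_values:
  assumes "f \<in> M1"
  shows "cs n f (val Zero) = n" "cs n f (val1 Succ k) = f k"
proof -
  obtain s where s: "has_type [] s ty1" and f: "f = val1 s" using assms by (rule M1E)
  have c: "cs n f = val1 (consT \<^bold>\<cdot> rep n \<^bold>\<cdot> s)" using val1_consT[OF has_type_rep s, of n] f by simp
  show "cs n f (val Zero) = n"
    unfolding c using s by (simp add: val1_val val_consT_Zero)
  show "cs n f (val1 Succ k) = f k"
    using s val1_val[of "consT \<^bold>\<cdot> rep n \<^bold>\<cdot> s" "Succ \<^bold>\<cdot> rep k"] unfolding c
    by (simp add: val_consT_Succ val_ops1) (simp add: f val1_def)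
qed

lemma val1_Succ_neq: "val1 Succ n \<noteq> val Zero"
proof -
  have "Tr (Neg (Succ \<^bold>\<cdot> rep n \<^bold>= Zero))" by (rule Tr_axiom[OF RCA0\<omega>.Succ_not_Zero]) auto
  then show ?thesis by (simp add: Tr_Neg Tr_Eq val1_def del: wff.simps) (simp add: Tr_Imp Tr_Eq)
qed

lemma val1_Succ_inject: "val1 Succ m = val1 Succ n \<Longrightarrow> m = n"
proof -
  assume *: "val1 Succ m = val1 Succ n"
  have "Tr (Succ \<^bold>\<cdot> rep m \<^bold>= Succ \<^bold>\<cdot> rep n \<^bold>\<longrightarrow> rep m \<^bold>= rep n)"
    by (rule Tr_axiom[OF RCA0\<omega>.Succ_inject]) auto
  then show "m = n" using * by (simp add: Tr_Imp Tr_Eq val1_def)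
qed

sublocale raw "val Zero" "val1 Succ" "val1 predT" "val2 addT" "val2 multT" "val2 monusT" "val1 pow2T"
  "val1 triT" "val1 tri_rootT" "val1 parityT" "val1 halfT" cs M1 M2
proof
  show "{val1 Succ, val1 predT, val1 pow2T, val1 triT, val1 tri_rootT, val1 parityT, val1 halfT} \<subseteq> M1"
    by (auto intro!: M1I has_type_ops)
  show "cs n f \<in> M1" if "f \<in> M1" for n f
    using that
  proof (rule M1E)
    fix t assume t: "has_type [] t ty1" "f = val1 t"
    then show "cs n f \<in> M1" using val1_consT[OF has_type_rep t(1), of n] M1I[of "consT \<^bold>\<cdot> rep n \<^bold>\<cdot> t"] by simp
  qed
  show "(\<lambda>n. F (cs n x)) \<in> M1" if "F \<in> M2" "x \<in> M1" for F x
  proof (rule section_term[OF that(1)])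
    fix h assume h: "has_type [] h (ty1 \<^bold>\<rightarrow> ty1)"
      "\<And>s. has_type [] s ty1 \<Longrightarrow> val1 (h \<^bold>\<cdot> s) = (\<lambda>n. F (cs n (val1 s)))"
    obtain s where s: "has_type [] s ty1" and f: "x = val1 s" by (rule M1E[OF \<open>x \<in> M1\<close>])
    show ?thesis using M1I[of "h \<^bold>\<cdot> s"] h s f by simp
  qed
  show "(\<lambda>x. c) \<in> M2" for c
    by (rule M2I[of "\<lambda>s. rep c"]) (auto intro: int1_const)
  show "(\<lambda>x. f (F x)) \<in> M2" if "f \<in> M1" "F \<in> M2" for f F
  proof -
    obtain s where s: "has_type [] s ty1" and f: "f = val1 s" by (rule M1E[OF \<open>f \<in> M1\<close>])
    obtain t where t: "has_type [] t ty2" "\<And>s. has_type [] s ty1 \<Longrightarrow> F (val1 s) = val (t \<^bold>\<cdot> s)"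
      using M2E[OF \<open>F \<in> M2\<close>] by blast
    show ?thesis
      by (rule M2I[OF int1_app[OF int1_const[OF s] int1_app[OF int1_const[OF t(1)] int1_id]]])
        (use t s f in \<open>simp add: val1_val\<close>)
  qed
  have arith: "(\<lambda>x. val2 h (F x) (G x)) \<in> M2" if h: "has_type [] h (N \<^bold>\<rightarrow> N \<^bold>\<rightarrow> N)" and FG: "F \<in> M2" "G \<in> M2" for h F G
  proof -
    obtain f where f: "has_type [] f ty2" "\<And>s. has_type [] s ty1 \<Longrightarrow> F (val1 s) = val (f \<^bold>\<cdot> s)"
      using M2E[OF FG(1)] by blast
    obtain g where g: "has_type [] g ty2" "\<And>s. has_type [] s ty1 \<Longrightarrow> G (val1 s) = val (g \<^bold>\<cdot> s)"
      using M2E[OF FG(2)] by blast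
    show ?thesis
    proof (rule M2I)
      show "int1 ty1 N (\<lambda>s. h \<^bold>\<cdot> (f \<^bold>\<cdot> s) \<^bold>\<cdot> (g \<^bold>\<cdot> s))"
        by (rule int1_app int1_id int1_const h f g)+
    qed (use f g h in \<open>simp add: val2_val\<close>)
  qed
  show "(\<lambda>x. val2 addT (F x) (G x)) \<in> M2" "(\<lambda>x. val2 multT (F x) (G x)) \<in> M2"
    "(\<lambda>x. val2 monusT (F x) (G x)) \<in> M2" if "F \<in> M2" "G \<in> M2" for F G
    using that by (auto intro!: arith has_type_ops)
  show "(\<lambda>x. x (F x)) \<in> M2" if "F \<in> M2" for F
  proof -
    obtain f where f: "has_type [] f ty2" "\<And>s. has_type [] s ty1 \<Longrightarrow> F (val1 s) = val (f \<^bold>\<cdot> s)"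
      using M2E[OF \<open>F \<in> M2\<close>] by blast
    show ?thesis
    proof (rule M2I)
      show "int1 ty1 N (\<lambda>s. s \<^bold>\<cdot> (f \<^bold>\<cdot> s))"
        by (rule int1_app int1_id int1_const f)+
    qed (use f in \<open>simp add: val1_val\<close>)
  qed
  show "(\<lambda>x. G (\<lambda>n. F (cs n x))) \<in> M2" if "F \<in> M2" "G \<in> M2" for F G
  proof (rule section_term[OF that(1)])
    fix h assume h: "has_type [] h (ty1 \<^bold>\<rightarrow> ty1)"
      "\<And>s. has_type [] s ty1 \<Longrightarrow> val1 (h \<^bold>\<cdot> s) = (\<lambda>n. F (cs n (val1 s)))"
    obtain g where g: "has_type [] g ty2" "\<And>s. has_type [] s ty1 \<Longrightarrow> G (val1 s) = val (g \<^bold>\<cdot> s)"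
      using M2E[OF \<open>G \<in> M2\<close>] by blast
    show ?thesis
    proof (rule M2I)
      show "int1 ty1 N (\<lambda>s. g \<^bold>\<cdot> (h \<^bold>\<cdot> s))"
        by (rule int1_app int1_id int1_const g h)+
    qed (use h g in \<open>simp flip: h(2)\<close>)
  qed
qed (fact val1_Succ_neq val1_Succ_inject M1_induct M2_choice M2_exists M2_rec cs_values |
    simp add: rec_values)+

end

section \<open>Definability and arithmetic in the type structure\<close>

context raw
begin

section \<open>Elementary arithmetic from the recursion equations\<close>

lemma S_M1 [simp]: "S \<in> M1" "prd \<in> M1" "pw \<in> M1" "tri \<in> M1" "trr \<in> M1" "par \<in> M1" "hlf \<in> M1"
  using M1_basic by auto

lemma M2_at: "f \<in> M1 \<Longrightarrow> (\<lambda>x. f (x Z)) \<in> M2"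
  by (rule M2_comp[OF _ M2_apply[OF M2_const]])

lemmas M2_S = M2_comp[OF S_M1(1)]

text \<open>\<open>S\<close> stands for an arbitrary member of \<open>M1\<close>: a sequence without
  parameters is a section at a dummy argument.\<close>

lemma M1_I: "F \<in> M2 \<Longrightarrow> (\<And>n. F (cs n S) = f n) \<Longrightarrow> f \<in> M1"
  using M1_section[of F S] by simp

lemma M1_id [simp]: "(\<lambda>n. n) \<in> M1"
  by (rule M1_I[OF M2_apply[OF M2_const[of Z]]]) simp

lemma M1_const [simp]: "(\<lambda>n. c) \<in> M1"
  by (rule M1_I[OF M2_const]) simp

lemma M1_arith:
  assumes "f \<in> M1" "g \<in> M1"
  shows "(\<lambda>n. add (f n) (g n)) \<in> M1" "(\<lambda>n. mul (f n) (g n)) \<in> M1" "(\<lambda>n. mon (f n) (g n)) \<in> M1"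
  by (rule M1_I[OF M2_arith(1)[OF M2_at M2_at]] M1_I[OF M2_arith(2)[OF M2_at M2_at]]
      M1_I[OF M2_arith(3)[OF M2_at M2_at]]; (use assms in simp)?)+

lemma M1_comp: "f \<in> M1 \<Longrightarrow> g \<in> M1 \<Longrightarrow> (\<lambda>n. f (g n)) \<in> M1"
  by (rule M1_I[OF M2_comp[OF _ M2_at[of g]]]) auto

lemmas M1_intros = M1_id M1_const M1_arith M1_comp[OF S_M1(1)] M1_comp[OF S_M1(2)] S_M1

lemma M1_eq_induct:
  assumes "f \<in> M1" "g \<in> M1" "f Z = g Z" "\<And>n. f n = g n \<Longrightarrow> f (S n) = g (S n)"
  shows "f n = g n"
  using M1_induct[of f g f g n] assms by auto

lemma Z_or_S: "n = Z \<or> S (prd n) = n"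
  by (rule M1_induct) (auto intro!: M1_intros)

lemma S_cases:
  obtains "n = Z" | k where "n = S k"
  using Z_or_S[of n] by metis

lemma mon_S_S [simp]: "mon (S m) (S n) = mon m n"
  by (rule M1_eq_induct[where n = n]) (auto intro!: M1_intros)

declare mon_S [simp del]

lemma mon_self [simp]: "mon n n = Z"
  by (rule M1_eq_induct[where n = n]) (auto intro!: M1_intros)

lemma mon_Z_left [simp]: "mon Z n = Z"
  by (rule M1_eq_induct[where n = n]) (auto intro!: M1_intros simp: mon_S)

lemma add_Z_left [simp]: "add Z n = n"
  by (rule M1_eq_induct[where n = n]) (auto intro!: M1_intros)

lemma add_S_left [simp]: "add (S m) n = S (add m n)"
  by (rule M1_eq_induct[where n = n]) (auto intro!: M1_intros)

lemma add_commute: "add m n = add n m"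
  by (rule M1_eq_induct[where n = n]) (auto intro!: M1_intros)

lemma add_assoc: "add (add k m) n = add k (add m n)"
  by (rule M1_eq_induct[where n = n]) (auto intro!: M1_intros)

lemma add_left_commute: "add k (add m n) = add m (add k n)"
  by (metis add_commute add_assoc)

lemma mon_add [simp]: "mon (add m n) n = m"
  by (rule M1_eq_induct[where n = n]) (auto intro!: M1_intros)

lemma mon_add_left [simp]: "mon (add n m) n = m"
  by (metis mon_add add_commute)

lemma mon_mon: "mon (mon k m) n = mon k (add m n)"
  by (rule M1_eq_induct[where n = n]) (auto intro!: M1_intros simp: mon_S)

lemma mul_Z_left [simp]: "mul Z n = Z"
  by (rule M1_eq_induct[where n = n]) (auto intro!: M1_intros)

lemma mul_S_left: "mul (S m) n = add (mul m n) n"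
  by (rule M1_eq_induct[where n = n]) (auto intro!: M1_intros simp: add_assoc add_commute add_left_commute)

lemma mul_commute: "mul m n = mul n m"
  by (rule M1_eq_induct[where n = n]) (auto intro!: M1_intros simp: mul_S_left)

lemma mul_add: "mul k (add m n) = add (mul k m) (mul k n)"
  by (rule M1_eq_induct[where n = n]) (auto intro!: M1_intros simp: add_assoc)

lemma mul_assoc: "mul (mul k m) n = mul k (mul m n)"
  by (rule M1_eq_induct[where n = n]) (auto intro!: M1_intros simp: mul_add)

lemma add_eq_Z: "add m n = Z \<longleftrightarrow> m = Z \<and> n = Z"
  by (cases n rule: S_cases) auto

lemma mul_eq_Z: "mul m n = Z \<longleftrightarrow> m = Z \<or> n = Z"
  by (cases n rule: S_cases; cases m rule: S_cases) (auto simp: add_eq_Z)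

text \<open>Linearity of the order in equational form. It is a disjunction of two equations, exactly
  the shape that \<open>M1_induct\<close> admits, and comparability and the law for products of
  differences follow from it.\<close>

lemma add_mon_total: "add m (mon n m) = n \<or> add n (mon m n) = m"
proof (rule M1_induct[where n = n])
  fix n assume "add m (mon n m) = n \<or> add n (mon m n) = m"
  then show "add m (mon (S n) m) = S n \<or> add (S n) (mon m (S n)) = m"
  proof
    assume "add m (mon n m) = n"
    then have "S n = add m (S (mon n m))" by simp
    then show ?thesis by (metis mon_add_left)
  next
    assume *: "add n (mon m n) = m"
    show ?thesis
    proof (cases "mon m n" rule: S_cases)
      case 1
      then have "S n = add m (S Z)" using * by simp
      then show ?thesis by (metis mon_add_left)
    next
      case (2 k)
      then have "m = add (S n) k" using * by simp
      then show ?thesis by (metis mon_add_left)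
    qed
  qed
qed (auto intro!: M1_intros)

lemma mon_add_right [simp]: "mon m (add m n) = Z"
  by (simp flip: mon_mon)

lemma le_iff: "mon m n = Z \<longleftrightarrow> (\<exists>k. n = add m k)"
proof
  assume *: "mon m n = Z"
  from add_mon_total[of m n] show "\<exists>k. n = add m k"
  proof
    assume "add n (mon m n) = m"
    then have "n = add m Z" using * by simp
    then show ?thesis ..
  qed metis
qed auto

lemma mul_mon: "mul k (mon m n) = mon (mul k m) (mul k n)"
  using add_mon_total[of m n]
proof
  assume "add m (mon n m) = n"
  then obtain l where l: "n = add m l" by metis
  show ?thesis by (simp add: l mul_add)
next
  assume "add n (mon m n) = m"
  then obtain l where l: "m = add n l" by metis
  show ?thesis by (simp add: l mul_add)
qed

text \<open>
  A context \<open>c\<close> is a set of arguments together with a coding of the arguments by type 1 objects;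
  \<open>push c\<close> adds a number variable, and \<open>D c F\<close> says that \<open>F\<close> is given by an object of type 2.
  Only arguments in \<open>dom c\<close>, whose codes exist in the model, count.
\<close>

definition base :: "('n \<Rightarrow> 'n) set \<times> (('n \<Rightarrow> 'n) \<Rightarrow> 'n \<Rightarrow> 'n)" where
  "base = (M1, \<lambda>x. x)"

definition dom :: "'a set \<times> ('a \<Rightarrow> 'n \<Rightarrow> 'n) \<Rightarrow> 'a set" where
  "dom c = {a \<in> fst c. snd c a \<in> M1}"

definition push :: "'a set \<times> ('a \<Rightarrow> 'n \<Rightarrow> 'n) \<Rightarrow> ('a \<times> 'n) set \<times> ('a \<times> 'n \<Rightarrow> 'n \<Rightarrow> 'n)" where
  "push c = (dom c \<times> UNIV, \<lambda>p. cs (snd p) (snd c (fst p)))"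

definition D :: "'a set \<times> ('a \<Rightarrow> 'n \<Rightarrow> 'n) \<Rightarrow> ('a \<Rightarrow> 'n) \<Rightarrow> bool" where
  "D c F \<longleftrightarrow> (\<exists>G\<in>M2. \<forall>a\<in>dom c. F a = G (snd c a))"

text \<open>Truth is coded by \<open>Z\<close>, so that an existential number quantifier asks for a
  zero, which is what \<open>M2_exists\<close> and \<open>M2_choice\<close> speak about.\<close>

definition DP :: "'a set \<times> ('a \<Rightarrow> 'n \<Rightarrow> 'n) \<Rightarrow> ('a \<Rightarrow> bool) \<Rightarrow> bool" where
  "DP c P \<longleftrightarrow> D c (\<lambda>a. if P a then Z else S Z)"

section \<open>Closure of definability under logic, recursion and choice\<close>

lemma dom_base [simp]: "dom base = M1"
  by (auto simp: dom_def base_def)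

lemma snd_base [simp]: "snd base x = x"
  by (simp add: base_def)

lemma dom_push [simp]: "dom (push c) = dom c \<times> UNIV"
  by (auto simp: dom_def push_def)

lemma dom_M1 [simp]: "a \<in> dom c \<Longrightarrow> snd c a \<in> M1"
  by (simp add: dom_def)

lemma snd_push: "snd (push c) p = cs (snd p) (snd c (fst p))"
  by (simp add: push_def)

lemma D_I: "G \<in> M2 \<Longrightarrow> (\<And>a. a \<in> dom c \<Longrightarrow> F a = G (snd c a)) \<Longrightarrow> D c F"
  by (auto simp: D_def)

lemma D_E:
  assumes "D c F"
  obtains G where "G \<in> M2" "\<And>a. a \<in> dom c \<Longrightarrow> F a = G (snd c a)"
  using assms by (auto simp: D_def)

lemma D_const: "D c (\<lambda>a. k)"
  by (rule D_I[OF M2_const]) simp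

lemma D_M1:
  assumes "f \<in> M1" "D c F"
  shows "D c (\<lambda>a. f (F a))"
proof -
  obtain G where "G \<in> M2" "\<And>a. a \<in> dom c \<Longrightarrow> F a = G (snd c a)" using D_E[OF assms(2)] by blast
  then show ?thesis by (intro D_I[OF M2_comp[OF assms(1)]]) auto
qed

lemma D_arith:
  assumes "D c F" "D c G"
  shows "D c (\<lambda>a. add (F a) (G a))" "D c (\<lambda>a. mul (F a) (G a))" "D c (\<lambda>a. mon (F a) (G a))"
proof -
  obtain F' where F: "F' \<in> M2" "\<And>a. a \<in> dom c \<Longrightarrow> F a = F' (snd c a)" using D_E[OF assms(1)] by blast
  obtain G' where G: "G' \<in> M2" "\<And>a. a \<in> dom c \<Longrightarrow> G a = G' (snd c a)" using D_E[OF assms(2)] by blast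
  show "D c (\<lambda>a. add (F a) (G a))" by (rule D_I[OF M2_arith(1)[OF F(1) G(1)]]) (simp add: F G)
  show "D c (\<lambda>a. mul (F a) (G a))" by (rule D_I[OF M2_arith(2)[OF F(1) G(1)]]) (simp add: F G)
  show "D c (\<lambda>a. mon (F a) (G a))" by (rule D_I[OF M2_arith(3)[OF F(1) G(1)]]) (simp add: F G)
qed

text \<open>Change of context along \<open>m\<close>. The functional \<open>V\<close> computes entry
  \<open>n\<close> of the code of \<open>m a\<close> from the code of \<open>a\<close> with
  \<open>n\<close> put in front; this suffices, because codes are themselves sequences.\<close>

lemma D_transfer:
  assumes "D c F" "\<And>a. a \<in> dom c' \<Longrightarrow> m a \<in> dom c" "V \<in> M2"
    "\<And>a n. a \<in> dom c' \<Longrightarrow> V (cs n (snd c' a)) = snd c (m a) n"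
  shows "D c' (\<lambda>a. F (m a))"
proof -
  obtain G where G: "G \<in> M2" "\<And>a. a \<in> dom c \<Longrightarrow> F a = G (snd c a)" using D_E[OF assms(1)] by blast
  show ?thesis
    by (rule D_I[OF M2_subst[OF assms(3) G(1)]]) (simp add: G(2) assms(2,4))
qed

definition cond :: "'n \<Rightarrow> 'n \<Rightarrow> 'n \<Rightarrow> 'n" where
  "cond k m n = add (mul m (mon (S Z) k)) (mul n (mon (S Z) (mon (S Z) k)))"

lemma cond_simps [simp]: "cond Z m n = m" "cond (S k) m n = n"
  by (simp_all add: cond_def)

lemma cond_eq: "cond k m n = (if k = Z then m else n)"
  by (cases k rule: S_cases) auto

lemma M2_cond: "F \<in> M2 \<Longrightarrow> G \<in> M2 \<Longrightarrow> H \<in> M2 \<Longrightarrow> (\<lambda>x. cond (F x) (G x) (H x)) \<in> M2"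
  unfolding cond_def by (intro M2_arith M2_const)

lemma D_snd: "D (push c) (\<lambda>p. snd p)"
  by (rule D_I[OF M2_apply[OF M2_const[of Z]]]) (auto simp: snd_push)

lemma D_weak: "D c F \<Longrightarrow> D (push c) (\<lambda>p. F (fst p))"
  \<comment> \<open>Here \<open>z\<close> starts with the index and the pushed number.
    \<open>z Z\<close> is the index, and the two successors skip these two entries.\<close>
  by (erule D_transfer[where V = "\<lambda>z. z (S (S (z Z)))"])
    (use M2_apply[OF M2_S[OF M2_S[OF M2_apply[OF M2_const[of Z]]]]] in \<open>auto simp: snd_push\<close>)

text \<open>The new variable is inserted below the last one, because the last variable is the
  argument of the family \<open>X\<close>. \<open>V\<close> keeps the last variable as head and
  skips the inserted one.\<close>

lemma D_weak_fun:
  assumes "D (push c) (\<lambda>p. X (fst p) (snd p))"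
  shows "D (push (push c)) (\<lambda>p. X (fst (fst p)) (snd p))"
proof -
  have "D (push (push c)) (\<lambda>q. (\<lambda>p. X (fst p) (snd p)) (fst (fst q), snd q))"
  proof (rule D_transfer[OF assms, where V = "\<lambda>z. cond (z Z) (z (S Z)) (z (S (S (z Z))))"])
    show "(\<lambda>z. cond (z Z) (z (S Z)) (z (S (S (z Z))))) \<in> M2"
      by (intro M2_cond M2_apply M2_S M2_const)
    fix a n assume "a \<in> dom (push (push c))"
    then show "cond (cs n (snd (push (push c)) a) Z) (cs n (snd (push (push c)) a) (S Z))
        (cs n (snd (push (push c)) a) (S (S (cs n (snd (push (push c)) a) Z)))) =
       snd (push c) (fst (fst a), snd a) n"
      by (cases n rule: S_cases) (auto simp: snd_push)
  qed auto
  then show ?thesis by simp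
qed

lemma D_apply:
  assumes "D (push c) (\<lambda>p. X (fst p) (snd p))" "D c F"
  shows "D c (\<lambda>a. X a (F a))"
proof -
  obtain G where G: "G \<in> M2" "\<And>a. a \<in> dom c \<Longrightarrow> F a = G (snd c a)" using D_E[OF assms(2)] by blast
  \<comment> \<open>In \<open>z = cs n x\<close> the inner function recovers the tail
    \<open>x\<close>, on which \<open>G\<close> computes the value to be substituted. It becomes
    entry \<open>Z\<close> of the new code; at any other index \<open>n\<close>, entry
    \<open>n\<close> of \<open>z\<close> is already the right one.\<close>
  let ?V = "\<lambda>z. cond (z Z) (G (\<lambda>n. (\<lambda>y. y (S (S (y Z)))) (cs n z))) (z (z Z))"
  have "D c (\<lambda>a. (\<lambda>p. X (fst p) (snd p)) (a, F a))"
  proof (rule D_transfer[OF assms(1), where V = ?V])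
    show "?V \<in> M2"
      by (intro M2_cond M2_apply M2_const M2_subst[OF _ G(1)] M2_S)
    fix a n assume a: "a \<in> dom c"
    have "(\<lambda>i. cs n (snd c a) (S i)) = snd c a" using a by auto
    then have "?V (cs n (snd c a)) = cond n (F a) (cs n (snd c a) n)"
      using a by (simp add: G(2))
    also have "\<dots> = snd (push c) (a, F a) n"
      using a by (cases n rule: S_cases) (auto simp: snd_push)
    finally show "?V (cs n (snd c a)) = snd (push c) (a, F a) n" .
  qed auto
  then show ?thesis by simp
qed

lemma D_M2:
  assumes "Y \<in> M2" "D (push c) (\<lambda>p. X (fst p) (snd p))"
  shows "D c (\<lambda>a. Y (X a))"
proof -
  obtain G where G: "G \<in> M2" "\<And>a. a \<in> dom (push c) \<Longrightarrow> X (fst a) (snd a) = G (snd (push c) a)"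
    using D_E[OF assms(2)] by blast
  have "X a = (\<lambda>n. G (cs n (snd c a)))" if "a \<in> dom c" for a
    using G(2)[of "(a, _)"] that by (auto simp: snd_push)
  then show ?thesis
    by (intro D_I[OF M2_subst[OF G(1) assms(1)]]) auto
qed

lemma section_M1:
  assumes "D (push c) (\<lambda>p. X (fst p) (snd p))" "a \<in> dom c"
  shows "X a \<in> M1"
proof -
  obtain G where G: "G \<in> M2" "\<And>a. a \<in> dom (push c) \<Longrightarrow> X (fst a) (snd a) = G (snd (push c) a)"
    using D_E[OF assms(1)] by blast
  have "X a = (\<lambda>n. G (cs n (snd c a)))"
    using G(2)[of "(a, _)"] assms(2) by (auto simp: snd_push)
  then show ?thesis using M1_section[OF G(1), of "snd c a"] assms(2) by simp
qed

lemma D_M1_iff: "f \<in> M1 \<longleftrightarrow> D (push base) (\<lambda>p. f (snd p))"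
proof
  assume "f \<in> M1"
  then show "D (push base) (\<lambda>p. f (snd p))" by (rule D_M1[OF _ D_snd])
next
  assume *: "D (push base) (\<lambda>p. f (snd p))"
  show "f \<in> M1" by (rule section_M1[of base "\<lambda>_. f", OF * , of S]) simp
qed

lemma D_var: "D (push base) (\<lambda>p. fst p (snd p))"
  by (rule D_I[where G = "\<lambda>y. y (S (y Z))"]) (use M2_apply[OF M2_S[OF M2_apply[OF M2_const[of Z]]]] in \<open>auto simp: snd_push\<close>)

lemma D_if:
  assumes "DP c P" "D c F" "D c G"
  shows "D c (\<lambda>a. if P a then F a else G a)"
proof -
  have "D c (\<lambda>a. cond (if P a then Z else S Z) (F a) (G a))"
    unfolding cond_def by (intro D_arith D_const assms(2,3) assms(1)[unfolded DP_def])
  moreover have "(\<lambda>a. cond (if P a then Z else S Z) (F a) (G a)) = (\<lambda>a. if P a then F a else G a)"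
    by auto
  ultimately show ?thesis by simp
qed

lemma DP_Z:
  assumes "D c F"
  shows "DP c (\<lambda>a. F a = Z)"
proof -
  have "D c (\<lambda>a. cond (F a) Z (S Z))"
    unfolding cond_def by (intro D_arith D_const assms)
  then show ?thesis by (simp add: DP_def cond_eq cong: if_cong)
qed

lemma D_cond: "D c F \<Longrightarrow> D c G \<Longrightarrow> D c H \<Longrightarrow> D c (\<lambda>a. cond (F a) (G a) (H a))"
  unfolding cond_def by (intro D_arith D_const)

lemma DP_I:
  assumes "D c F" "\<And>a. P a \<longleftrightarrow> F a = Z"
  shows "DP c P"
proof -
  have "P = (\<lambda>a. F a = Z)" using assms(2) by auto
  then show ?thesis using DP_Z[OF assms(1)] by simp
qed

lemma DP_E:
  assumes "DP c P"
  obtains F where "D c F" "\<And>a. P a \<longleftrightarrow> F a = Z"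
  using assms that[of "\<lambda>a. if P a then Z else S Z"] by (simp add: DP_def)

lemma DP_eq: "D c F \<Longrightarrow> D c G \<Longrightarrow> DP c (\<lambda>a. F a = G a)"
proof (rule DP_I)
  show "D c F \<Longrightarrow> D c G \<Longrightarrow> D c (\<lambda>a. add (mon (F a) (G a)) (mon (G a) (F a)))"
    by (intro D_arith)
  show "F a = G a \<longleftrightarrow> add (mon (F a) (G a)) (mon (G a) (F a)) = Z" for a
    by (auto simp: add_eq_Z) (metis add_mon_total add_Z)
qed

lemma DP_not:
  assumes "DP c P"
  shows "DP c (\<lambda>a. \<not> P a)"
proof -
  obtain F where F: "D c F" "\<And>a. P a \<longleftrightarrow> F a = Z" using DP_E[OF assms] by blast
  show ?thesis
    by (rule DP_I[OF D_cond[OF F(1) D_const[of c "S Z"] D_const[of c Z]]]) (simp add: F(2) cond_eq)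
qed

lemma DP_imp:
  assumes "DP c P" "DP c Q"
  shows "DP c (\<lambda>a. P a \<longrightarrow> Q a)"
proof -
  obtain F where F: "D c F" "\<And>a. P a \<longleftrightarrow> F a = Z" using DP_E[OF assms(1)] by blast
  obtain G where G: "D c G" "\<And>a. Q a \<longleftrightarrow> G a = Z" using DP_E[OF assms(2)] by blast
  show ?thesis
    by (rule DP_I[OF D_cond[OF F(1) G(1) D_const[of c Z]]]) (simp add: F(2) G(2) cond_eq)
qed

lemma DP_conj: "DP c P \<Longrightarrow> DP c Q \<Longrightarrow> DP c (\<lambda>a. P a \<and> Q a)"
  using DP_not[OF DP_imp[OF _ DP_not], of c P Q] by simp

lemma DP_disj: "DP c P \<Longrightarrow> DP c Q \<Longrightarrow> DP c (\<lambda>a. P a \<or> Q a)"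
  using DP_imp[OF DP_not, of c P Q] by (simp add: disj_imp)

lemma DP_iff': "DP c P \<Longrightarrow> DP c Q \<Longrightarrow> DP c (\<lambda>a. P a \<longleftrightarrow> Q a)"
  using DP_conj[OF DP_imp[of c P Q] DP_imp[of c Q P]] by (simp add: iff_conv_conj_imp)

lemma DP_fixed: "DP c (\<lambda>a. b)"
  unfolding DP_def by (rule D_const)

text \<open>The functional of \<open>M2_exists\<close> decides whether the characteristic sequence
  has a zero. This makes definable predicates closed under arithmetical quantification.\<close>

lemma DP_ex:
  assumes "DP (push c) (\<lambda>p. P (fst p) (snd p))"
  shows "DP c (\<lambda>a. \<exists>n. P a n)"
proof -
  obtain \<phi> where \<phi>: "\<phi> \<in> M2" "\<And>f. f \<in> M1 \<Longrightarrow> \<phi> f = Z \<longleftrightarrow> (\<exists>n. f n = Z)"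
    using M2_exists by blast
  let ?X = "\<lambda>a n. if P a n then Z else S Z"
  have X: "D (push c) (\<lambda>p. ?X (fst p) (snd p))" using assms by (simp add: DP_def)
  have "D c (\<lambda>a. cond (\<phi> (?X a)) Z (S Z))"
    unfolding cond_def by (intro D_arith D_const D_M2[OF \<phi>(1) X])
  moreover have "cond (\<phi> (?X a)) Z (S Z) = (if \<exists>n. P a n then Z else S Z)" if "a \<in> dom c" for a
    using \<phi>(2)[OF section_M1[OF X that]] by (simp add: cond_eq)
  ultimately show ?thesis unfolding DP_def D_def by auto
qed

lemma DP_all: "DP (push c) (\<lambda>p. P (fst p) (snd p)) \<Longrightarrow> DP c (\<lambda>a. \<forall>n. P a n)"
  using DP_not[OF DP_ex[of c "\<lambda>a n. \<not> P a n", OF DP_not]] by simp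

lemma D_rec:
  assumes "D c F" "D (push (push c)) (\<lambda>p. H (fst (fst p)) (snd (fst p)) (snd p))"
  shows "\<exists>X. D (push c) (\<lambda>p. X (fst p) (snd p)) \<and>
    (\<forall>a\<in>dom c. X a Z = F a \<and> (\<forall>n. X a (S n) = H a (X a n) n))"
proof -
  obtain F' where F: "F' \<in> M2" "\<And>a. a \<in> dom c \<Longrightarrow> F a = F' (snd c a)" using D_E[OF assms(1)] by blast
  obtain H' where H: "H' \<in> M2" "\<And>p. p \<in> dom (push (push c)) \<Longrightarrow>
      H (fst (fst p)) (snd (fst p)) (snd p) = H' (snd (push (push c)) p)" using D_E[OF assms(2)] by blast
  obtain R where R: "R \<in> M2" "\<And>x. x \<in> M1 \<Longrightarrow> R (cs Z x) = F' x \<and>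
      (\<forall>n. R (cs (S n) x) = H' (cs n (cs (R (cs n x)) x)))"
    using M2_rec[OF F(1) H(1)] by blast
  let ?X = "\<lambda>a n. R (cs n (snd c a))"
  have "D (push c) (\<lambda>p. ?X (fst p) (snd p))"
    by (rule D_I[OF R(1)]) (simp add: snd_push)
  moreover have "?X a Z = F a \<and> (\<forall>n. ?X a (S n) = H a (?X a n) n)" if "a \<in> dom c" for a
    using R(2)[of "snd c a"] that F(2)[OF that] H(2)[of "((a, _), _)"] by (simp add: snd_push)
  ultimately show ?thesis by (intro exI[of _ ?X]) auto
qed

text \<open>\<open>M2_choice\<close> demands a solution for every argument. The predicate is made
  total by accepting every number where no solution exists, and that condition is definable by
  \<open>DP_ex\<close>.\<close>

lemma D_choice:
  assumes "DP (push c) (\<lambda>p. P (fst p) (snd p))"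
  shows "\<exists>F. D c F \<and> (\<forall>a\<in>dom c. (\<exists>n. P a n) \<longrightarrow> P a (F a))"
proof -
  obtain G where G: "G \<in> M2" "\<And>p. p \<in> dom (push c) \<Longrightarrow>
      (if P (fst p) (snd p) then Z else S Z) = G (snd (push c) p)"
    using assms unfolding DP_def by (rule D_E) blast
  have P: "P a n \<longleftrightarrow> G (cs n (snd c a)) = Z" if "a \<in> dom c" for a n
    using G(2)[of "(a, n)", symmetric] that by (simp add: snd_push)
  let ?Q = "\<lambda>x n. G (cs n x) = Z \<or> \<not> (\<exists>m. G (cs m x) = Z)"
  have GD: "D (push base) (\<lambda>p. G (cs (snd p) (fst p)))"
    by (rule D_I[OF G(1)]) (auto simp: snd_push)
  have "DP (push base) (\<lambda>p. ?Q (fst p) (snd p))"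
    by (intro DP_disj DP_not DP_Z DP_ex GD D_weak_fun[of base "\<lambda>x n. G (cs n x)", OF GD])
  then obtain Q' where Q': "Q' \<in> M2" "\<And>p. p \<in> dom (push base) \<Longrightarrow>
      (if ?Q (fst p) (snd p) then Z else S Z) = Q' (snd (push base) p)"
    unfolding DP_def by (rule D_E) blast
  have Q: "?Q x n \<longleftrightarrow> Q' (cs n x) = Z" if "x \<in> M1" for x n
    using Q'(2)[of "(x, n)", symmetric] that by (simp add: snd_push)
  have "\<exists>n. Q' (cs n x) = Z" if "x \<in> M1" for x
    using Q[OF that] by blast
  then obtain K where K: "K \<in> M2" "\<And>x. x \<in> M1 \<Longrightarrow> Q' (cs (K x) x) = Z"
    using M2_choice[OF Q'(1)] by blast
  have "P a (K (snd c a))" if "a \<in> dom c" "P a n" for a n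
    using Q[of "snd c a" "K (snd c a)"] K(2)[of "snd c a"] P[OF that(1)] that by auto
  moreover have "D c (\<lambda>a. K (snd c a))"
    by (rule D_I[OF K(1)]) simp
  ultimately show ?thesis by blast
qed

text \<open>The characteristic sequence belongs to \<open>M1\<close>, so equational induction proves
  that it is constantly \<open>Z\<close>.\<close>

lemma DP_induct:
  assumes "DP (push base) (\<lambda>p. P (snd p))" "P Z" "\<And>n. P n \<Longrightarrow> P (S n)"
  shows "P n"
proof -
  let ?f = "\<lambda>n. if P n then Z else S Z"
  have "?f \<in> M1" using assms(1) by (simp add: D_M1_iff DP_def)
  then have "?f n = Z"
    by (rule M1_eq_induct[OF _ M1_const]) (use assms(2,3) in \<open>auto split: if_splits\<close>)
  then show ?thesis by (simp split: if_splits)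
qed

end

section \<open>The ordered field generated by an ordered semiring\<close>

lemma semiring_diff_trans:
  fixes a b c d e f :: "'a :: linordered_semidom"
  assumes "a + d = c + b" "c + f = e + d"
  shows "a + f = e + b"
proof -
  have "(a + f) + (c + d) = (a + d) + (c + f)" by (simp add: ac_simps)
  also have "\<dots> = (e + b) + (c + d)" using assms by (simp add: ac_simps)
  finally show ?thesis by simp
qed

fun diff_rel :: "('a :: linordered_semidom) \<times> 'a \<Rightarrow> 'a \<times> 'a \<Rightarrow> bool" where
  "diff_rel (a, b) (c, d) = (a + d = c + b)"

\<comment> \<open>The ring of formal differences of the semiring. Since the numbers of the model may
  be nonstandard, \<open>int\<close> and \<open>rat\<close> cannot serve as its integers and
  rationals.\<close>
quotient_type (overloaded) 'a gint = "'a \<times> 'a :: linordered_semidom" / diff_rel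
proof (rule equivpI)
  show "reflp diff_rel" by (auto simp: reflp_def)
  show "symp diff_rel" by (auto simp: symp_def)
  show "transp diff_rel"
    unfolding transp_def using semiring_diff_trans by (auto simp del: split_paired_All) blast
qed

instantiation gint :: (linordered_semidom) comm_ring_1
begin

lift_definition zero_gint :: "'a gint" is "(0, 0)" .
lift_definition one_gint :: "'a gint" is "(1, 0)" .

lift_definition plus_gint :: "'a gint \<Rightarrow> 'a gint \<Rightarrow> 'a gint" is "\<lambda>(a, b) (c, d). (a + c, b + d)"
proof (clarsimp)
  fix a b a' b' c d c' d' :: 'a
  assume "a + b' = a' + b" "c + d' = c' + d"
  then have "(a + b') + (c + d') = (a' + b) + (c' + d)" by simp
  then show "a + c + (b' + d') = a' + c' + (b + d)" by (simp add: ac_simps)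
qed

lift_definition uminus_gint :: "'a gint \<Rightarrow> 'a gint" is "\<lambda>(a, b). (b, a)"
  by (auto simp: ac_simps)

lift_definition minus_gint :: "'a gint \<Rightarrow> 'a gint \<Rightarrow> 'a gint" is "\<lambda>(a, b) (c, d). (a + d, b + c)"
proof (clarsimp)
  fix a b a' b' c d c' d' :: 'a
  assume "a + b' = a' + b" "c + d' = c' + d"
  then have "(a + b') + (c' + d) = (a' + b) + (c + d')" by simp
  then show "a + d + (b' + c') = a' + d' + (b + c)" by (simp add: ac_simps)
qed

lift_definition times_gint :: "'a gint \<Rightarrow> 'a gint \<Rightarrow> 'a gint"
  is "\<lambda>(a, b) (c, d). (a * c + b * d, a * d + b * c)"
proof (clarsimp)
  fix a b a' b' c d c' d' :: 'a
  assume *: "a + b' = a' + b" "c + d' = c' + d"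
  have "(a * c + b * d + (a' * d' + b' * c')) + (b' * c + a' * c + a' * d + b' * d) =
      (a + b') * c + (b + a') * d + a' * (c + d') + b' * (c' + d)"
    by (simp add: algebra_simps)
  also have "\<dots> = (a' + b) * c + (a + b') * d + a' * (c' + d) + b' * (c + d')"
    using * by (simp add: add.commute)
  also have "\<dots> = (a' * c' + b' * d' + (a * d + b * c)) + (b' * c + a' * c + a' * d + b' * d)"
    by (simp add: algebra_simps)
  finally show "a * c + b * d + (a' * d' + b' * c') = a' * c' + b' * d' + (a * d + b * c)"
    by simp
qed

instance
  by standard (transfer; clarsimp simp: algebra_simps)+

end

instantiation gint :: (linordered_semidom) linordered_idom
begin

lift_definition less_eq_gint :: "'a gint \<Rightarrow> 'a gint \<Rightarrow> bool" is "\<lambda>(a, b) (c, d). a + d \<le> c + b"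
proof (clarsimp)
  fix a b a' b' c d c' d' :: 'a
  assume *: "a + b' = a' + b" "c + d' = c' + d"
  have "a + d \<le> c + b \<longleftrightarrow> (a + d) + (b' + d') \<le> (c + b) + (b' + d')" by simp
  also have "\<dots> \<longleftrightarrow> (a + b') + (d + d') \<le> (c + d') + (b + b')" by (simp add: ac_simps)
  also have "\<dots> \<longleftrightarrow> (a' + d') + (b + d) \<le> (c' + b') + (b + d)" using * by (simp add: ac_simps)
  finally show "a + d \<le> c + b \<longleftrightarrow> a' + d' \<le> c' + b'" by simp
qed

lift_definition less_gint :: "'a gint \<Rightarrow> 'a gint \<Rightarrow> bool" is "\<lambda>(a, b) (c, d). a + d < c + b"
proof (clarsimp)
  fix a b a' b' c d c' d' :: 'a
  assume *: "a + b' = a' + b" "c + d' = c' + d"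
  have "a + d < c + b \<longleftrightarrow> (a + d) + (b' + d') < (c + b) + (b' + d')" by simp
  also have "\<dots> \<longleftrightarrow> (a + b') + (d + d') < (c + d') + (b + b')" by (simp add: ac_simps)
  also have "\<dots> \<longleftrightarrow> (a' + d') + (b + d) < (c' + b') + (b + d)" using * by (simp add: ac_simps)
  finally show "a + d < c + b \<longleftrightarrow> a' + d' < c' + b'" by simp
qed

definition gint_abs: "\<bar>x :: 'a gint\<bar> = (if x < 0 then - x else x)"

definition gint_sgn: "sgn (x :: 'a gint) = (if x = 0 then 0 else if 0 < x then 1 else - 1)"

instance
proof
  fix x y z :: "'a gint"
  show "x < y \<longleftrightarrow> x \<le> y \<and> \<not> y \<le> x" by transfer auto
  show "x \<le> x" by transfer auto
  show "x \<le> z" if "x \<le> y" "y \<le> z" using that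
  proof (transfer, clarsimp)
    fix a b c d e f :: 'a
    assume "a + d \<le> c + b" "c + f \<le> e + d"
    then have "(a + d) + (c + f) \<le> (c + b) + (e + d)" by (rule add_mono)
    then have "(a + f) + (c + d) \<le> (e + b) + (c + d)" by (simp add: ac_simps)
    then show "a + f \<le> e + b" by simp
  qed
  show "x = y" if "x \<le> y" "y \<le> x" using that by transfer auto
  show "x \<le> y \<or> y \<le> x" by transfer auto
  show "z + x \<le> z + y" if "x \<le> y" using that
  proof (transfer, clarsimp)
    fix a b c d e f :: 'a
    assume "a + d \<le> c + b"
    then have "(e + f) + (a + d) \<le> (e + f) + (c + b)" by simp
    then show "e + a + (f + d) \<le> e + c + (f + b)" by (simp add: ac_simps)
  qed
  show "z * x < z * y" if "x < y" "0 < z" using that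
  proof (transfer, clarsimp)
    fix a b c d e f :: 'a
    assume *: "a + d < c + b" "f < e"
    \<comment> \<open>Written with the positive remainders \<open>s\<close> and \<open>t\<close>,
      both hypotheses become equations, and the claim reduces to
      \<open>f * s < e * s\<close>.\<close>
    define s t where "s = (c + b) - (a + d)" and "t = e - f"
    have s: "c + b = (a + d) + s" and t: "e = f + t"
      using * by (simp_all add: s_def t_def le_add_diff_inverse)
    have "0 < s" "0 < t" using * unfolding s t by simp_all
    have "e * a + f * b + (e * d + f * c) = e * (a + d) + f * (c + b)" by (simp add: algebra_simps)
    also have "\<dots> = e * (a + d) + f * (a + d) + f * s" unfolding s by (simp add: algebra_simps)
    also have "\<dots> < e * (a + d) + f * (a + d) + e * s"
      using \<open>0 < s\<close> *(2) by (simp add: mult_strict_right_mono)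
    also have "\<dots> = e * (c + b) + f * (a + d)" unfolding s by (simp add: algebra_simps)
    also have "\<dots> = e * c + f * d + (e * b + f * a)" by (simp add: algebra_simps)
    finally show "e * a + f * b + (e * d + f * c) < e * c + f * d + (e * b + f * a)" .
  qed
  show "\<bar>x\<bar> = (if x < 0 then - x else x)" by (rule gint_abs)
  show "sgn x = (if x = 0 then 0 else if 0 < x then 1 else - 1)" by (rule gint_sgn)
qed

end

lift_definition gint_of :: "'a :: linordered_semidom \<Rightarrow> 'a gint" is "\<lambda>a. (a, 0)" .

lemma gint_of_hom:
  "gint_of 0 = 0" "gint_of 1 = 1" "gint_of (a + b) = gint_of a + gint_of b"
  "gint_of (a * b) = gint_of a * gint_of b" "gint_of a < gint_of b \<longleftrightarrow> a < b"
  by (transfer, simp)+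

lemma gint_cases: "\<exists>a b. x = gint_of a - gint_of b"
  by transfer auto

definition emb :: "'a :: linordered_semidom \<Rightarrow> 'a gint fract" where
  "emb a = Fract (gint_of a) 1"

lemma emb_hom [simp]:
  "emb 0 = 0" "emb 1 = 1" "emb (a + b) = emb a + emb b" "emb (a * b) = emb a * emb b"
  by (simp_all add: emb_def gint_of_hom Zero_fract_def One_fract_def)

lemma emb_less [simp]: "emb a < emb b \<longleftrightarrow> a < b"
  by (simp add: emb_def gint_of_hom)

lemma emb_le [simp]: "emb a \<le> emb b \<longleftrightarrow> a \<le> b"
  by (simp flip: not_less)

lemma emb_eq [simp]: "emb a = emb b \<longleftrightarrow> a = b"
  by (simp add: order.eq_iff)

lemma emb_nonneg: "0 \<le> a \<Longrightarrow> 0 \<le> emb a"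
  using emb_le[of 0 a] by simp

text \<open>A negative denominator becomes positive by exchanging the two parts of the numerator, so
  fractions need only data from the semiring.\<close>

lemma fract_cases:
  obtains a b d :: "'a :: linordered_semidom" where "0 < d" "q = (emb a - emb b) / emb d"
proof (cases q)
  case (Fract x y)
  obtain a b where x: "x = gint_of a - gint_of b" using gint_cases by blast
  obtain c d where y: "y = gint_of c - gint_of d" using gint_cases by blast
  show thesis
  proof (cases "d < c")
    case True
    then have c: "c = d + (c - d)" by (simp add: le_add_diff_inverse)
    then have "gint_of c = gint_of d + gint_of (c - d)" by (metis gint_of_hom(3))
    then have "y = gint_of (c - d)" using y by simp
    then have "q = (emb a - emb b) / emb (c - d)"
      using Fract x by (simp add: emb_def divide_fract)
    moreover have "0 < c - d" using True c by (metis add_less_same_cancel1 less_add_same_cancel1)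
    ultimately show ?thesis using that by blast
  next
    case False
    then have d: "d = c + (d - c)" by (simp add: le_add_diff_inverse)
    then have "gint_of d = gint_of c + gint_of (d - c)" by (metis gint_of_hom(3))
    then have y': "y = - gint_of (d - c)" using y by simp
    then have "gint_of (d - c) \<noteq> 0" using Fract by auto
    then have "q = (emb b - emb a) / emb (d - c)"
      using Fract x y' by (simp add: emb_def divide_fract eq_fract algebra_simps)
    moreover have "c \<noteq> d" using \<open>gint_of (d - c) \<noteq> 0\<close> by (auto simp: gint_of_hom)
    then have "c + 0 < c + (d - c)" using False d by (metis add_0_right linorder_neqE)
    then have "0 < d - c" by (simp only: add_less_cancel_left)
    ultimately show ?thesis using that by blast
  qed
qed

section \<open>Rational codes in the model\<close>

text \<open>The structure of \<open>raw\<close> with its arithmetic as class operations, which makes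
  the library on ordered semirings and fields available. \<open>le_minus\<close> ties the order of
  the class to cut-off subtraction.\<close>

locale model = raw 0 "\<lambda>n. n + 1" prd "(+)" "(*)" "(-)" pw tri trr par hlf cs M1 M2
  for prd pw tri trr par hlf :: "'n :: linordered_semidom \<Rightarrow> 'n" and cs M1 M2 +
  assumes le_minus: "\<And>a b :: 'n. a \<le> b \<longleftrightarrow> a - b = 0"
begin

declare add_S [simp del] add_S_left [simp del] mul_S [simp del]

lemma zero_le [simp]: "0 \<le> (n :: 'n)"
  by (simp add: le_minus)

lemma not_less_0 [simp]: "\<not> (n :: 'n) < 0"
  by (simp add: not_less)

lemma less_iff_add1_le: "(a :: 'n) < b \<longleftrightarrow> a + 1 \<le> b"
proof
  assume "a < b"
  then obtain k where k: "b = a + k" using le_iff[of a b] le_minus[of a b] by auto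
  then have "k \<noteq> 0" using \<open>a < b\<close> by auto
  then obtain j where "k = j + 1" using Z_or_S[of k] by metis
  then show "a + 1 \<le> b" using k by (simp add: add.assoc)
next
  assume "a + 1 \<le> b"
  then show "a < b" by (metis less_add_same_cancel1 less_le_trans zero_less_one)
qed

lemma minus_pos: "(a :: 'n) < b \<Longrightarrow> 0 < b - a"
  by (metis le_minus not_le order_le_imp_less_or_eq zero_le)

lemma less_add1: "(a :: 'n) < b + 1 \<longleftrightarrow> a \<le> b"
  by (simp add: less_iff_add1_le)

lemma emb_less_iff: "emb a < emb b \<longleftrightarrow> emb a + 1 \<le> emb (b :: 'n)"
proof -
  have "emb a < emb b \<longleftrightarrow> emb (a + 1) \<le> emb b" unfolding emb_less emb_le by (rule less_iff_add1_le)
  then show ?thesis by simp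
qed

lemma emb_ge0 [simp]: "0 \<le> emb (n :: 'n)"
  by (rule emb_nonneg) simp

lemma emb_minus: "b \<le> a \<Longrightarrow> emb (a - b) = emb a - emb (b :: 'n)"
  by (metis add_diff_cancel_right' emb_hom(3) le_add_diff_inverse2)

text \<open>Variables are positions in nested pairs. One instance per depth lets
  \<open>intro\<close> recognise a variable of a formula by its shape alone.\<close>

lemma D_snds:
  "D (push c1) (\<lambda>p. snd p)"
  "D (push (push c2)) (\<lambda>p. snd (fst p))"
  "D (push (push (push c3))) (\<lambda>p. snd (fst (fst p)))"
  "D (push (push (push (push c4)))) (\<lambda>p. snd (fst (fst (fst p))))"
  "D (push (push (push (push (push c5))))) (\<lambda>p. snd (fst (fst (fst (fst p)))))"
  "D (push (push (push (push (push (push c6)))))) (\<lambda>p. snd (fst (fst (fst (fst (fst p))))))"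
  by (rule D_snd D_weak[OF D_snd] D_weak[OF D_weak[OF D_snd]] D_weak[OF D_weak[OF D_weak[OF D_snd]]]
      D_weak[OF D_weak[OF D_weak[OF D_weak[OF D_snd]]]]
      D_weak[OF D_weak[OF D_weak[OF D_weak[OF D_weak[OF D_snd]]]]])+

lemma D_var_weak:
  "D (push base) (\<lambda>p. fst p (snd p))"
  "D (push (push base)) (\<lambda>p. fst (fst p) (snd p))"
  "D (push (push (push base))) (\<lambda>p. fst (fst (fst p)) (snd p))"
  "D (push (push (push (push base)))) (\<lambda>p. fst (fst (fst (fst p))) (snd p))"
  "D (push (push (push (push (push base))))) (\<lambda>p. fst (fst (fst (fst (fst p)))) (snd p))"
  "D (push (push (push (push (push (push base)))))) (\<lambda>p. fst (fst (fst (fst (fst (fst p))))) (snd p))"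
proof -
  show 1: "D (push base) (\<lambda>p. fst p (snd p))" by (rule D_var)
  show 2: "D (push (push base)) (\<lambda>p. fst (fst p) (snd p))"
    by (rule D_weak_fun[where X = "\<lambda>a. a", OF 1])
  show 3: "D (push (push (push base))) (\<lambda>p. fst (fst (fst p)) (snd p))"
    by (rule D_weak_fun[where X = "\<lambda>a. fst a", OF 2])
  show 4: "D (push (push (push (push base)))) (\<lambda>p. fst (fst (fst (fst p))) (snd p))"
    by (rule D_weak_fun[where X = "\<lambda>a. fst (fst a)", OF 3])
  show 5: "D (push (push (push (push (push base))))) (\<lambda>p. fst (fst (fst (fst (fst p)))) (snd p))"
    by (rule D_weak_fun[where X = "\<lambda>a. fst (fst (fst a))", OF 4])
  show "D (push (push (push (push (push (push base)))))) (\<lambda>p. fst (fst (fst (fst (fst (fst p))))) (snd p))"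
    by (rule D_weak_fun[where X = "\<lambda>a. fst (fst (fst (fst a)))", OF 5])
qed

lemma D_vars:
  "D base F \<Longrightarrow> D base (\<lambda>p. p (F p))"
  "D (push base) F1 \<Longrightarrow> D (push base) (\<lambda>p. fst p (F1 p))"
  "D (push (push base)) F2 \<Longrightarrow> D (push (push base)) (\<lambda>p. fst (fst p) (F2 p))"
  "D (push (push (push base))) F3 \<Longrightarrow> D (push (push (push base))) (\<lambda>p. fst (fst (fst p)) (F3 p))"
  "D (push (push (push (push base)))) F4 \<Longrightarrow>
     D (push (push (push (push base)))) (\<lambda>p. fst (fst (fst (fst p))) (F4 p))"
  "D (push (push (push (push (push base))))) F5 \<Longrightarrow>
     D (push (push (push (push (push base))))) (\<lambda>p. fst (fst (fst (fst (fst p)))) (F5 p))"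
  by (rule D_apply[where X = "\<lambda>a. a", OF D_var_weak(1)] D_apply[where X = "\<lambda>a. fst a", OF D_var_weak(2)]
      D_apply[where X = "\<lambda>a. fst (fst a)", OF D_var_weak(3)]
      D_apply[where X = "\<lambda>a. fst (fst (fst a))", OF D_var_weak(4)]
      D_apply[where X = "\<lambda>a. fst (fst (fst (fst a)))", OF D_var_weak(5)]
      D_apply[where X = "\<lambda>a. fst (fst (fst (fst (fst a))))", OF D_var_weak(6)]; assumption)+

lemmas D_fun = D_M1[OF S_M1(2)] D_M1[OF S_M1(3)] D_M1[OF S_M1(4)] D_M1[OF S_M1(5)] D_M1[OF S_M1(6)] D_M1[OF S_M1(7)]

lemma DP_le: "D c F \<Longrightarrow> D c G \<Longrightarrow> DP c (\<lambda>a. F a \<le> G a)"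
  unfolding le_minus by (intro DP_eq D_arith D_const)

lemma DP_less: "D c F \<Longrightarrow> D c G \<Longrightarrow> DP c (\<lambda>a. F a < G a)"
  unfolding not_le[symmetric] by (intro DP_not DP_le)

lemmas D_intros = D_snds D_vars D_fun D_arith D_if D_const DP_eq DP_le DP_less DP_not DP_conj DP_disj DP_imp
  DP_iff' DP_ex DP_all DP_fixed

lemma induct0 [case_names definable zero step]:
  assumes "DP (push base) (\<lambda>p. P (snd p))" "P 0" "\<And>n. P n \<Longrightarrow> P (n + 1)"
  shows "P n"
  using assms by (rule DP_induct)

lemma least:
  assumes "DP (push base) (\<lambda>p. P (snd p))" "P n"
  shows "\<exists>m. P m \<and> (\<forall>k<m. \<not> P k)"
proof -
  have DPw: "DP (push (push base)) (\<lambda>p. P (snd p))"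
    using D_weak_fun[of base "\<lambda>_ n. if P n then 0 else 0 + 1"] assms(1) unfolding DP_def by simp
  show ?thesis
  proof (rule ccontr)
    assume no: "\<not> (\<exists>m. P m \<and> (\<forall>k<m. \<not> P k))"
    have "\<forall>k<n. \<not> P k" for n
    proof (induction n rule: induct0)
      case definable
      show ?case by (intro D_intros DPw)
    next
      case (step n)
      then show ?case using no by (metis less_add1 order_le_less)
    qed simp
    then show False using no assms(2) by blast
  qed
qed

lemma D_choose:
  assumes "DP (push c) (\<lambda>p. P (fst p) (snd p))"
  obtains F where "D c F" "\<And>a n. a \<in> dom c \<Longrightarrow> P a n \<Longrightarrow> P a (F a)"
  using D_choice[OF assms] by blast

section \<open>Powers of two and the Archimedean property\<close>

lemma pw_pos [simp]: "0 < pw n"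
proof (induction n rule: induct0)
  case definable
  show ?case by (intro D_intros)
next
  case (step n)
  then show ?case by (simp add: add_pos_pos)
qed simp

lemma pw_neq0 [simp]: "pw n \<noteq> 0"
  by (metis pw_pos less_irrefl)

lemma emb_pw_pos [simp]: "0 < emb (pw n)"
  using emb_less[of 0 "pw n"] by simp

lemma less_pw: "n < pw n"
proof (induction n rule: induct0)
  case definable
  show ?case by (intro D_intros)
next
  case (step n)
  have "1 \<le> pw n" using pw_pos[of n] less_iff_add1_le[of 0 "pw n"] by simp
  then have "n + 1 < pw n + pw n" using step by (rule add_less_le_mono[rotated])
  then show ?case by simp
qed simp

lemma pw_add: "pw (m + n) = pw m * pw n"
proof (induction n rule: induct0)
  case definable
  show ?case by (intro D_intros)
next
  case (step n)
  then show ?case by (simp flip: add.assoc add: distrib_left)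
qed simp

definition eps :: "'n \<Rightarrow> 'n gint fract" where
  "eps n = 1 / emb (pw n)"

lemma eps_pos [simp]: "0 < eps n"
  using emb_less[of 0 "pw n"] by (simp add: eps_def)

lemma eps_0 [simp]: "eps 0 = 1"
  by (simp add: eps_def)

lemma eps_add: "eps (m + n) = eps m * eps n"
  by (simp add: eps_def pw_add)

lemma eps_1 [simp]: "eps 1 = 1 / 2"
proof -
  have "pw 1 = 1 + 1" using pw_S[of 0] by (simp del: one_add_one)
  then have "emb (pw 1) = emb (1 + 1)" by (rule arg_cong)
  also have "\<dots> = 2" unfolding emb_hom by simp
  finally have "emb (pw 1) = 2" .
  then show ?thesis by (simp add: eps_def)
qed

lemma eps_Suc: "eps (n + 1) = eps n / 2"
  by (simp add: eps_add)

lemma eps_le1: "eps n \<le> 1"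
proof -
  have "1 \<le> pw n" using pw_pos[of n] less_iff_add1_le[of 0 "pw n"] by simp
  then have "1 \<le> emb (pw n)" using emb_le[of 1 "pw n"] by simp
  then show ?thesis by (simp add: eps_def)
qed

lemma eps_antimono: "m \<le> n \<Longrightarrow> eps n \<le> eps m"
proof -
  assume "m \<le> n"
  then obtain k where "n = m + k" using le_iff le_minus by metis
  then show ?thesis
    using mult_left_mono[OF eps_le1, of "eps m" k] eps_pos[of m] by (simp add: eps_add less_imp_le)
qed

text \<open>Write \<open>q\<close> as \<open>(a - b) / d\<close>. Discreteness makes the numerator
  at least 1, and \<open>d < pw d\<close>, so already \<open>n = d\<close> works. The property holds
  relative to the numbers of the model.\<close>

lemma ex_eps:
  assumes "0 < q"
  obtains n where "eps n < q"
proof -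
  obtain a b d :: 'n where d: "0 < d" and q: "q = (emb a - emb b) / emb d" by (rule fract_cases)
  have d': "0 < emb d" using emb_less[of 0 d] d by simp
  then have "emb b < emb a" using assms q by (simp add: zero_less_divide_iff)
  then have "emb b + 1 \<le> emb a" by (simp only: emb_less_iff)
  moreover have "emb d < emb (pw d)" by (simp add: less_pw)
  ultimately have "1 / emb (pw d) < (emb a - emb b) / emb d"
    using d' by (intro less_le_trans[OF divide_strict_left_mono[of "emb d" _ 1] divide_right_mono]) auto
  then show thesis using that q by (simp add: eps_def)
qed

lemma archimedean: "\<exists>n :: 'n. q < emb n"
proof (cases "0 < q")
  case True
  then have "0 < 1 / q" by simp
  then obtain n where "eps n < 1 / q" by (rule ex_eps)
  then have "q < emb (pw n)"
    using True emb_less[of 0 "pw n"] by (simp add: eps_def field_simps)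
  then show ?thesis by blast
next
  case False
  then show ?thesis using emb_less[of 0 1] by (intro exI[of _ 1]) (auto simp: not_less)
qed

section \<open>Pairing, parity and the values of rational codes\<close>

definition pr :: "'n \<Rightarrow> 'n \<Rightarrow> 'n" where "pr m n = tri (m + n) + m"
definition p1 :: "'n \<Rightarrow> 'n" where "p1 c = c - tri (trr c)"
definition p2 :: "'n \<Rightarrow> 'n" where "p2 c = trr c - p1 c"

lemma tri_mono: "tri m \<le> tri (m + n)"
proof (induction n rule: induct0)
  case definable
  show ?case by (intro D_intros)
next
  case (step n)
  then show ?case by (simp flip: add.assoc add: add_increasing2)
qed simp

text \<open>With \<open>w = trr c\<close>, the increment in the recursion is
  \<open>1 - (tri (w + 1) - (c + 1))\<close>. It equals 1 once \<open>c + 1\<close> has reached the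
  next triangular number, and 0 while at least 1 is missing.\<close>

lemma trr: "tri (trr c) \<le> c \<and> c < tri (trr c + 1)"
proof (induction c rule: induct0)
  case definable
  show ?case by (intro D_intros)
next
  case (step c)
  let ?w = "trr c"
  show ?case
  proof (cases "tri (?w + 1) \<le> c + 1")
    case True
    then have "tri (?w + 1) - (c + 1) = 0" by (simp only: le_minus)
    then have w: "trr (c + 1) = ?w + 1" by (simp del: tri_S)
    have "c + 1 \<le> tri (?w + 1)" using step less_iff_add1_le by blast
    moreover have "0 < ?w + 1 + 1" by (simp only: less_add1 zero_le)
    then have "tri (?w + 1) < tri (?w + 1) + (?w + 1 + 1)" by (simp only: less_add_same_cancel1)
    ultimately have "c + 1 < tri (?w + 1) + (?w + 1 + 1)" by (rule le_less_trans)
    then show ?thesis using True unfolding w tri_S[of "?w + 1"] by blast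
  next
    case False
    then have "c + 1 < tri (?w + 1)" by simp
    then have "c + 1 + 1 \<le> tri (?w + 1)" using less_iff_add1_le by blast
    then have "1 - (tri (?w + 1) - (c + 1)) = 0"
      unfolding le_minus[symmetric] by (metis add.commute add_le_imp_le_diff)
    then have w: "trr (c + 1) = ?w" by (simp del: tri_S)
    show ?thesis using step \<open>c + 1 < tri (?w + 1)\<close> unfolding w by (auto intro: order.trans[of _ c])
  qed
qed (use tri_S[of 0] in simp)

lemma trr_unique:
  assumes "tri w \<le> c" "c < tri (w + 1)"
  shows "trr c = w"
proof -
  have *: "u \<le> v" if "tri u \<le> c" "c < tri (v + 1)" for u v
  proof (rule ccontr)
    assume "\<not> u \<le> v"
    then have "v + 1 \<le> u" using not_le less_iff_add1_le by blast
    then obtain k where "u = (v + 1) + k" using le_iff le_minus by metis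
    then have "tri (v + 1) \<le> tri u" using tri_mono[of "v + 1" k] by simp
    then show False using that by simp
  qed
  show ?thesis using *[OF assms(1)] *[of "trr c" w] assms trr[of c] by (simp add: order.eq_iff del: tri_S)
qed

lemma trr_pr: "trr (pr m n) = m + n"
proof (rule trr_unique)
  have "m < m + n + 1" by (simp add: less_add1 add_increasing2)
  then show "pr m n < tri (m + n + 1)" by (simp add: pr_def)
qed (simp add: pr_def add_increasing2)

lemma p1_pr [simp]: "p1 (pr m n) = m" and p2_pr [simp]: "p2 (pr m n) = n"
proof -
  show 1: "p1 (pr m n) = m" unfolding p1_def trr_pr by (simp add: pr_def)
  show "p2 (pr m n) = n" unfolding p2_def trr_pr 1 by simp
qed

lemma par: "par n = 0 \<or> par n = 1"
proof (induction n rule: induct0)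
  case definable
  show ?case by (intro D_intros)
next
  case (step n)
  then show ?case by auto
qed simp

lemma hlf: "n = hlf n + hlf n + par n"
proof (induction n rule: induct0)
  case definable
  show ?case by (intro D_intros)
next
  case (step n)
  have "hlf (n + 1) + hlf (n + 1) + par (n + 1) = (hlf n + hlf n + par n) + 1"
    unfolding hlf_S par_S using par[of n] by (elim disjE) (simp_all add: ac_simps)
  then show ?case using step by simp
qed simp

text \<open>Different halves differ by at least 1, which changes the doubled part by at least 2; the
  parities can compensate only 1.\<close>

lemma par_hlf_unique:
  assumes "m + m + p = n" "p = 0 \<or> p = 1"
  shows "par n = p \<and> hlf n = m"
proof -
  let ?h = "emb (hlf n)" and ?m = "emb m"
  have "emb (hlf n + hlf n + par n) = emb (m + m + p)"
    using hlf[of n] assms(1) by simp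
  then have eq: "?h + ?h + emb (par n) = ?m + ?m + emb p" by simp
  have p: "emb p = 0 \<or> emb p = 1" "emb (par n) = 0 \<or> emb (par n) = 1"
    using assms(2) par[of n] by auto
  have "?h = ?m"
  proof (rule linorder_cases[of ?h ?m])
    assume "?h < ?m"
    then have "?h + 1 \<le> ?m" by (simp only: emb_less_iff)
    then show ?thesis using eq p by linarith
  next
    assume "?m < ?h"
    then have "?m + 1 \<le> ?h" by (simp only: emb_less_iff)
    then show ?thesis using eq p by linarith
  qed
  then show ?thesis using eq by simp
qed

lemma par_hlf [simp]:
  "par (m + m) = 0" "hlf (m + m) = m" "par (m + m + 1) = 1" "hlf (m + m + 1) = m"
  using par_hlf_unique[of m 0] par_hlf_unique[of m 1] by auto

definition posc :: "'n \<Rightarrow> 'n" where "posc q = (1 - par (p1 q)) * hlf (p1 q)"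
definition negc :: "'n \<Rightarrow> 'n" where "negc q = par (p1 q) * (hlf (p1 q) + 1)"
definition denc :: "'n \<Rightarrow> 'n" where "denc q = p2 q + 1"
definition crossc :: "'n \<Rightarrow> 'n \<Rightarrow> 'n" where "crossc q r = posc q * denc r + negc r * denc q"

definition rc :: "'n \<Rightarrow> 'n gint fract" where
  "rc q = (emb (posc q) - emb (negc q)) / emb (denc q)"

lemma denc_pos [simp]: "0 < denc q"
  by (simp add: denc_def less_add1)

lemma emb_denc_pos [simp]: "0 < emb (denc q)"
  using emb_less[of 0 "denc q"] by simp

lemma rc_even: "rc (pr (m + m) n) = emb m / emb (n + 1)"
  by (simp add: rc_def posc_def negc_def denc_def)

lemma rc_odd: "rc (pr (m + m + 1) n) = - emb (m + 1) / emb (n + 1)"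
  by (simp add: rc_def posc_def negc_def denc_def del: hlf_S par_S)

text \<open>Every element of the field has a code, which turns quantifiers over the field into
  number quantifiers. An odd first component codes a negative numerator shifted by one, hence the
  \<open>k\<close> with \<open>b - a = k + 1\<close>.\<close>

lemma rc_surj: "\<exists>c. rc c = q"
proof -
  obtain a b d :: 'n where d: "0 < d" and q: "q = (emb a - emb b) / emb d" by (rule fract_cases)
  then obtain d' where d': "d = d' + 1" using Z_or_S[of d] by (metis less_irrefl)
  show ?thesis
  proof (cases "b \<le> a")
    case True
    then have "rc (pr ((a - b) + (a - b)) d') = q" by (simp add: rc_even emb_minus q d')
    then show ?thesis ..
  next
    case False
    then have "b - a \<noteq> 0" by (simp flip: le_minus)
    then obtain k where k: "b - a = k + 1" using Z_or_S[of "b - a"] by metis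
    have "rc (pr (k + k + 1) d') = - emb (b - a) / emb d" by (simp only: rc_odd k d')
    also have "\<dots> = q" using False by (simp add: emb_minus q minus_divide_left)
    finally show ?thesis by blast
  qed
qed

lemma emb_cross: "emb (crossc q r) - emb (crossc r q) = (rc q - rc r) * (emb (denc q) * emb (denc r))"
proof -
  have 1: "rc q * emb (denc q) = emb (posc q) - emb (negc q)" for q
    using less_imp_neq[OF emb_denc_pos[of q]] by (auto simp: rc_def)
  have "(rc q - rc r) * (emb (denc q) * emb (denc r)) =
      (rc q * emb (denc q)) * emb (denc r) - (rc r * emb (denc r)) * emb (denc q)"
    by (simp add: algebra_simps)
  also have "\<dots> = emb (crossc q r) - emb (crossc r q)"
    unfolding 1 by (simp add: crossc_def algebra_simps)
  finally show ?thesis ..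
qed

text \<open>Clearing the positive denominators and the power of two translates the coded comparison
  of the formal language into an inequality of the field.\<close>

lemma cross_less_iff:
  "crossc q r * pw k < crossc r q * pw k + a * (denc q * denc r) \<longleftrightarrow> rc q - rc r < emb a * eps k"
proof -
  let ?d = "emb (denc q) * emb (denc r)"
  have d: "0 < ?d" and p: "0 < emb (pw k)" using emb_less[of 0 "pw k"] by simp_all
  have "crossc q r * pw k < crossc r q * pw k + a * (denc q * denc r) \<longleftrightarrow>
      emb (crossc q r * pw k) < emb (crossc r q * pw k + a * (denc q * denc r))" by (simp only: emb_less)
  also have "\<dots> \<longleftrightarrow> (emb (crossc q r) - emb (crossc r q)) * emb (pw k) < emb a * ?d"
    by (simp add: algebra_simps)
  also have "\<dots> \<longleftrightarrow> ((rc q - rc r) * emb (pw k)) * ?d < emb a * ?d"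
    by (simp only: emb_cross ac_simps)
  also have "\<dots> \<longleftrightarrow> (rc q - rc r) * emb (pw k) < emb a" using d by simp
  also have "\<dots> \<longleftrightarrow> rc q - rc r < emb a * eps k" using p by (simp add: eps_def pos_less_divide_eq)
  finally show ?thesis .
qed

lemma cross_le_iff:
  "crossc q r * pw k \<le> crossc r q * pw k + a * (denc q * denc r) \<longleftrightarrow> rc q - rc r \<le> emb a * eps k"
proof -
  let ?d = "emb (denc q) * emb (denc r)"
  have d: "0 < ?d" and p: "0 < emb (pw k)" using emb_less[of 0 "pw k"] by simp_all
  have "crossc q r * pw k \<le> crossc r q * pw k + a * (denc q * denc r) \<longleftrightarrow>
      emb (crossc q r * pw k) \<le> emb (crossc r q * pw k + a * (denc q * denc r))" by (simp only: emb_le)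
  also have "\<dots> \<longleftrightarrow> (emb (crossc q r) - emb (crossc r q)) * emb (pw k) \<le> emb a * ?d"
    by (simp add: algebra_simps)
  also have "\<dots> \<longleftrightarrow> ((rc q - rc r) * emb (pw k)) * ?d \<le> emb a * ?d"
    by (simp only: emb_cross ac_simps)
  also have "\<dots> \<longleftrightarrow> (rc q - rc r) * emb (pw k) \<le> emb a" using d by simp
  also have "\<dots> \<longleftrightarrow> rc q - rc r \<le> emb a * eps k" using p by (simp add: eps_def pos_le_divide_eq)
  finally show ?thesis .
qed

subsection \<open>Definable rational-valued maps\<close>

text \<open>A definable map into the field is given by definable numbers for the two parts of the
  numerator and a positive denominator, not by a chosen code. The field operations then act by
  polynomials on these numbers.\<close>

definition DK :: "'a set \<times> ('a \<Rightarrow> 'n \<Rightarrow> 'n) \<Rightarrow> ('a \<Rightarrow> 'n gint fract) \<Rightarrow> bool" where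
  "DK c F \<longleftrightarrow> (\<exists>p m d. D c p \<and> D c m \<and> D c d \<and> (\<forall>a. 0 < d a \<and> F a = (emb (p a) - emb (m a)) / emb (d a)))"

lemma DK_I:
  "D c p \<Longrightarrow> D c m \<Longrightarrow> D c d \<Longrightarrow> (\<And>a. 0 < d a) \<Longrightarrow> (\<And>a. F a = (emb (p a) - emb (m a)) / emb (d a)) \<Longrightarrow> DK c F"
  unfolding DK_def by blast

lemma DK_E:
  assumes "DK c F"
  obtains p m d where "D c p" "D c m" "D c d" "\<And>a. 0 < emb (d a)" "\<And>a. 0 < d a"
    "\<And>a. F a = (emb (p a) - emb (m a)) / emb (d a)"
proof -
  obtain p m d where "D c p" "D c m" "D c d" "\<And>a. 0 < d a \<and> F a = (emb (p a) - emb (m a)) / emb (d a)"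
    using assms unfolding DK_def by blast
  then show thesis using that[of p m d] emb_less[of 0 "d _"] by simp
qed

lemma DK_rc: "D c F \<Longrightarrow> DK c (\<lambda>a. rc (F a))"
  by (rule DK_I[of c "\<lambda>a. posc (F a)" "\<lambda>a. negc (F a)" "\<lambda>a. denc (F a)"])
    (auto simp: rc_def, auto simp: posc_def negc_def denc_def p1_def p2_def intro!: D_arith D_fun D_const)

lemma DK_emb: "D c F \<Longrightarrow> DK c (\<lambda>a. emb (F a))"
  by (rule DK_I[of c F "\<lambda>_. 0" "\<lambda>_. 1"]) (auto intro: D_const)

lemma DK_eps: "D c F \<Longrightarrow> DK c (\<lambda>a. eps (F a))"
  by (rule DK_I[of c "\<lambda>_. 1" "\<lambda>_. 0" "\<lambda>a. pw (F a)"]) (auto intro: D_const D_fun simp: eps_def)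

lemma DK_const: "DK c (\<lambda>a. q)"
proof -
  obtain a b d :: 'n where "0 < d" "q = (emb a - emb b) / emb d" by (rule fract_cases)
  then show ?thesis by (intro DK_I[of c "\<lambda>_. a" "\<lambda>_. b" "\<lambda>_. d"]) (auto intro: D_const)
qed

lemma DK_uminus:
  assumes "DK c F"
  shows "DK c (\<lambda>a. - F a)"
proof -
  obtain p m d where F: "D c p" "D c m" "D c d" "\<And>a. 0 < emb (d a)" "\<And>a. 0 < d a"
    "\<And>a. F a = (emb (p a) - emb (m a)) / emb (d a)" by (rule DK_E[OF assms]) blast
  show ?thesis by (rule DK_I[OF F(2,1,3)]) (simp_all add: F(5,6) minus_divide_left)
qed

lemma DK_plus:
  assumes "DK c F" "DK c G"
  shows "DK c (\<lambda>a. F a + G a)"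
proof -
  obtain p m d where F: "D c p" "D c m" "D c d" "\<And>a. 0 < emb (d a)" "\<And>a. 0 < d a"
    "\<And>a. F a = (emb (p a) - emb (m a)) / emb (d a)" by (rule DK_E[OF assms(1)]) blast
  obtain p' m' d' where G: "D c p'" "D c m'" "D c d'" "\<And>a. 0 < emb (d' a)" "\<And>a. 0 < d' a"
    "\<And>a. G a = (emb (p' a) - emb (m' a)) / emb (d' a)" by (rule DK_E[OF assms(2)]) blast
  have nz: "emb (d a) \<noteq> 0" "emb (d' a) \<noteq> 0" for a using F(4)[of a] G(4)[of a] by auto
  have eq: "emb (p a) = emb (m a) + F a * emb (d a)" "emb (p' a) = emb (m' a) + G a * emb (d' a)" for a
    using F(6)[of a] G(6)[of a] nz[of a] by simp_all
  show ?thesis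
    by (rule DK_I[of c "\<lambda>a. p a * d' a + p' a * d a" "\<lambda>a. m a * d' a + m' a * d a" "\<lambda>a. d a * d' a"])
      (use F(1-3,5) G(1-3,5) nz in \<open>auto intro!: D_arith simp: eq nonzero_eq_divide_eq algebra_simps\<close>)
qed

lemma DK_times:
  assumes "DK c F" "DK c G"
  shows "DK c (\<lambda>a. F a * G a)"
proof -
  obtain p m d where F: "D c p" "D c m" "D c d" "\<And>a. 0 < emb (d a)" "\<And>a. 0 < d a"
    "\<And>a. F a = (emb (p a) - emb (m a)) / emb (d a)" by (rule DK_E[OF assms(1)]) blast
  obtain p' m' d' where G: "D c p'" "D c m'" "D c d'" "\<And>a. 0 < emb (d' a)" "\<And>a. 0 < d' a"
    "\<And>a. G a = (emb (p' a) - emb (m' a)) / emb (d' a)" by (rule DK_E[OF assms(2)]) blast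
  have nz: "emb (d a) \<noteq> 0" "emb (d' a) \<noteq> 0" for a using F(4)[of a] G(4)[of a] by auto
  have eq: "emb (p a) = emb (m a) + F a * emb (d a)" "emb (p' a) = emb (m' a) + G a * emb (d' a)" for a
    using F(6)[of a] G(6)[of a] nz[of a] by simp_all
  show ?thesis
    by (rule DK_I[of c "\<lambda>a. p a * p' a + m a * m' a" "\<lambda>a. p a * m' a + m a * p' a" "\<lambda>a. d a * d' a"])
      (use F(1-3,5) G(1-3,5) nz in \<open>auto intro!: D_arith simp: eq nonzero_eq_divide_eq algebra_simps\<close>)
qed

lemma DK_minus: "DK c F \<Longrightarrow> DK c G \<Longrightarrow> DK c (\<lambda>a. F a - G a)"
  using DK_plus[OF _ DK_uminus] by simp

lemma DK_inverse:
  assumes "DK c F"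
  shows "DK c (\<lambda>a. inverse (F a))"
proof -
  obtain p m d where F: "D c p" "D c m" "D c d" "\<And>a. 0 < emb (d a)" "\<And>a. 0 < d a"
    "\<And>a. F a = (emb (p a) - emb (m a)) / emb (d a)" by (rule DK_E[OF assms]) blast
  show ?thesis
  \<comment> \<open>The new denominator is the absolute difference of the old numerator parts. If it
    vanishes, 1 replaces it and the numerator is 0, in agreement with
    \<open>inverse 0 = 0\<close>.\<close>
  proof (rule DK_I[of c "\<lambda>a. if m a < p a then d a else 0" "\<lambda>a. if p a < m a then d a else 0"
        "\<lambda>a. if m a < p a then p a - m a else if p a < m a then m a - p a else 1"])
    fix a
    show "0 < (if m a < p a then p a - m a else if p a < m a then m a - p a else 1)"
      by (simp add: minus_pos)
    show "inverse (F a) = (emb (if m a < p a then d a else 0) - emb (if p a < m a then d a else 0)) /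
        emb (if m a < p a then p a - m a else if p a < m a then m a - p a else 1)"
      using F(4)[of a] unfolding F(6)
      by (cases "m a" "p a" rule: linorder_cases) (auto simp: emb_minus field_simps)
  qed (intro D_if DP_less D_const D_arith F)+
qed

lemma DK_divide: "DK c F \<Longrightarrow> DK c G \<Longrightarrow> DK c (\<lambda>a. F a / G a)"
  unfolding divide_inverse by (intro DK_times DK_inverse)

lemma DP_K_le:
  assumes "DK c F" "DK c G"
  shows "DP c (\<lambda>a. F a \<le> G a)"
proof -
  obtain p m d where F: "D c p" "D c m" "D c d" "\<And>a. 0 < emb (d a)" "\<And>a. 0 < d a"
    "\<And>a. F a - G a = (emb (p a) - emb (m a)) / emb (d a)" by (rule DK_E[OF DK_minus[OF assms]]) blast
  have "F a \<le> G a \<longleftrightarrow> p a \<le> m a" for a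
  proof -
    have "F a \<le> G a \<longleftrightarrow> F a - G a \<le> 0" by simp
    also have "\<dots> \<longleftrightarrow> emb (p a) - emb (m a) \<le> 0" unfolding F(6) using F(4)[of a] by (simp add: divide_le_0_iff)
    finally show ?thesis by simp
  qed
  then show ?thesis using DP_le[OF F(1,2)] by simp
qed

lemma DP_K_less: "DK c F \<Longrightarrow> DK c G \<Longrightarrow> DP c (\<lambda>a. F a < G a)"
  unfolding not_le[symmetric] by (intro DP_not DP_K_le)

lemma DP_K_eq: "DK c F \<Longrightarrow> DK c G \<Longrightarrow> DP c (\<lambda>a. F a = G a)"
  unfolding order.eq_iff by (intro DP_conj DP_K_le)

lemma ex_rc: "(\<exists>q. P q) \<longleftrightarrow> (\<exists>c. P (rc c))"
  by (metis rc_surj)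

lemma all_rc: "(\<forall>q. P q) \<longleftrightarrow> (\<forall>c. P (rc c))"
  by (metis rc_surj)

lemma DP_K_ex: "DP (push c) (\<lambda>p. P (fst p) (rc (snd p))) \<Longrightarrow> DP c (\<lambda>a. \<exists>q. P a q)"
  unfolding ex_rc by (rule DP_ex)

lemma DP_K_all: "DP (push c) (\<lambda>p. P (fst p) (rc (snd p))) \<Longrightarrow> DP c (\<lambda>a. \<forall>q. P a q)"
  unfolding all_rc by (rule DP_all)

lemma DK_if:
  assumes "DP c P" "DK c F" "DK c G"
  shows "DK c (\<lambda>a. if P a then F a else G a)"
proof -
  obtain p m d where F: "D c p" "D c m" "D c d" "\<And>a. 0 < emb (d a)" "\<And>a. 0 < d a"
    "\<And>a. F a = (emb (p a) - emb (m a)) / emb (d a)" by (rule DK_E[OF assms(2)]) blast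
  obtain p' m' d' where G: "D c p'" "D c m'" "D c d'" "\<And>a. 0 < emb (d' a)" "\<And>a. 0 < d' a"
    "\<And>a. G a = (emb (p' a) - emb (m' a)) / emb (d' a)" by (rule DK_E[OF assms(3)]) blast
  show ?thesis
    by (rule DK_I[OF D_if[OF assms(1) F(1) G(1)] D_if[OF assms(1) F(2) G(2)] D_if[OF assms(1) F(3) G(3)]])
      (simp_all add: F(5,6) G(5,6))
qed

lemmas def_intros = D_intros DK_rc DK_emb DK_eps DK_const DK_uminus DK_plus DK_times DK_minus DK_inverse
  DK_divide DK_if DP_K_le DP_K_less DP_K_eq DP_K_ex DP_K_all

end

section \<open>Reals and cuts\<close>

definition lower_open :: "('f :: linordered_field \<Rightarrow> bool) \<Rightarrow> bool" where
  "lower_open P \<longleftrightarrow> (\<forall>p q. P q \<longrightarrow> p \<le> q \<longrightarrow> P p) \<and> (\<forall>q. P q \<longrightarrow> (\<exists>p>q. P p))"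

definition cut :: "('f :: linordered_field \<Rightarrow> bool) \<Rightarrow> bool" where
  "cut P \<longleftrightarrow> lower_open P \<and> (\<exists>q. P q) \<and> (\<exists>q. \<not> P q)"

lemma lower_openD:
  assumes "lower_open P"
  shows "P q \<Longrightarrow> p \<le> q \<Longrightarrow> P p" "P q \<Longrightarrow> \<exists>p>q. P p" "P q \<Longrightarrow> \<not> P p \<Longrightarrow> q < p"
  using assms by (auto simp: lower_open_def) (meson not_le)

text \<open>The constant 2 makes the branches meet at 1/2: nonnegative elements fill
  \<open>[1/2, 1)\<close> and negative ones fill \<open>(0, 1/2)\<close>. Only field operations and
  a case distinction occur, so the map is definable.\<close>

definition squeeze :: "'f :: linordered_field \<Rightarrow> 'f" where
  "squeeze q = (if 0 \<le> q then 1 - 1 / (q + 2) else 1 / (2 - q))"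

lemma squeeze_bounds: "0 < squeeze q" "squeeze q < 1"
  by (auto simp: squeeze_def field_simps)

lemma squeeze_less: "p < q \<Longrightarrow> squeeze p < squeeze q"
proof -
  assume "p < q"
  consider "0 \<le> p" | "p < 0" "0 \<le> q" | "q < 0" using \<open>p < q\<close> by linarith
  then show ?thesis
  proof cases
    case 1
    then show ?thesis using \<open>p < q\<close> by (simp add: squeeze_def divide_strict_left_mono mult_pos_pos add_nonneg_pos)
  next
    case 2
    have "1 / (2 - p) < 1 / 2" "1 / (q + 2) \<le> 1 / 2" using 2 by (simp_all add: field_simps)
    moreover have "1 / 2 + 1 / 2 = (1 :: 'a)" by (simp add: field_simps)
    ultimately have "1 / (2 - p) < 1 - 1 / (q + 2)" by linarith
    then show ?thesis using 2 by (simp add: squeeze_def)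
  next
    case 3
    then show ?thesis using \<open>p < q\<close> by (simp add: squeeze_def field_simps)
  qed
qed

lemma squeeze_less_iff [simp]: "squeeze p < squeeze q \<longleftrightarrow> p < q"
  by (metis squeeze_less not_less_iff_gr_or_eq)

lemma squeeze_le_iff [simp]: "squeeze p \<le> squeeze q \<longleftrightarrow> p \<le> q"
  by (simp flip: not_less)

lemma squeeze_surj:
  assumes "0 < p" "p < 1"
  obtains q where "p = squeeze q"
proof (cases "1 / 2 \<le> p")
  case True
  have "0 \<le> 1 / (1 - p) - 2" using True assms by (simp add: field_simps)
  then have "squeeze (1 / (1 - p) - 2) = p" by (simp add: squeeze_def)
  then show ?thesis using that by metis
next
  case False
  have "2 - 1 / p < 0" using False assms by (simp add: field_simps)
  then have "squeeze (2 - 1 / p) = p" by (simp add: squeeze_def)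
  then show ?thesis using that by metis
qed

context model
begin

section \<open>Cauchy reals and their lower cuts\<close>

definition realp :: "('n \<Rightarrow> 'n) \<Rightarrow> bool" where
  "realp x \<longleftrightarrow> (\<forall>n i. rc (x n) - rc (x (n + i)) < eps n \<and> rc (x (n + i)) - rc (x n) < eps n)"

definition rleq :: "('n \<Rightarrow> 'n) \<Rightarrow> ('n \<Rightarrow> 'n) \<Rightarrow> bool" where
  "rleq x y \<longleftrightarrow> (\<forall>n. rc (x n) - rc (y n) \<le> 2 * eps n)"

text \<open>The lower cut of the real. The margin \<open>eps k\<close> covers the error of the
  approximation \<open>x k\<close>, so one good approximation certifies the inequality.\<close>

definition below :: "('n \<Rightarrow> 'n) \<Rightarrow> 'n gint fract \<Rightarrow> bool" where
  "below x q \<longleftrightarrow> (\<exists>k. q + eps k < rc (x k))"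

lemma realp_le:
  assumes "realp x" "m \<le> n"
  shows "rc (x m) - rc (x n) < eps m" "rc (x n) - rc (x m) < eps m"
proof -
  obtain i where "n = m + i" using assms(2) le_iff le_minus by metis
  then show "rc (x m) - rc (x n) < eps m" "rc (x n) - rc (x m) < eps m"
    using assms(1) by (auto simp: realp_def)
qed

lemma realp_upper:
  assumes "realp x" "below x q"
  shows "q < rc (x n) + eps n"
proof -
  obtain k where k: "q + eps k < rc (x k)" using assms(2) by (auto simp: below_def)
  show ?thesis
  proof (cases "k \<le> n")
    case True
    then show ?thesis using realp_le[OF assms(1) True] k eps_pos[of n] by linarith
  next
    case False
    then have nk: "n \<le> k" by simp
    show ?thesis using realp_le[OF assms(1) nk] k eps_pos[of k] by linarith
  qed
qed

lemma cut_below: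
  assumes "realp x"
  shows "cut (below x)"
proof -
  have 1: "below x p" if "below x q" "p \<le> q" for p q
    using that by (auto simp: below_def intro: le_less_trans[OF add_right_mono])
  have 2: "\<exists>p>q. below x p" if b: "below x q" for q
  proof -
    obtain k where k: "q + eps k < rc (x k)" using b by (auto simp: below_def)
    \<comment> \<open>The midpoint of \<open>q\<close> and \<open>rc (x k) - eps k\<close> has the
      same certificate \<open>k\<close>.\<close>
    define p where "p = (q + (rc (x k) - eps k)) / 2"
    have "q < p" "p + eps k < rc (x k)" using k by (simp_all add: p_def field_simps)
    then show ?thesis by (auto simp: below_def)
  qed
  have 3: "below x (rc (x 0) - 2)"
    unfolding below_def by (rule exI[of _ 0]) simp
  have 4: "\<not> below x (rc (x 0) + 1)"
    using realp_upper[OF assms, of "rc (x 0) + 1" 0] by auto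
  show ?thesis using 1 2 3 4 unfolding cut_def lower_open_def by blast
qed

lemma rleq_iff:
  assumes "realp x" "realp y"
  shows "rleq x y \<longleftrightarrow> (\<forall>q. below x q \<longrightarrow> below y q)"
proof
  assume *: "rleq x y"
  show "\<forall>q. below x q \<longrightarrow> below y q"
  proof (intro allI impI)
    fix q assume "below x q"
    then obtain k where k: "q + eps k < rc (x k)" by (auto simp: below_def)
    \<comment> \<open>The gap is divided by three: \<open>rleq\<close> costs two errors of size
      \<open>eps n\<close>, and the margin in \<open>below y\<close> is a third.\<close>
    then have "0 < (rc (x k) - q - eps k) / 3" by simp
    then obtain m where m: "eps m < (rc (x k) - q - eps k) / 3" by (rule ex_eps)
    define n where "n = k + m"
    have n: "k \<le> n" "m \<le> n" by (simp_all add: n_def add_increasing add_increasing2)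
    have "rc (x k) - rc (x n) < eps k" using realp_le[OF assms(1) n(1)] by simp
    moreover have "rc (x n) - rc (y n) \<le> 2 * eps n" using * by (simp add: rleq_def)
    moreover have "eps n \<le> eps m" by (rule eps_antimono[OF n(2)])
    moreover have "3 * eps m < rc (x k) - q - eps k" using m by (simp add: field_simps)
    ultimately have "q + eps n < rc (y n)" by linarith
    then show "below y q" by (auto simp: below_def)
  qed
next
  assume *: "\<forall>q. below x q \<longrightarrow> below y q"
  show "rleq x y"
    unfolding rleq_def
  proof (rule allI, rule ccontr)
    fix n assume "\<not> rc (x n) - rc (y n) \<le> 2 * eps n"
    \<comment> \<open>A violation of the inequality leaves room for a rational that
      \<open>x n\<close> certifies as smaller while \<open>y n\<close> certifies the
      opposite.\<close>
    then have "rc (y n) + eps n < rc (x n) - eps n" by linarith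
    then obtain q where q: "rc (y n) + eps n < q" "q < rc (x n) - eps n" using dense by blast
    then have "below x q" unfolding below_def by (intro exI[of _ n]) linarith
    then show False using * realp_upper[OF assms(2), of q n] q(1) by auto
  qed
qed

lemma req_iff:
  assumes "realp x" "realp y"
  shows "rleq x y \<and> rleq y x \<longleftrightarrow> below x = below y"
  using rleq_iff[OF assms] rleq_iff[OF assms(2,1)] by (auto simp: fun_eq_iff)

lemma realp_const: "realp (\<lambda>_. c)"
  by (simp add: realp_def)

lemma below_const: "below (\<lambda>_. c) q \<longleftrightarrow> q < rc c"
proof
  assume "q < rc c"
  then have "0 < rc c - q" by simp
  then obtain k where "eps k < rc c - q" by (rule ex_eps)
  then show "below (\<lambda>_. c) q" unfolding below_def by (intro exI[of _ k]) linarith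
next
  assume "below (\<lambda>_. c) q"
  then obtain k where "q + eps k < rc c" by (auto simp: below_def)
  then show "q < rc c" using eps_pos[of k] by linarith
qed

definition unitp :: "('n \<Rightarrow> 'n) \<Rightarrow> bool" where
  "unitp x \<longleftrightarrow> realp x \<and> rleq (\<lambda>_. pr 0 0) x \<and> rleq x (\<lambda>_. pr (1 + 1) 0)"

lemma unitp_iff: "unitp x \<longleftrightarrow> realp x \<and> (\<forall>q<0. below x q) \<and> (\<forall>q. below x q \<longrightarrow> q < 1)"
proof -
  have "rc (pr 0 0) = 0" "rc (pr (1 + 1) 0) = 1"
    using rc_even[of 0 0] rc_even[of 1 0] by simp_all
  then show ?thesis
    unfolding unitp_def using rleq_iff[OF realp_const, of x] rleq_iff[OF _ realp_const, of x]
    by (auto simp: below_const)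
qed

text \<open>Going up from a member in steps of width \<open>\<delta>\<close>, the Archimedean
  property forces an exit from the cut. The point before the first exit is the one sought.\<close>

lemma cut_step:
  assumes "cut P" "(\<lambda>m. if P (rc m) then 0 else 0 + 1) \<in> M1" "0 < \<delta>"
  shows "\<exists>m. P (rc m) \<and> \<not> P (rc m + \<delta>)"
proof -
  let ?f = "\<lambda>m. if P (rc m) then 0 else 0 + 1 :: 'n"
  obtain q0 q1 where q: "P q0" "\<not> P q1" using assms(1) by (auto simp: cut_def)
  have lo: "lower_open P" using assms(1) by (simp add: cut_def)
  obtain n :: 'n where "(q1 - q0) / \<delta> < emb n" using archimedean by blast
  then have n: "q1 < q0 + emb n * \<delta>" using assms(3) by (simp add: pos_divide_less_eq)
  \<comment> \<open>Membership is available as a sequence over codes only, so it is expressed at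
    \<open>q0 + emb i * \<delta>\<close> through a code of that value.\<close>
  have "DP (push base) (\<lambda>p. \<exists>m. rc m = q0 + emb (snd p) * \<delta> \<and> \<not> ?f m = 0)"
    by (intro def_intros D_M1[OF assms(2)])
  moreover have "(\<exists>m. rc m = q0 + emb i * \<delta> \<and> \<not> ?f m = 0) \<longleftrightarrow> \<not> P (q0 + emb i * \<delta>)" for i
  proof -
    obtain c where c: "q0 + emb i * \<delta> = rc c" using rc_surj[of "q0 + emb i * \<delta>"] by metis
    show ?thesis unfolding c by (auto intro!: exI[of _ c])
  qed
  ultimately have d: "DP (push base) (\<lambda>p. \<not> P (q0 + emb (snd p) * \<delta>))" by simp
  have "\<not> P (q0 + emb n * \<delta>)" using lower_openD(1)[OF lo] q(2) n by (meson less_imp_le)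
  then obtain m where m: "\<not> P (q0 + emb m * \<delta>)" "\<And>k. k < m \<Longrightarrow> \<not> \<not> P (q0 + emb k * \<delta>)"
    using least[where P = "\<lambda>i. \<not> P (q0 + emb i * \<delta>)", OF d] by blast
  have "m \<noteq> 0" using m(1) q(1) by auto
  then obtain j where j: "m = j + 1" using Z_or_S[of m] by metis
  then have "P (q0 + emb j * \<delta>)" using m(2)[of j] by (simp add: less_add1)
  moreover have "q0 + emb m * \<delta> = (q0 + emb j * \<delta>) + \<delta>" by (simp add: j algebra_simps)
  moreover obtain c where "rc c = q0 + emb j * \<delta>" using rc_surj by blast
  ultimately show ?thesis using m(1) by metis
qed

text \<open>Approximation \<open>n\<close> is a rational in the cut which leaves it when
  \<open>eps (n + 1)\<close> is added. Definable choice selects it uniformly in the parameter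
  \<open>a\<close>, so maps of cuts lift to maps of representatives.\<close>

lemma cut_realization:
  assumes "DP (push c) (\<lambda>p. P (fst p) (rc (snd p)))"
  shows "\<exists>h. D (push c) (\<lambda>p. h (fst p) (snd p)) \<and>
    (\<forall>a\<in>dom c. cut (P a) \<longrightarrow> realp (h a) \<and> below (h a) = P a)"
proof -
  let ?X = "\<lambda>a n. if P a (rc n) then 0 else 0 + 1 :: 'n"
  have X0: "D (push c) (\<lambda>p. ?X (fst p) (snd p))" using assms by (simp only: DP_def)
  have X1: "D (push (push c)) (\<lambda>p. ?X (fst (fst p)) (snd p))" by (rule D_weak_fun[of c ?X, OF X0])
  have X2: "D (push (push (push c))) (\<lambda>p. ?X (fst (fst (fst p))) (snd p))"
    by (rule D_weak_fun[of "push c" "\<lambda>a. ?X (fst a)", OF X1])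
  have P1: "DP (push (push c)) (\<lambda>p. P (fst (fst p)) (rc (snd p)))" using X1 by (simp only: DP_def)
  have P2: "DP (push (push (push c))) (\<lambda>p. P (fst (fst (fst p))) (rc (snd p)))" using X2 by (simp only: DP_def)
  \<comment> \<open>\<open>P\<close> is known to be definable only at values of codes, hence the
    detour over a code of the shifted rational.\<close>
  let ?Q = "\<lambda>p m. P (fst p) (rc m) \<and> \<not> (\<exists>k. rc k = rc m + eps (snd p + 1) \<and> P (fst p) (rc k))"
  have "DP (push (push c)) (\<lambda>p. ?Q (fst p) (snd p))"
    by (intro def_intros P1 P2)
  then obtain F where F: "D (push c) F" "\<And>a n. a \<in> dom (push c) \<Longrightarrow> ?Q a n \<Longrightarrow> ?Q a (F a)"
    by (rule D_choose) blast
  define h where "h a n = F (a, n)" for a n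
  have h: "P a (rc (h a n)) \<and> \<not> P a (rc (h a n) + eps (n + 1))" if a: "a \<in> dom c" "cut (P a)" for a n
  proof -
    obtain m where "P a (rc m) \<and> \<not> P a (rc m + eps (n + 1))"
      using cut_step[OF a(2) section_M1[of c ?X, OF X0 a(1)] eps_pos] by blast
    then have "?Q (a, n) m" by auto
    then have "?Q (a, n) (F (a, n))" using F(2)[of "(a, n)" m] a(1) by simp
    then show ?thesis using rc_surj[of "rc (h a n) + eps (n + 1)"] by (auto simp: h_def)
  qed
  have "D (push c) (\<lambda>p. h (fst p) (snd p))" using F(1) by (simp add: h_def)
  moreover have "realp (h a) \<and> below (h a) = P a" if a: "a \<in> dom c" "cut (P a)" for a
  proof
    have lo: "lower_open (P a)" using a(2) by (simp add: cut_def)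
    have lt: "rc (h a m) < rc (h a n) + eps (n + 1)" for m n
      using lower_openD(3)[OF lo] h[OF a] by blast
    show "realp (h a)"
      unfolding realp_def
    proof (intro allI conjI)
      fix n i
      have "eps (n + 1) < eps n" using eps_pos[of n] by (simp add: eps_Suc)
      moreover have "eps (n + i + 1) \<le> eps (n + 1)"
        by (rule eps_antimono) (simp add: add_increasing2)
      ultimately show "rc (h a n) - rc (h a (n + i)) < eps n" "rc (h a (n + i)) - rc (h a n) < eps n"
        using lt[of n "n + i"] lt[of "n + i" n] by linarith+
    qed
    show "below (h a) = P a"
    proof
      fix q
      show "below (h a) q \<longleftrightarrow> P a q"
      proof
        assume "below (h a) q"
        then obtain k where "q + eps k < rc (h a k)" by (auto simp: below_def)
        then have "q \<le> rc (h a k)" using eps_pos[of k] by linarith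
        then show "P a q" using lower_openD(1)[OF lo] h[OF a] by blast
      next
        assume "P a q"
        then obtain p where p: "q < p" "P a p" using lower_openD(2)[OF lo] by blast
        then have "0 < (p - q) / 2" by simp
        then obtain k where k: "eps k < (p - q) / 2" by (rule ex_eps)
        have "p < rc (h a k) + eps (k + 1)" using lower_openD(3)[OF lo] p(2) h[OF a] by blast
        moreover have "eps (k + 1) < eps k" using eps_pos[of k] by (simp add: eps_Suc)
        moreover have "2 * eps k < p - q" using k by (simp add: field_simps)
        ultimately have "q + eps k < rc (h a k)" by linarith
        then show "below (h a) q" by (auto simp: below_def)
      qed
    qed
  qed
  ultimately show ?thesis by blast
qed

subsection \<open>The unit interval and the real line\<close>

definition from_unit :: "('n gint fract \<Rightarrow> bool) \<Rightarrow> 'n gint fract \<Rightarrow> bool" where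
  "from_unit B q \<longleftrightarrow> B (squeeze q)"

text \<open>The disjunct \<open>p < 0\<close> sends the empty cut to the cut of 0; the whole field
  goes to the cut of 1.\<close>

definition to_unit :: "('n gint fract \<Rightarrow> bool) \<Rightarrow> 'n gint fract \<Rightarrow> bool" where
  "to_unit C p \<longleftrightarrow> p < 0 \<or> (\<exists>q. C q \<and> p \<le> squeeze q)"

text \<open>A member of \<open>B\<close> above some \<open>squeeze q\<close> is positive and, by
  assumption, below 1. Hence it is itself in the range of \<open>squeeze\<close>, and openness
  carries over.\<close>

lemma lower_open_from_unit:
  assumes "cut B" "\<And>q. B q \<Longrightarrow> q < 1"
  shows "lower_open (from_unit B)"
proof -
  have lo: "lower_open B" using assms(1) by (simp add: cut_def)
  have "\<exists>p>q. B (squeeze p)" if b: "B (squeeze q)" for q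
  proof -
    obtain p where p: "squeeze q < p" "B p" using lower_openD(2)[OF lo b] by blast
    moreover have "0 < p" using p(1) squeeze_bounds(1)[of q] by linarith
    ultimately obtain r where "p = squeeze r" using assms(2) by (blast intro: squeeze_surj)
    then show ?thesis using p by auto
  qed
  then show ?thesis
    unfolding lower_open_def from_unit_def using lower_openD(1)[OF lo] squeeze_le_iff by blast
qed

lemma to_unit_from_unit:
  assumes "cut B" "\<And>q. q < 0 \<Longrightarrow> B q" "\<And>q. B q \<Longrightarrow> q < 1"
  shows "to_unit (from_unit B) = B"
proof
  fix p
  have lo: "lower_open B" using assms(1) by (simp add: cut_def)
  have "\<exists>q. B (squeeze q) \<and> p \<le> squeeze q" if b: "B p" "\<not> p < 0"
  proof -
    obtain r where r: "p < r" "B r" using lower_openD(2)[OF lo b(1)] by blast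
    then have "0 < r" "r < 1" using b(2) assms(3) by auto
    then obtain q where "r = squeeze q" by (rule squeeze_surj)
    then show ?thesis using r by auto
  qed
  then show "to_unit (from_unit B) p = B p"
    using lower_openD(1)[OF lo] assms(2) by (auto simp: to_unit_def from_unit_def)
qed

lemma from_unit_to_unit:
  assumes "lower_open C"
  shows "from_unit (to_unit C) = C"
  using lower_openD(1)[OF assms] squeeze_bounds(1) by (auto simp: fun_eq_iff to_unit_def from_unit_def not_less less_imp_le dest: less_asym)

lemma to_unit_props:
  assumes "lower_open C"
  shows "cut (to_unit C)" "q < 0 \<Longrightarrow> to_unit C q" "to_unit C q \<Longrightarrow> q < 1"
proof -
  show lt: "q < 1" if "to_unit C q" for q
    using that squeeze_bounds(2) by (auto simp: to_unit_def intro: le_less_trans less_trans)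
  show neg: "to_unit C q" if "q < 0" for q using that by (simp add: to_unit_def)
  have "\<exists>p>q. to_unit C p" if q: "to_unit C q" for q
  proof (cases "q < 0")
    case True
    then obtain p where "q < p" "p < 0" using dense by blast
    then show ?thesis using neg by blast
  next
    case False
    then obtain r where r: "C r" "q \<le> squeeze r" using q by (auto simp: to_unit_def)
    then obtain r' where "r < r'" "C r'" using lower_openD(2)[OF assms] by blast
    then show ?thesis using r by (intro exI[of _ "squeeze r'"]) (auto simp: to_unit_def intro: le_less_trans)
  qed
  moreover have "to_unit C p" if "to_unit C q" "p \<le> q" for p q
    using that by (auto simp: to_unit_def intro: order.trans)
  moreover have "to_unit C (-1)" "\<not> to_unit C 1" using neg[of "-1"] lt[of 1] by auto
  ultimately show "cut (to_unit C)" unfolding cut_def lower_open_def by blast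
qed

section \<open>Absorbing the improper cuts\<close>

definition seg :: "'n \<Rightarrow> 'n gint fract \<Rightarrow> bool" where
  "seg n q \<longleftrightarrow> q < emb n"

text \<open>
  Hilbert's hotel on the cuts of the natural numbers makes room for the two improper cuts.
\<close>

definition hotel :: "('n gint fract \<Rightarrow> bool) \<Rightarrow> 'n gint fract \<Rightarrow> bool" where
  "hotel C q \<longleftrightarrow> ((\<forall>p. \<not> C p) \<and> seg 0 q) \<or> ((\<forall>p. C p) \<and> seg 1 q) \<or>
     (\<exists>n. (\<forall>p. C p \<longleftrightarrow> seg n p) \<and> seg (n + 1 + 1) q) \<or>
     (\<not> (\<forall>p. C p) \<and> \<not> (\<exists>n. \<forall>p. C p \<longleftrightarrow> seg n p) \<and> C q)"

text \<open>At \<open>seg 0\<close> no disjunct applies, which yields the empty cut. The case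
  distinction is a formula with number and rational quantifiers, so the rules for definability cover
  it.\<close>

definition unhotel :: "('n gint fract \<Rightarrow> bool) \<Rightarrow> 'n gint fract \<Rightarrow> bool" where
  "unhotel B q \<longleftrightarrow> (\<forall>p. B p \<longleftrightarrow> seg 1 p) \<or> (\<exists>n. (\<forall>p. B p \<longleftrightarrow> seg (n + 1 + 1) p) \<and> seg n q) \<or>
     (\<not> (\<exists>n. \<forall>p. B p \<longleftrightarrow> seg n p) \<and> B q)"

lemma cut_seg: "cut (seg n)"
proof -
  have "\<exists>p>q. p < emb n" if "q < emb n" for q :: "'n gint fract" using dense[OF that] by blast
  moreover have "emb n - 1 < emb n" "\<not> emb n < emb n" by auto
  ultimately show ?thesis unfolding cut_def lower_open_def seg_def by (meson le_less_trans)
qed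

lemma seg_inject [simp]: "seg m = seg n \<longleftrightarrow> m = n"
proof
  assume "seg m = seg n"
  then have "seg m (emb m) = seg n (emb m)" "seg m (emb n) = seg n (emb n)" by simp_all
  then show "m = n" by (simp add: seg_def)
qed simp

lemma hotel_cases:
  assumes "lower_open C"
  obtains "C = (\<lambda>q. False)" | "C = (\<lambda>q. True)" | n where "C = seg n"
    | "cut C" "\<And>n. C \<noteq> seg n"
  using assms unfolding cut_def by (metis ext)

lemma hotel_improper: "hotel (\<lambda>q. False) = seg 0" "hotel (\<lambda>q. True) = seg 1"
  using cut_seg by (auto simp: hotel_def fun_eq_iff cut_def)

lemma hotel_seg: "hotel (seg n) = seg (n + 1 + 1)"
proof -
  have "\<exists>p. seg n p" "\<exists>p. \<not> seg n p" using cut_seg[of n] by (auto simp: cut_def)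
  moreover have "(\<forall>p. seg n p = seg m p) \<longleftrightarrow> m = n" for m
    using seg_inject[of n m] by (auto simp: fun_eq_iff simp del: seg_inject)
  ultimately show ?thesis by (auto simp: hotel_def fun_eq_iff simp del: seg_inject)
qed

lemma hotel_other: "cut C \<Longrightarrow> (\<And>n. C \<noteq> seg n) \<Longrightarrow> hotel C = C"
  by (auto simp: hotel_def fun_eq_iff cut_def)

lemma unhotel_seg: "unhotel (seg 0) = (\<lambda>q. False)" "unhotel (seg 1) = (\<lambda>q. True)"
  "unhotel (seg (n + 1 + 1)) = seg n"
proof -
  have eq: "(\<forall>p. seg m p = seg k p) \<longleftrightarrow> m = k" for m k
    using seg_inject[of m k] by (auto simp: fun_eq_iff simp del: seg_inject)
  have neq: "m + 1 + 1 \<noteq> 0" "m + 1 + 1 \<noteq> 1" "0 \<noteq> m + 1 + 1" "1 \<noteq> m + 1 + 1"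
    "m + 1 + 1 = k + 1 + 1 \<longleftrightarrow> m = k" for m k :: 'n
    using S_neq_Z[of m] S_neq_Z[of "m + 1"] add_right_cancel[of "m + 1" 1 0] by auto
  show "unhotel (seg 0) = (\<lambda>q. False)" "unhotel (seg 1) = (\<lambda>q. True)"
    "unhotel (seg (n + 1 + 1)) = seg n"
    unfolding unhotel_def fun_eq_iff eq using neq by (auto simp only:) (metis zero_neq_one)
qed

lemma unhotel_other: "(\<And>n. B \<noteq> seg n) \<Longrightarrow> unhotel B = B"
  by (auto simp: unhotel_def fun_eq_iff)

lemma cut_hotel: "lower_open C \<Longrightarrow> cut (hotel C)"
  by (erule hotel_cases) (simp_all add: hotel_improper hotel_seg hotel_other cut_seg)

lemma unhotel_hotel: "lower_open C \<Longrightarrow> unhotel (hotel C) = C"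
  by (erule hotel_cases) (simp_all only: hotel_improper hotel_seg hotel_other unhotel_seg unhotel_other not_False_eq_True)

lemma unhotel_cases:
  assumes "cut B"
  obtains "B = seg 0" | "B = seg 1" | n where "B = seg (n + 1 + 1)" | "\<And>n. B \<noteq> seg n"
proof (cases "\<exists>n. B = seg n")
  case True
  then obtain n where n: "B = seg n" ..
  show thesis
  proof (cases n rule: S_cases)
    case (2 k)
    then show thesis using that n by (cases k rule: S_cases) auto
  qed (use that n in simp)
qed (use that in blast)

lemma lower_open_unhotel:
  assumes "cut B"
  shows "lower_open (unhotel B)"
  using assms
proof (rule unhotel_cases)
  have "lower_open (\<lambda>q :: 'n gint fract. False)" "lower_open (\<lambda>q :: 'n gint fract. True)"
    by (auto simp: lower_open_def intro: gt_ex)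
  then show "B = seg 0 \<Longrightarrow> lower_open (unhotel B)" "B = seg 1 \<Longrightarrow> lower_open (unhotel B)"
    by (simp_all only: unhotel_seg)
  show "B = seg (n + 1 + 1) \<Longrightarrow> lower_open (unhotel B)" for n
    using cut_seg[of n] by (simp only: unhotel_seg cut_def)
  show "(\<And>n. B \<noteq> seg n) \<Longrightarrow> lower_open (unhotel B)"
    using assms by (simp add: unhotel_other cut_def)
qed

lemma hotel_unhotel:
  assumes "cut B"
  shows "hotel (unhotel B) = B"
  using assms
proof (rule unhotel_cases)
  show "hotel (unhotel B) = B" if "\<And>n. B \<noteq> seg n"
    using that by (simp add: unhotel_other hotel_other assms)
qed (simp_all only: unhotel_seg hotel_seg hotel_improper)

section \<open>Transporting bijections along definable maps\<close>

definition bijection :: "('n \<Rightarrow> 'n) set \<Rightarrow> (('n \<Rightarrow> 'n) \<Rightarrow> ('n \<Rightarrow> 'n) \<Rightarrow> bool) \<Rightarrow> (('n \<Rightarrow> 'n) \<Rightarrow> 'n) \<Rightarrow> bool" where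
  "bijection X E Y \<longleftrightarrow> (\<forall>x\<in>X. \<forall>x'\<in>X. E x x' \<longrightarrow> Y x = Y x') \<and>
     (\<forall>x\<in>X. \<forall>x'\<in>X. Y x = Y x' \<longrightarrow> E x x') \<and> (\<forall>n. \<exists>x\<in>X. Y x = n)"

text \<open>The new bijection is the composition of \<open>Y\<close> with \<open>h\<close>. Since
  \<open>Y\<close> respects \<open>E\<close>, surjectivity of \<open>h\<close> up to
  \<open>E\<close> is enough.\<close>

lemma bijection_transfer:
  assumes "D (push base) (\<lambda>p. h (fst p) (snd p))" "X' \<subseteq> M1" "h ` X' \<subseteq> X"
    "\<And>x x'. x \<in> X' \<Longrightarrow> x' \<in> X' \<Longrightarrow> E' x x' \<longleftrightarrow> E (h x) (h x')"
    "\<And>y. y \<in> X \<Longrightarrow> \<exists>x\<in>X'. E (h x) y"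
    and Y: "Y \<in> M2" "bijection X E Y"
  shows "\<exists>Y'\<in>M2. bijection X' E' Y'"
proof -
  have "D base (\<lambda>x. Y (h x))" by (rule D_M2[of Y base h, OF Y(1) assms(1)])
  then have "\<exists>Y'\<in>M2. \<forall>x\<in>M1. Y (h x) = Y' x" by (simp add: D_def)
  then obtain Y' where Y': "Y' \<in> M2" "\<And>x. x \<in> M1 \<Longrightarrow> Y (h x) = Y' x" by blast
  have ex: "\<exists>x\<in>X. Y x = n" for n using Y(2) unfolding bijection_def by blast
  have iff: "E x x' \<longleftrightarrow> Y x = Y x'" if "x \<in> X" "x' \<in> X" for x x'
    using Y(2) that unfolding bijection_def by blast
  have hX: "h x \<in> X" "Y' x = Y (h x)" if "x \<in> X'" for x
    using that assms(2,3) Y'(2)[of x] by auto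
  have "\<exists>x\<in>X'. Y' x = n" for n
  proof -
    obtain y where y: "y \<in> X" "Y y = n" using ex by blast
    obtain x where x: "x \<in> X'" "E (h x) y" using assms(5)[OF y(1)] by blast
    show ?thesis using iff[OF hX(1)[OF x(1)] y(1)] hX(2)[OF x(1)] x y(2) by auto
  qed
  moreover have "E' x x' \<longleftrightarrow> Y' x = Y' x'" if xx: "x \<in> X'" "x' \<in> X'" for x x'
    unfolding assms(4)[OF xx] hX(2)[OF xx(1)] hX(2)[OF xx(2)] by (rule iff) (use hX xx in auto)
  ultimately have "bijection X' E' Y'" unfolding bijection_def by blast
  then show ?thesis using Y'(1) by blast
qed

definition req :: "('n \<Rightarrow> 'n) \<Rightarrow> ('n \<Rightarrow> 'n) \<Rightarrow> bool" where
  "req x y \<longleftrightarrow> rleq x y \<and> rleq y x"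

definition "reals = {x \<in> M1. realp x}"
definition "unit_interval = {x \<in> M1. unitp x}"

lemma unitp_cut:
  assumes "unitp x"
  shows "cut (below x)" "lower_open (from_unit (below x))" "to_unit (from_unit (below x)) = below x"
  using assms cut_below[of x] lower_open_from_unit[of "below x"] to_unit_from_unit[of "below x"]
  by (auto simp: unitp_iff)

text \<open>Two reals are equal iff their cuts are, so a map between spaces of reals is given by a map of cuts.\<close>

lemma bijection_by_cuts:
  assumes "DP (push base) (\<lambda>p. F (below (fst p)) (rc (snd p)))"
    and "DP (push base) (\<lambda>p. G (below (fst p)) (rc (snd p)))"
    and X: "X \<subseteq> {x \<in> M1. realp x}" "X' \<subseteq> {x \<in> M1. realp x}"
    and FX: "\<And>x. x \<in> X' \<Longrightarrow> cut (F (below x)) \<and> G (F (below x)) = below x"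
    and GX: "\<And>x. x \<in> X \<Longrightarrow> cut (G (below x)) \<and> F (G (below x)) = below x"
    and memX: "\<And>x y. y \<in> X' \<Longrightarrow> x \<in> M1 \<Longrightarrow> realp x \<Longrightarrow> below x = F (below y) \<Longrightarrow> x \<in> X"
    and memX': "\<And>x y. y \<in> X \<Longrightarrow> x \<in> M1 \<Longrightarrow> realp x \<Longrightarrow> below x = G (below y) \<Longrightarrow> x \<in> X'"
    and Y: "Y \<in> M2" "bijection X req Y"
  shows "\<exists>Y'\<in>M2. bijection X' req Y'"
proof -
  obtain h where h: "D (push base) (\<lambda>p. h (fst p) (snd p))"
    "\<And>a. a \<in> M1 \<Longrightarrow> cut (F (below a)) \<Longrightarrow> realp (h a) \<and> below (h a) = F (below a)"
    using cut_realization[of base "\<lambda>x. F (below x)", OF assms(1)] unfolding dom_base by blast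
  obtain k where k: "D (push base) (\<lambda>p. k (fst p) (snd p))"
    "\<And>a. a \<in> M1 \<Longrightarrow> cut (G (below a)) \<Longrightarrow> realp (k a) \<and> below (k a) = G (below a)"
    using cut_realization[of base "\<lambda>x. G (below x)", OF assms(2)] unfolding dom_base by blast
  have M1: "x \<in> M1" if "x \<in> X \<or> x \<in> X'" for x using that X by auto
  have hX: "realp (h x)" "below (h x) = F (below x)" "h x \<in> X" if x: "x \<in> X'" for x
  proof -
    show 1: "realp (h x)" "below (h x) = F (below x)" using h(2)[of x] FX x M1 by auto
    show "h x \<in> X" by (rule memX[OF x section_M1[OF h(1)] 1]) (use M1 x in auto)
  qed
  have kX: "realp (k x)" "below (k x) = G (below x)" "k x \<in> X'" if x: "x \<in> X" for x
  proof -
    show 1: "realp (k x)" "below (k x) = G (below x)" using k(2)[of x] GX x M1 by auto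
    show "k x \<in> X'" by (rule memX'[OF x section_M1[OF k(1)] 1]) (use M1 x in auto)
  qed
  have req: "req x y \<longleftrightarrow> below x = below y" if "realp x" "realp y" for x y
    using req_iff[OF that] by (simp add: req_def)
  show ?thesis
  proof (rule bijection_transfer[OF h(1) _ _ _ _ Y])
    show "X' \<subseteq> M1" "h ` X' \<subseteq> X" using X hX by auto
    show "req x x' \<longleftrightarrow> req (h x) (h x')" if xx: "x \<in> X'" "x' \<in> X'" for x x'
    proof -
      have "F (below x) = F (below x') \<longleftrightarrow> below x = below x'" using FX xx by metis
      moreover have "realp x" "realp x'" using X xx by auto
      ultimately show ?thesis using hX xx req by simp
    qed
    show "\<exists>x\<in>X'. req (h x) y" if y: "y \<in> X" for y
    proof -
      have "realp y" using X y by auto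
      then have "req (h (k y)) y" using hX kX y GX req by simp
      then show ?thesis using kX(3)[OF y] by blast
    qed
  qed
qed

lemma DP_unit_to_real: "DP (push base) (\<lambda>p. hotel (from_unit (below (fst p))) (rc (snd p)))"
  unfolding hotel_def from_unit_def squeeze_def seg_def below_def
  by (intro def_intros)

lemma DP_real_to_unit: "DP (push base) (\<lambda>p. to_unit (unhotel (below (fst p))) (rc (snd p)))"
  unfolding unhotel_def to_unit_def squeeze_def seg_def below_def
  by (intro def_intros)

lemma unit_real_round_trip:
  "unitp x \<Longrightarrow> cut (hotel (from_unit (below x)))"
  "unitp x \<Longrightarrow> to_unit (unhotel (hotel (from_unit (below x)))) = below x"
  "realp x \<Longrightarrow> cut (to_unit (unhotel (below x)))"
  "realp x \<Longrightarrow> hotel (from_unit (to_unit (unhotel (below x)))) = below x"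
  using unitp_cut cut_hotel unhotel_hotel cut_below lower_open_unhotel to_unit_props(1)
    from_unit_to_unit hotel_unhotel by metis+

lemma unitp_to_unit:
  "realp y \<Longrightarrow> realp x \<Longrightarrow> below x = to_unit (unhotel (below y)) \<Longrightarrow> unitp x"
  using to_unit_props(2,3)[OF lower_open_unhotel[OF cut_below]] by (simp add: unitp_iff)

text \<open>The same pair of maps of cuts serves both directions with exchanged roles.\<close>

theorem bijection_real_unit:
  "(\<exists>Y\<in>M2. bijection unit_interval req Y) \<longleftrightarrow> (\<exists>Y\<in>M2. bijection reals req Y)"
proof
  assume "\<exists>Y\<in>M2. bijection unit_interval req Y"
  then obtain Y where Y: "Y \<in> M2" "bijection unit_interval req Y" by blast
  show "\<exists>Y\<in>M2. bijection reals req Y"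
    by (rule bijection_by_cuts[OF DP_real_to_unit DP_unit_to_real _ _ _ _ _ _ Y])
      (use unit_real_round_trip unitp_to_unit in \<open>auto simp: reals_def unit_interval_def unitp_iff\<close>)
next
  assume "\<exists>Y\<in>M2. bijection reals req Y"
  then obtain Y where Y: "Y \<in> M2" "bijection reals req Y" by blast
  show "\<exists>Y\<in>M2. bijection unit_interval req Y"
    by (rule bijection_by_cuts[OF DP_unit_to_real DP_real_to_unit _ _ _ _ _ _ Y])
      (use unit_real_round_trip unitp_to_unit in \<open>auto simp: reals_def unit_interval_def unitp_iff\<close>)
qed

end

section \<open>The real line and Baire space\<close>

context model
begin

text \<open>For the cut \<open>P\<close> of a real this says that \<open>a\<close> is at most the
  real, so \<open>inI\<close> places the real in the half-open interval from \<open>a\<close> to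
  \<open>b\<close>.\<close>

definition leC :: "('n gint fract \<Rightarrow> bool) \<Rightarrow> 'n gint fract \<Rightarrow> bool" where
  "leC P a \<longleftrightarrow> (\<forall>q. q < a \<longrightarrow> P q)"

definition inI :: "('n gint fract \<Rightarrow> bool) \<Rightarrow> 'n gint fract \<Rightarrow> 'n gint fract \<Rightarrow> bool" where
  "inI P a b \<longleftrightarrow> leC P a \<and> \<not> leC P b"

lemma leC_antimono: "leC P b \<Longrightarrow> a \<le> b \<Longrightarrow> leC P a"
  by (auto simp: leC_def)

lemma inI_less: "inI P a b \<Longrightarrow> inI P a' b' \<Longrightarrow> a < b'"
  unfolding inI_def using leC_antimono not_le by blast

section \<open>Integer parts and half-open cells\<close>

definition zc :: "'n \<Rightarrow> 'n gint fract" where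
  "zc n = rc (pr n 0)"

lemma zc_even: "zc (m + m) = emb m" and zc_odd: "zc (m + m + 1) = - emb (m + 1)"
  unfolding zc_def rc_even rc_odd by simp_all

lemma zc_cases:
  obtains m where "n = m + m" "zc n = emb m" | m where "n = m + m + 1" "zc n = - emb (m + 1)"
  using par[of n] hlf[of n] zc_even[of "hlf n"] zc_odd[of "hlf n"] by (metis add.right_neutral)

lemma zc_diff: "\<exists>a b. zc n = emb a - emb b"
  by (cases n rule: zc_cases) (metis diff_zero emb_hom(1), metis diff_0 emb_hom(1))

lemma zc_surj: "\<exists>m. zc m = emb a - emb b"
proof (cases "b \<le> a")
  case True
  then show ?thesis using zc_even[of "a - b"] by (auto simp: emb_minus)
next
  case False
  then have "b - a \<noteq> 0" by (simp flip: le_minus)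
  then obtain k where k: "b - a = k + 1" using Z_or_S[of "b - a"] by metis
  have "zc (k + k + 1) = - emb (b - a)" by (simp only: zc_odd k)
  then show ?thesis using False by (auto simp: emb_minus)
qed

text \<open>Moving the subtracted numbers to the other sides reduces this to discreteness of the
  semiring.\<close>

lemma zc_less: "zc m < zc n \<Longrightarrow> zc m + 1 \<le> zc n"
proof -
  obtain a b c d where m: "zc m = emb a - emb b" and n: "zc n = emb c - emb d"
    using zc_diff by metis
  assume "zc m < zc n"
  then have "emb (a + d) < emb (c + b)" by (simp del: emb_less add: m n algebra_simps)
  then have "emb (a + d) + 1 \<le> emb (c + b)" by (simp only: emb_less_iff)
  then show ?thesis by (simp del: emb_le add: m n algebra_simps)
qed

lemma zc_inject: "zc m = zc n \<Longrightarrow> m = n"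
proof -
  have neg: "- emb (j + 1) \<noteq> emb k" for j k :: 'n
    using emb_ge0[of j] emb_ge0[of k] unfolding emb_hom by linarith
  assume "zc m = zc n"
  then show ?thesis
    by (cases m rule: zc_cases; cases n rule: zc_cases)
      (auto simp del: emb_hom(3) simp: neg neg[THEN not_sym])
qed

lemma inI_zc_unique: "inI P (zc m) (zc m + 1) \<Longrightarrow> inI P (zc n) (zc n + 1) \<Longrightarrow> m = n"
proof -
  assume *: "inI P (zc m) (zc m + 1)" "inI P (zc n) (zc n + 1)"
  then have "zc m < zc n + 1" "zc n < zc m + 1" using inI_less by blast+
  then have "zc m = zc n" using zc_less[of m n] zc_less[of n m] by (metis linorder_neqE not_le)
  then show ?thesis by (rule zc_inject)
qed

text \<open>A state pairs a code of the left end with the exponent of the width; all widths are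
  powers of 1/2.\<close>

definition lft :: "'n \<Rightarrow> 'n gint fract" where "lft c = rc (p1 c)"
definition wid :: "'n \<Rightarrow> 'n gint fract" where "wid c = eps (p2 c)"
definition cell :: "'n \<Rightarrow> 'n \<Rightarrow> 'n gint fract" where "cell c m = lft c + wid c * (1 - eps m)"

lemma wid_pos [simp]: "0 < wid c"
  by (simp add: wid_def)

lemma cell_mono: "m \<le> n \<Longrightarrow> cell c m \<le> cell c n"
  using eps_antimono[of m n] by (simp add: cell_def)

lemma cell_0: "cell c 0 = lft c"
  by (simp add: cell_def)

lemma cell_less: "cell c m < lft c + wid c"
  by (simp add: cell_def algebra_simps)

lemma inI_cell_unique:
  assumes "inI P (cell c m) (cell c (m + 1))" "inI P (cell c n) (cell c (n + 1))"
  shows "m = n"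
proof -
  have "\<not> m < n" if "cell c n < cell c (m + 1)" for m n
    using that cell_mono[of "m + 1" n c] by (auto simp: less_iff_add1_le)
  then show ?thesis using inI_less[OF assms] inI_less[OF assms(2,1)] by (metis linorder_neqE)
qed

text \<open>
  A state codes an interval \<open>[lft, lft + wid)\<close>, which the points \<open>cell c m\<close> divide into
  infinitely many subintervals. A sequence selects nested intervals, starting with one between
  neighbouring integers.
\<close>

definition nxt :: "'n \<Rightarrow> 'n \<Rightarrow> 'n \<Rightarrow> bool" where
  "nxt c m c' \<longleftrightarrow> lft c' = cell c m \<and> p2 c' = p2 c + m + 1"

text \<open>Membership of \<open>C\<close> in \<open>M1\<close> licenses induction along the
  run.\<close>

definition run :: "('n \<Rightarrow> 'n) \<Rightarrow> ('n \<Rightarrow> 'n) \<Rightarrow> bool" where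
  "run f C \<longleftrightarrow> C \<in> M1 \<and> lft (C 0) = zc (f 0) \<and> p2 (C 0) = 0 \<and> (\<forall>k. nxt (C k) (f (k + 1)) (C (k + 1)))"

definition codes :: "('n gint fract \<Rightarrow> bool) \<Rightarrow> ('n \<Rightarrow> 'n) \<Rightarrow> bool" where
  "codes P f \<longleftrightarrow> (\<exists>C. run f C \<and> (\<forall>k. inI P (lft (C k)) (lft (C k) + wid (C k))))"

section \<open>Runs of states and uniqueness of coding\<close>

lemma nxt_exists: "\<exists>c'. nxt c m c'"
proof -
  obtain q where "rc q = cell c m" using rc_surj by blast
  then show ?thesis by (intro exI[of _ "pr q (p2 c + m + 1)"]) (simp add: nxt_def lft_def)
qed

text \<open>Neighbouring points \<open>cell c m\<close> and \<open>cell c (m + 1)\<close> are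
  \<open>wid c * eps (m + 1)\<close> apart, which explains the increase of the exponent by
  \<open>m + 1\<close>.\<close>

lemma nxt_right: "nxt c m c' \<Longrightarrow> lft c' + wid c' = cell c (m + 1)"
  by (simp add: nxt_def wid_def cell_def eps_add algebra_simps)

lemma nxt_eq: "nxt c m c' \<Longrightarrow> nxt d m d' \<Longrightarrow> lft c = lft d \<Longrightarrow> p2 c = p2 d \<Longrightarrow> lft c' = lft d' \<and> p2 c' = p2 d'"
  by (simp add: nxt_def cell_def wid_def)

lemmas D_pairs = p1_def p2_def pr_def
lemmas state_defs = inI_def leC_def lft_def wid_def cell_def nxt_def zc_def D_pairs

lemma run_M1: "run f C \<Longrightarrow> C \<in> M1"
  by (simp add: run_def)

text \<open>Only the value of the left end is compared, because a rational has many codes.\<close>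

lemma run_unique:
  assumes "run f C" "run f C'"
  shows "lft (C k) = lft (C' k) \<and> p2 (C k) = p2 (C' k)"
proof (induction k rule: induct0)
  case definable
  show ?case unfolding lft_def D_pairs
    by (intro def_intros D_M1[OF run_M1[OF assms(1)]] D_M1[OF run_M1[OF assms(2)]])
next
  case zero
  then show ?case using assms by (simp add: run_def)
next
  case (step k)
  then show ?case using assms nxt_eq[of "C k" "f (k + 1)" "C (k + 1)" "C' k" "C' (k + 1)"]
    by (simp add: run_def)
qed

text \<open>State and entry are compared in one induction: equal intervals have equal pieces, and
  the real lies in only one of these.\<close>

lemma codes_fun_unique:
  assumes "codes P f" "codes P g" "f \<in> M1" "g \<in> M1"
  shows "f k = g k"
proof -
  obtain C where C: "run f C" "\<And>k. inI P (lft (C k)) (lft (C k) + wid (C k))"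
    using assms(1) unfolding codes_def by blast
  obtain C' where C': "run g C'" "\<And>k. inI P (lft (C' k)) (lft (C' k) + wid (C' k))"
    using assms(2) unfolding codes_def by blast
  have "lft (C k) = lft (C' k) \<and> p2 (C k) = p2 (C' k) \<and> f k = g k"
  proof (induction k rule: induct0)
    case definable
    show ?case unfolding lft_def D_pairs
      by (intro def_intros D_M1[OF run_M1[OF C(1)]] D_M1[OF run_M1[OF C'(1)]] D_M1[OF assms(3)] D_M1[OF assms(4)])
  next
    case zero
    have "f 0 = g 0"
      by (rule inI_zc_unique[of P]) (use C(2)[of 0] C'(2)[of 0] C(1) C'(1) in \<open>auto simp: run_def wid_def\<close>)
    then show ?case using C(1) C'(1) by (simp add: run_def)
  next
    case (step k)
    have nx: "nxt (C k) (f (k + 1)) (C (k + 1))" "nxt (C' k) (g (k + 1)) (C' (k + 1))"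
      using C(1) C'(1) by (auto simp: run_def)
    have cell: "cell (C k) = cell (C' k)" using step by (simp add: cell_def wid_def fun_eq_iff)
    have "f (k + 1) = g (k + 1)"
    proof (rule inI_cell_unique)
      show "inI P (cell (C k) (f (k + 1))) (cell (C k) (f (k + 1) + 1))"
        using C(2)[of "k + 1"] nxt_right[OF nx(1)] nx(1) by (simp add: nxt_def)
      show "inI P (cell (C k) (g (k + 1))) (cell (C k) (g (k + 1) + 1))"
        using C'(2)[of "k + 1"] nxt_right[OF nx(2)] nx(2) by (simp add: nxt_def cell)
    qed
    then show ?case using nxt_eq[OF nx(1)] nx(2) step by simp
  qed
  then show ?thesis by simp
qed

text \<open>Each step raises the exponent by at least 1, so the widths tend to zero even if all
  entries are 0.\<close>

lemma run_depth:
  assumes "run f C"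
  shows "k \<le> p2 (C k)"
proof (induction k rule: induct0)
  case definable
  show ?case unfolding D_pairs by (intro def_intros D_M1[OF run_M1[OF assms]])
next
  case (step k)
  have "p2 (C (k + 1)) = p2 (C k) + f (k + 1) + 1" using assms by (simp add: run_def nxt_def)
  then show ?case using step by (simp add: add_increasing2)
qed simp

text \<open>A gap from \<open>q\<close> to \<open>p\<close> between the two reals would fit into
  each interval of the common run, whose width is eventually less than \<open>p - q\<close>.\<close>

lemma codes_cut_le:
  assumes "codes P f" "codes Q f" "cut P" "cut Q" "P q"
  shows "Q q"
proof (rule ccontr)
  assume nQ: "\<not> Q q"
  obtain C where C: "run f C" "\<And>k. inI P (lft (C k)) (lft (C k) + wid (C k))"
    using assms(1) unfolding codes_def by blast
  obtain C' where C': "run f C'" "\<And>k. inI Q (lft (C' k)) (lft (C' k) + wid (C' k))"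
    using assms(2) unfolding codes_def by blast
  have lo: "lower_open P" using assms(3) by (simp add: cut_def)
  obtain p where p: "q < p" "P p" using lower_openD(2)[OF lo assms(5)] by blast
  then have "0 < p - q" by simp
  then obtain k where k: "eps k < p - q" by (rule ex_eps)
  have "wid (C k) \<le> eps k" unfolding wid_def by (rule eps_antimono[OF run_depth[OF C(1)]])
  moreover have "p < lft (C k) + wid (C k)"
  proof -
    obtain r where "r < lft (C k) + wid (C k)" "\<not> P r" using C(2)[of k] unfolding inI_def leC_def by blast
    then show ?thesis using lower_openD(3)[OF lo p(2)] by force
  qed
  moreover have "lft (C k) \<le> q"
  proof -
    have "leC Q (lft (C k))" using C'(2)[of k] run_unique[OF C(1) C'(1), of k] by (simp add: inI_def)
    then show ?thesis using nQ unfolding leC_def by (meson not_le)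
  qed
  ultimately show False using k by linarith
qed

lemma codes_cut_unique: "codes P f \<Longrightarrow> codes Q f \<Longrightarrow> cut P \<Longrightarrow> cut Q \<Longrightarrow> P = Q"
  using codes_cut_le by blast

section \<open>Every sequence has a real and every real has a sequence\<close>

lemma run_exists:
  assumes "f \<in> M1"
  shows "\<exists>C. run f C"
proof -
  have "DP (push (push (push base))) (\<lambda>p. nxt (snd (fst (fst p))) (fst (fst (fst p)) (snd (fst p) + 1)) (snd p))"
    unfolding state_defs by (intro def_intros)
  then obtain G where G: "D (push (push base)) G" "\<And>a n. a \<in> dom (push (push base)) \<Longrightarrow>
      nxt (snd (fst a)) (fst (fst a) (snd a + 1)) n \<Longrightarrow> nxt (snd (fst a)) (fst (fst a) (snd a + 1)) (G a)"
    by (rule D_choose[where P = "\<lambda>a. nxt (snd (fst a)) (fst (fst a) (snd a + 1))"]) blast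
  define H where "H a u n = G ((a, u), n)" for a u n
  have H: "nxt u (a (n + 1)) (H a u n)" if "a \<in> M1" for a u n
    using G(2)[of "((a, u), n)"] that nxt_exists[of u "a (n + 1)"] by (auto simp: H_def)
  have HD: "D (push (push base)) (\<lambda>p. H (fst (fst p)) (snd (fst p)) (snd p))"
    using G(1) by (simp add: H_def)
  \<comment> \<open>The initial state: \<open>pr (a 0) 0\<close> codes the integer
    \<open>zc (a 0)\<close>, and exponent 0 means width 1.\<close>
  have "D base (\<lambda>a. pr (pr (a 0) 0) 0)" unfolding D_pairs by (intro def_intros)
  from D_rec[OF this HD] obtain X where X: "D (push base) (\<lambda>p. X (fst p) (snd p))"
    "\<And>a. a \<in> M1 \<Longrightarrow> X a 0 = pr (pr (a 0) 0) 0 \<and> (\<forall>n. X a (n + 1) = H a (X a n) n)"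
    unfolding dom_base by blast
  have "X f \<in> M1" by (rule section_M1[of base X, OF X(1)]) (simp add: assms)
  then have "run f (X f)"
    using X(2)[OF assms] H[OF assms] by (simp add: run_def lft_def zc_def)
  then show ?thesis by (rule exI[of "run f" "X f"])
qed

lemma run_nested:
  assumes "run f C"
  shows "lft (C k) \<le> lft (C (k + j)) \<and> lft (C (k + j)) + wid (C (k + j)) \<le> lft (C k) + wid (C k)"
proof (induction j rule: induct0)
  case definable
  show ?case unfolding lft_def wid_def D_pairs by (intro def_intros D_M1[OF run_M1[OF assms]])
next
  case (step j)
  have nx: "nxt (C (k + j)) (f (k + j + 1)) (C (k + j + 1))" using assms by (simp add: run_def)
  have "lft (C (k + j)) \<le> lft (C (k + j + 1))"
    using nx cell_mono[of 0 "f (k + j + 1)" "C (k + j)"] by (simp add: nxt_def cell_0)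
  moreover have "lft (C (k + j + 1)) + wid (C (k + j + 1)) < lft (C (k + j)) + wid (C (k + j))"
    using nxt_right[OF nx] cell_less by simp
  ultimately show ?case using step by (simp add: add.assoc)
qed simp

text \<open>The real is the supremum of the left ends. It stays below every right end because the
  following interval ends strictly earlier.\<close>

lemma codes_surj:
  assumes "f \<in> M1"
  shows "\<exists>x\<in>M1. realp x \<and> codes (below x) f"
proof -
  obtain C where C: "run f C" using run_exists[OF assms] by blast
  define P where "P q \<longleftrightarrow> (\<exists>k. q < lft (C k))" for q
  have up: "q < lft (C k) + wid (C k)" if Pq: "P q" for q k
  proof -
    obtain j where j: "q < lft (C j)" using Pq by (auto simp: P_def)
    have "lft (C j) < lft (C k) + wid (C k)"
    proof (cases "j \<le> k")
      case True
      then obtain i where "k = j + i" using le_iff le_minus by metis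
      then have "lft (C j) \<le> lft (C k)" using run_nested[OF C, of j i] by simp
      then show ?thesis using wid_pos[of "C k"] by linarith
    next
      case False
      then have "k \<le> j" by simp
      then obtain i where "j = k + i" using le_iff le_minus by metis
      then have "lft (C j) + wid (C j) \<le> lft (C k) + wid (C k)" using run_nested[OF C, of k i] by simp
      then show ?thesis using wid_pos[of "C j"] by linarith
    qed
    then show ?thesis using j by simp
  qed
  have "cut P"
    unfolding cut_def lower_open_def
  proof (intro conjI allI impI)
    show "\<exists>p>q. P p" if "P q" for q
      using that dense unfolding P_def by blast
    show "\<exists>q. P q" unfolding P_def by (rule exI[of _ "lft (C 0) - 1"]) (auto intro: exI[of _ 0])
    show "\<exists>q. \<not> P q" using up[of "lft (C 0) + wid (C 0)" 0] by auto
  qed (auto simp: P_def intro: le_less_trans)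
  have "DP (push base) (\<lambda>p. P (rc (snd p)))"
    unfolding P_def lft_def D_pairs by (intro def_intros D_M1[OF run_M1[OF C]])
  from cut_realization[of base "\<lambda>_. P", OF this]
  obtain h where h: "D (push base) (\<lambda>p. h (fst p) (snd p))" "\<And>a. a \<in> M1 \<Longrightarrow> realp (h a) \<and> below (h a) = P"
    using \<open>cut P\<close> unfolding dom_base by blast
  \<comment> \<open>The cut is independent of the parameter, so any member of \<open>M1\<close> may
    be inserted.\<close>
  obtain a where a: "a \<in> M1" using assms by blast
  have "inI P (lft (C k)) (lft (C k) + wid (C k))" for k
    unfolding inI_def
  proof
    show "leC P (lft (C k))" by (auto simp: leC_def P_def)
    have "lft (C (k + 1)) + wid (C (k + 1)) < lft (C k) + wid (C k)"
      using nxt_right[of "C k" "f (k + 1)" "C (k + 1)"] C cell_less by (simp add: run_def)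
    then show "\<not> leC P (lft (C k) + wid (C k))"
      using up[of "lft (C (k + 1)) + wid (C (k + 1))" "k + 1"] by (auto simp: leC_def)
  qed
  then have "codes P f" unfolding codes_def using C by blast
  moreover have "h a \<in> M1" by (rule section_M1[of base h, OF h(1)]) (simp add: a)
  ultimately show ?thesis using h(2)[OF a] by auto
qed

text \<open>The points \<open>cell c n\<close> approach the right end of the interval, hence some of
  them pass the real. At the least \<open>m\<close> whose right point passes it, the left point is
  either the left end of the interval or the right point of the preceding index.\<close>

lemma cell_exists:
  assumes x: "x \<in> M1" and "inI (below x) (lft c) (lft c + wid c)"
  shows "\<exists>m. inI (below x) (cell c m) (cell c (m + 1))"
proof -
  obtain q where q: "q < lft c + wid c" "\<not> below x q"
    using assms(2) unfolding inI_def leC_def by blast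
  then have "0 < (lft c + wid c - q) / wid c" by simp
  then obtain n where "eps n < (lft c + wid c - q) / wid c" by (rule ex_eps)
  then have "eps n * wid c < lft c + wid c - q" by (simp add: pos_less_divide_eq)
  moreover have "eps (n + 1) * wid c \<le> eps n * wid c"
    using eps_pos[of n] wid_pos[of c] by (simp add: eps_Suc)
  moreover have "cell c (n + 1) = lft c + wid c - eps (n + 1) * wid c"
    unfolding cell_def by (simp add: algebra_simps)
  ultimately have "q < cell c (n + 1)" by linarith
  then have n: "\<not> leC (below x) (cell c (n + 1))" using q(2) by (auto simp: leC_def)
  have d: "DP (push base) (\<lambda>p. \<not> leC (below x) (cell c (snd p + 1)))"
    unfolding leC_def below_def cell_def by (intro def_intros D_M1[OF x])
  obtain m where m: "\<not> leC (below x) (cell c (m + 1))" "\<And>k. k < m \<Longrightarrow> leC (below x) (cell c (k + 1))"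
    using least[where P = "\<lambda>m. \<not> leC (below x) (cell c (m + 1))", OF d n] by blast
  have "leC (below x) (cell c m)"
  proof (cases "m = 0")
    case True
    then show ?thesis using assms(2) by (simp add: cell_0 inI_def)
  next
    case False
    then obtain j where j: "m = j + 1" using Z_or_S[of m] by metis
    then show ?thesis using m(2)[of j] by (simp add: less_add1)
  qed
  then show ?thesis using m(1) by (auto simp: inI_def)
qed

text \<open>The integer part is found by searching upwards from some \<open>- emb b\<close> below
  the real for the first integer that exceeds it.\<close>

lemma zc_exists:
  assumes x: "x \<in> M1" "realp x"
  shows "\<exists>m. inI (below x) (zc m) (zc m + 1)"
proof -
  have lo: "lower_open (below x)" using cut_below[OF x(2)] by (simp add: cut_def)
  obtain q0 q1 where q: "below x q0" "\<not> below x q1" using cut_below[OF x(2)] by (auto simp: cut_def)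
  obtain b :: 'n where b: "- q0 < emb b" using archimedean by blast
  obtain n :: 'n where n: "q1 + emb b < emb n" using archimedean by blast
  have 0: "leC (below x) (- emb b)"
    unfolding leC_def using lower_openD(1)[OF lo q(1)] b by auto
  have "q1 < emb n - emb b" using n by linarith
  then have n: "\<not> leC (below x) (emb n - emb b)" using q(2) unfolding leC_def by blast
  have d: "DP (push base) (\<lambda>p. \<not> leC (below x) (emb (snd p) - emb b))"
    unfolding leC_def below_def by (intro def_intros D_M1[OF x(1)])
  obtain m where m: "\<not> leC (below x) (emb m - emb b)" "\<And>k. k < m \<Longrightarrow> leC (below x) (emb k - emb b)"
    using least[where P = "\<lambda>m. \<not> leC (below x) (emb m - emb b)", OF d n] by blast
  have "m \<noteq> 0" using m(1) 0 by auto
  then obtain j where j: "m = j + 1" using Z_or_S[of m] by metis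
  obtain k where k: "zc k = emb j - emb b" using zc_surj by blast
  have "zc k + 1 = emb m - emb b" by (simp add: k j)
  then have "\<not> leC (below x) (zc k + 1)" using m(1) by (simp only: not_False_eq_True)
  moreover have "leC (below x) (zc k)" using m(2)[of j] by (simp add: k j less_add1)
  ultimately show ?thesis unfolding inI_def by blast
qed

text \<open>Definable choice provides the integer part and, for any state, a piece that contains the
  real. Recursion turns these choices into a run, and the coding sequence consists of the choices
  themselves.\<close>

lemma codes_exists:
  "\<exists>h. D (push base) (\<lambda>p. h (fst p) (snd p)) \<and> (\<forall>x\<in>M1. realp x \<longrightarrow> codes (below x) (h x))"
proof -
  have "DP (push base) (\<lambda>p. inI (below (fst p)) (zc (snd p)) (zc (snd p) + 1))"
    unfolding state_defs below_def by (intro def_intros)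
  then obtain z where z: "D base z" "\<And>x n. x \<in> M1 \<Longrightarrow> inI (below x) (zc n) (zc n + 1) \<Longrightarrow>
      inI (below x) (zc (z x)) (zc (z x) + 1)"
    by (rule D_choose[where P = "\<lambda>x n. inI (below x) (zc n) (zc n + 1)"]) (unfold dom_base, blast)
  have "DP (push (push base)) (\<lambda>p. inI (below (fst (fst p))) (cell (snd (fst p)) (snd p)) (cell (snd (fst p)) (snd p + 1)))"
    unfolding state_defs below_def by (intro def_intros)
  then obtain m where m: "D (push base) m" "\<And>a n. a \<in> dom (push base) \<Longrightarrow>
      inI (below (fst a)) (cell (snd a) n) (cell (snd a) (n + 1)) \<Longrightarrow>
      inI (below (fst a)) (cell (snd a) (m a)) (cell (snd a) (m a + 1))"
    by (rule D_choose[where P = "\<lambda>a n. inI (below (fst a)) (cell (snd a) n) (cell (snd a) (n + 1))"]) blast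
  have m2: "D (push (push base)) (\<lambda>p. m (fst p))" by (rule D_weak[OF m(1)])
  have m3: "D (push (push (push base))) (\<lambda>p. m (fst (fst p)))" by (rule D_weak[OF m2])
  have "DP (push (push (push base))) (\<lambda>p. nxt (snd (fst (fst p))) (m (fst (fst p))) (snd p))"
    unfolding state_defs by (intro def_intros m3)
  then obtain G where G: "D (push (push base)) G" "\<And>a n. a \<in> dom (push (push base)) \<Longrightarrow>
      nxt (snd (fst a)) (m (fst a)) n \<Longrightarrow> nxt (snd (fst a)) (m (fst a)) (G a)"
    by (rule D_choose[where P = "\<lambda>a. nxt (snd (fst a)) (m (fst a))"]) blast
  define H where "H a u n = G ((a, u), n)" for a u n
  have H: "nxt u (m (a, u)) (H a u n)" if "a \<in> M1" for a u n
    using G(2)[of "((a, u), n)"] that nxt_exists[of u "m (a, u)"] by (auto simp: H_def)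
  have HD: "D (push (push base)) (\<lambda>p. H (fst (fst p)) (snd (fst p)) (snd p))"
    using G(1) by (simp add: H_def)
  have "D base (\<lambda>a. pr (pr (z a) 0) 0)" unfolding D_pairs by (intro def_intros z(1))
  from D_rec[OF this HD] obtain X where X: "D (push base) (\<lambda>p. X (fst p) (snd p))"
    "\<And>a. a \<in> M1 \<Longrightarrow> X a 0 = pr (pr (z a) 0) 0 \<and> (\<forall>n. X a (n + 1) = H a (X a n) n)"
    unfolding dom_base by blast
  \<comment> \<open>A later entry is the piece chosen in the state before it, hence the
    predecessor.\<close>
  define h where "h a k = (if k = 0 then z a else m (a, X a (prd k)))" for a k
  have "D (push (push base)) (\<lambda>p. m (fst (fst p), snd p))"
    by (rule D_weak_fun[of base "\<lambda>a n. m (a, n)"]) (simp add: m(1))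
  then have mD: "D (push base) F \<Longrightarrow> D (push base) (\<lambda>p. m (fst p, F p))" for F
    by (rule D_apply[where X = "\<lambda>a n. m (fst a, n)"])
  have "D (push (push base)) (\<lambda>p. X (fst (fst p)) (snd p))"
    by (rule D_weak_fun[of base X, OF X(1)])
  then have XD: "D (push base) F \<Longrightarrow> D (push base) (\<lambda>p. X (fst p) (F p))" for F
    by (rule D_apply[where X = "\<lambda>a. X (fst a)"])
  have "D (push base) (\<lambda>p. h (fst p) (snd p))"
    unfolding h_def by (intro def_intros mD XD D_weak[OF z(1)])
  moreover have "codes (below x) (h x)" if x: "x \<in> M1" "realp x" for x
  proof -
    have XM: "X x \<in> M1" by (rule section_M1[of base X, OF X(1)]) (simp add: x)
    have X0: "X x 0 = pr (pr (z x) 0) 0" and XS: "\<And>n. X x (n + 1) = H x (X x n) n"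
      using X(2)[OF x(1)] by auto
    have nx: "nxt (X x k) (m (x, X x k)) (X x (k + 1))" for k
      unfolding XS using H[OF x(1)] by blast
    then have "run (h x) (X x)"
      using XM X0 by (simp add: run_def h_def lft_def zc_def)
    moreover have "inI (below x) (lft (X x k)) (lft (X x k) + wid (X x k))" for k
    proof (induction k rule: induct0)
      case definable
      show ?case unfolding state_defs below_def by (intro def_intros D_M1[OF XM] D_M1[OF x(1)])
    next
      case zero
      obtain n where "inI (below x) (zc n) (zc n + 1)" using zc_exists[OF x] by blast
      from z(2)[OF x(1) this] show ?case by (simp add: X0 lft_def wid_def zc_def)
    next
      case (step k)
      obtain n where "inI (below x) (cell (X x k) n) (cell (X x k) (n + 1))"
        using cell_exists[OF x(1) step] by blast
      then have "inI (below x) (cell (X x k) (m (x, X x k))) (cell (X x k) (m (x, X x k) + 1))"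
        using m(2)[of "(x, X x k)" n] x(1) by simp
      then show ?case using nx[of k] nxt_right[OF nx[of k]] by (simp add: nxt_def)
    qed
    ultimately show ?thesis unfolding codes_def by blast
  qed
  ultimately show ?thesis by blast
qed

text \<open>\<open>h\<close> leads from reals to sequences, the direction needed for composition
  with \<open>Y\<close>. Injectivity comes from \<open>codes_cut_unique\<close>; surjectivity comes
  from \<open>codes_surj\<close> and the uniqueness of the coded sequence.\<close>

theorem bijection_baire_real:
  assumes "Y \<in> M2" "bijection M1 (\<lambda>f g. \<forall>n. f n = g n) Y"
  shows "\<exists>Y\<in>M2. bijection reals req Y"
proof -
  obtain h where h: "D (push base) (\<lambda>p. h (fst p) (snd p))" "\<And>x. x \<in> reals \<Longrightarrow> codes (below x) (h x)"
    using codes_exists unfolding reals_def by blast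
  have hM: "h x \<in> M1" if "x \<in> reals" for x
    by (rule section_M1[of base h, OF h(1)]) (use that in \<open>simp add: reals_def\<close>)
  have cut: "cut (below x)" if "x \<in> reals" for x
    using that by (simp add: reals_def cut_below)
  show ?thesis
  proof (rule bijection_transfer[OF h(1) _ _ _ _ assms])
    show "reals \<subseteq> M1" "h ` reals \<subseteq> M1" using hM by (auto simp: reals_def)
    show "req x x' \<longleftrightarrow> (\<forall>n. h x n = h x' n)" if xx: "x \<in> reals" "x' \<in> reals" for x x'
    proof -
      have "req x x' \<longleftrightarrow> below x = below x'"
        using xx req_iff by (simp add: req_def reals_def)
      moreover have "h x n = h x' n" if "below x = below x'" for n
        using codes_fun_unique[OF h(2)[OF xx(1)] _ hM[OF xx(1)] hM[OF xx(2)]] h(2)[OF xx(2)] that by simp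
      moreover have "below x = below x'" if "\<forall>n. h x n = h x' n"
      proof -
        have "h x = h x'" using that by auto
        then show ?thesis
          using codes_cut_unique[OF h(2)[OF xx(1)] _ cut[OF xx(1)] cut[OF xx(2)]] h(2)[OF xx(2)] by simp
      qed
      ultimately show ?thesis by blast
    qed
    show "\<exists>x\<in>reals. \<forall>n. h x n = f n" if f: "f \<in> M1" for f
    proof -
      obtain x where x: "x \<in> reals" "codes (below x) f" using codes_surj[OF f] by (auto simp: reals_def)
      then show ?thesis using codes_fun_unique[OF h(2)[OF x(1)] x(2) hM[OF x(1)] f] by blast
    qed
  qed
qed

end

section \<open>The arithmetic of the model as class operations\<close>

text \<open>The class axioms for arbitrary operations, with the order written as a vanishing cut-off
  difference. Both branches of the definitions on \<open>elt\<close> satisfy them, so one instance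
  proof covers both.\<close>

locale semidom_laws =
  fixes z u :: 'a and a m d :: "'a \<Rightarrow> 'a \<Rightarrow> 'a"
  assumes laws: "a (a x y) w = a x (a y w)" "a x y = a y x" "a z x = x"
      "m (m x y) w = m x (m y w)" "m x y = m y x" "m u x = x"
      "m (a x y) w = a (m x w) (m y w)" "m z x = z" "z \<noteq> u" "d (a x y) x = y" "d (d x y) w = d x (a y w)"
      "m x (d y w) = d (m x y) (m x w)" "m x y = z \<Longrightarrow> x = z \<or> y = z"
      "d x x = z" "d x y = z \<Longrightarrow> d y x = z \<Longrightarrow> x = y" "d x y = z \<Longrightarrow> d y w = z \<Longrightarrow> d x w = z"
      "d x y = z \<or> d y x = z" "d x y = z \<Longrightarrow> d (a w x) (a w y) = z"
      "d y x \<noteq> z \<Longrightarrow> d w z \<noteq> z \<Longrightarrow> d (m w y) (m w x) \<noteq> z"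
      "d y x = z \<Longrightarrow> a (d x y) y = x" "d u z \<noteq> z"

lemma (in raw) semidom_laws: "semidom_laws Z (S Z) add mul mon"
proof
  fix x y w
  show "add (add x y) w = add x (add y w)" by (rule add_assoc)
  show "add x y = add y x" by (rule add_commute)
  show "mul (mul x y) w = mul x (mul y w)" by (rule mul_assoc)
  show "mul x y = mul y x" by (rule mul_commute)
  show "mul (S Z) x = x" by (simp add: mul_S_left)
  show "mul (add x y) w = add (mul x w) (mul y w)" using mul_add mul_commute by metis
  show "mon (mon x y) w = mon x (add y w)" by (rule mon_mon)
  show "mul x (mon y w) = mon (mul x y) (mul x w)" by (rule mul_mon)
  show "x = Z \<or> y = Z" if "mul x y = Z" using that mul_eq_Z by blast
  show "x = y" if "mon x y = Z" "mon y x = Z" using add_mon_total[of x y] that by auto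
  show "mon x w = Z" if "mon x y = Z" "mon y w = Z"
    using that add_assoc unfolding le_iff by metis
  show "mon x y = Z \<or> mon y x = Z" using add_mon_total[of x y] unfolding le_iff by metis
  show "mon (add w x) (add w y) = Z" if "mon x y = Z"
    using that add_assoc unfolding le_iff by metis
  show "mon (mul w y) (mul w x) \<noteq> Z" if "mon y x \<noteq> Z" "mon w Z \<noteq> Z"
    using that by (simp add: mul_eq_Z flip: mul_mon)
  show "add (mon x y) y = x" if "mon y x = Z"
    using add_mon_total[of y x] that add_commute by auto
qed (simp_all add: S_neq_Z[THEN not_sym])

lemma semidom_laws_nat: "semidom_laws (Elt 0) (Elt 1) (\<lambda>x y. Elt (index x + index y))
  (\<lambda>x y. Elt (index x * index y)) (\<lambda>x y. Elt (index x - index y))"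
  by standard (auto simp: elt.expand algebra_simps diff_mult_distrib2, metis elt.collapse neq0_conv)

text \<open>
  A counterexample to be refuted. The class operations have to be defined unconditionally, so
  they fall back to the standard natural numbers if there is no counterexample.
\<close>

definition Tr0 :: "fm \<Rightarrow> bool" where
  "Tr0 = (SOME Tr. term_model Tr \<and> \<not> (Tr (NBI \<^bold>\<longleftrightarrow> NBI_real) \<and> Tr (NBI \<^bold>\<longrightarrow> NBI_baire)))"

instantiation elt :: linordered_semidom
begin

definition zero_elt :: elt where
  "zero_elt = (if term_model Tr0 then term_model.val Tr0 Zero else Elt 0)"
definition one_elt :: elt where
  "one_elt = (if term_model Tr0 then term_model.val1 Tr0 Succ (term_model.val Tr0 Zero) else Elt 1)"
definition plus_elt :: "elt \<Rightarrow> elt \<Rightarrow> elt" where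
  "plus_elt = (if term_model Tr0 then term_model.val2 Tr0 addT else (\<lambda>x y. Elt (index x + index y)))"
definition times_elt :: "elt \<Rightarrow> elt \<Rightarrow> elt" where
  "times_elt = (if term_model Tr0 then term_model.val2 Tr0 multT else (\<lambda>x y. Elt (index x * index y)))"
definition minus_elt :: "elt \<Rightarrow> elt \<Rightarrow> elt" where
  "minus_elt = (if term_model Tr0 then term_model.val2 Tr0 monusT else (\<lambda>x y. Elt (index x - index y)))"
definition less_eq_elt :: "elt \<Rightarrow> elt \<Rightarrow> bool" where
  "less_eq_elt x y \<longleftrightarrow> x - y = 0"
definition less_elt :: "elt \<Rightarrow> elt \<Rightarrow> bool" where
  "less_elt x y \<longleftrightarrow> y - x \<noteq> 0"

lemma semidom_laws_elt: "semidom_laws (0 :: elt) 1 (+) (*) (-)"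
proof (cases "term_model Tr0")
  case True
  then interpret term_model Tr0 .
  show ?thesis
    using semidom_laws True
    by (simp add: zero_elt_def one_elt_def plus_elt_def times_elt_def minus_elt_def)
next
  case False
  then show ?thesis
    using semidom_laws_nat
    by (simp add: zero_elt_def one_elt_def plus_elt_def times_elt_def minus_elt_def)
qed

instance
proof
  interpret L: semidom_laws "0 :: elt" 1 "(+)" "(*)" "(-)" by (rule semidom_laws_elt)
  fix a b c :: elt
  note [simp] = less_eq_elt_def less_elt_def
  show "a + b + c = a + (b + c)" "a + b = b + a" "0 + a = a"
    "a * b * c = a * (b * c)" "a * b = b * a" "1 * a = a" "(a + b) * c = a * c + b * c" "0 * a = 0"
    "(0 :: elt) \<noteq> 1" "a + b - a = b" "a - b - c = a - (b + c)" "a * (b - c) = a * b - a * c"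
    by (rule L.laws(1-12))+
  show "a * 0 = 0" using L.laws(5)[of a 0] L.laws(8)[of a] by (rule HOL.trans)
  show "a * (b + c) = a * b + a * c" by (metis L.laws(5,7))
  show "a \<le> a" "a \<le> b \<or> b \<le> a" "0 < (1 :: elt)"
    unfolding less_eq_elt_def less_elt_def by (rule L.laws(14,17,21))+
  show "a \<noteq> 0 \<Longrightarrow> b \<noteq> 0 \<Longrightarrow> a * b \<noteq> 0" using L.laws(13) by blast
  show "a \<le> b \<Longrightarrow> b \<le> a \<Longrightarrow> a = b" using L.laws(15) by simp
  show "a \<le> b \<Longrightarrow> b \<le> c \<Longrightarrow> a \<le> c" using L.laws(16)[of a b c] by simp
  show "a \<le> b \<Longrightarrow> c + a \<le> c + b" using L.laws(18)[of a b c] by simp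
  show "a < b \<Longrightarrow> 0 < c \<Longrightarrow> c * a < c * b" using L.laws(19)[of b a c] by simp
  show "b \<le> a \<Longrightarrow> a - b + b = a" using L.laws(20)[of b a] by simp
  show "a < b \<longleftrightarrow> a \<le> b \<and> \<not> b \<le> a" using L.laws(17)[of a b] by auto
qed

end

section \<open>Evaluation of the formulas\<close>

text \<open>The equations \<open>ops\<close> link the arithmetic of the truth predicate to the
  global class operations. They are established for \<open>Tr0\<close>.\<close>

locale arith_model = term_model Tr +
  md: model "val1 predT" "val1 pow2T" "val1 triT" "val1 tri_rootT" "val1 parityT" "val1 halfT" cs M1 M2
  for Tr +
  assumes ops [simp]: "val Zero = 0" "val1 Succ = (\<lambda>n. n + 1)" "val2 addT = (+)" "val2 multT = (*)"
    "val2 monusT = (-)"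

lemma arith_model_Tr0:
  assumes "term_model Tr0"
  shows "arith_model Tr0"
proof -
  interpret term_model Tr0 by (rule assms)
  have ops: "val Zero = 0" "val2 addT = (+)" "val2 multT = (*)" "val2 monusT = (-)"
    using assms by (simp_all add: zero_elt_def plus_elt_def times_elt_def minus_elt_def)
  have "n + 1 = val1 Succ n" for n
    using add_S[of n "val Zero"] assms by (simp add: one_elt_def plus_elt_def)
  then have S: "val1 Succ = (\<lambda>n. n + 1)" by auto
  have "raw 0 (\<lambda>n. n + 1) (val1 predT) (+) (*) (-) (val1 pow2T) (val1 triT) (val1 tri_rootT)
      (val1 parityT) (val1 halfT) cs M1 M2"
    using raw_axioms by (simp only: ops S)
  then have "model (val1 predT) (val1 pow2T) (val1 triT) (val1 tri_rootT) (val1 parityT) (val1 halfT) cs M1 M2"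
    by (rule model.intro) (rule model_axioms.intro, rule less_eq_elt_def)
  from arith_model.intro[OF assms this] show ?thesis
    by this (rule arith_model_axioms.intro[OF ops(1) S ops(2-4)])
qed

section \<open>Instantiation and abstraction in the formulas about rationals\<close>

lemma abstr_ops [simp]:
  "abstr_trm k x \<rho> addT = addT" "abstr_trm k x \<rho> multT = multT" "abstr_trm k x \<rho> monusT = monusT"
  "abstr_trm k x \<rho> pow2T = pow2T" "abstr_trm k x \<rho> predT = predT" "abstr_trm k x \<rho> triT = triT"
  "abstr_trm k x \<rho> tri_rootT = tri_rootT" "abstr_trm k x \<rho> parityT = parityT" "abstr_trm k x \<rho> halfT = halfT"
  by (simp_all add: abstr_trm_fresh)

lemma abstr_num [simp]: "abstr_trm k x \<rho> (num n) = num n"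
  by (simp add: abstr_trm_fresh)

lemma inst_num [simp]: "inst_trm k u (num n) = num n"
  by (rule inst_trm_closed[OF has_type_numeral])

lemmas code_defs = pair_def proj1_def proj2_def pos_def neg_def den_def cross_def
lemmas diff_defs = diff_less_def diff_leq_def lt_def le_def

lemma abstr_diff [simp]:
  "abstr k x \<rho> (diff_less q r a m) = diff_less (abstr_trm k x \<rho> q) (abstr_trm k x \<rho> r) (abstr_trm k x \<rho> a) (abstr_trm k x \<rho> m)"
  "abstr k x \<rho> (diff_leq q r a m) = diff_leq (abstr_trm k x \<rho> q) (abstr_trm k x \<rho> r) (abstr_trm k x \<rho> a) (abstr_trm k x \<rho> m)"
  by (simp_all add: diff_defs code_defs op_eqs)

lemma inst_diff [simp]:
  "inst k u (diff_less q r a m) = diff_less (inst_trm k u q) (inst_trm k u r) (inst_trm k u a) (inst_trm k u m)"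
  "inst k u (diff_leq q r a m) = diff_leq (inst_trm k u q) (inst_trm k u r) (inst_trm k u a) (inst_trm k u m)"
  by (simp_all add: diff_defs code_defs op_eqs)

lemma abstr_plus [simp]: "abstr_trm k x \<rho> (s \<^bold>+ t) = abstr_trm k x \<rho> s \<^bold>+ abstr_trm k x \<rho> t"
  by (simp add: op_eqs)

lemma inst_plus [simp]: "inst_trm k u (s \<^bold>+ t) = inst_trm k u s \<^bold>+ inst_trm k u t"
  by (simp add: op_eqs)

lemma has_type_arith [simp]:
  "has_type \<Gamma> s N \<Longrightarrow> has_type \<Gamma> t N \<Longrightarrow> has_type \<Gamma> (s \<^bold>+ t) N"
  "has_type \<Gamma> s N \<Longrightarrow> has_type \<Gamma> t N \<Longrightarrow> has_type \<Gamma> (s \<^bold>* t) N"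
  "has_type \<Gamma> s N \<Longrightarrow> has_type \<Gamma> t N \<Longrightarrow> has_type \<Gamma> (s \<^bold>- t) N"
  "has_type \<Gamma> s N \<Longrightarrow> has_type \<Gamma> (pow2 s) N" "has_type \<Gamma> s N \<Longrightarrow> has_type \<Gamma> (pred s) N"
  "has_type \<Gamma> s N \<Longrightarrow> has_type \<Gamma> (tri s) N" "has_type \<Gamma> s N \<Longrightarrow> has_type \<Gamma> (tri_root s) N"
  "has_type \<Gamma> s N \<Longrightarrow> has_type \<Gamma> (parity s) N" "has_type \<Gamma> s N \<Longrightarrow> has_type \<Gamma> (half s) N"
  by (simp_all add: op_eqs has_type_ops)

lemma has_type_code [simp]:
  "has_type \<Gamma> s N \<Longrightarrow> has_type \<Gamma> t N \<Longrightarrow> has_type \<Gamma> (pair s t) N"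
  "has_type \<Gamma> s N \<Longrightarrow> has_type \<Gamma> (proj1 s) N" "has_type \<Gamma> s N \<Longrightarrow> has_type \<Gamma> (proj2 s) N"
  "has_type \<Gamma> s N \<Longrightarrow> has_type \<Gamma> (pos s) N" "has_type \<Gamma> s N \<Longrightarrow> has_type \<Gamma> (neg s) N"
  "has_type \<Gamma> s N \<Longrightarrow> has_type \<Gamma> (den s) N"
  "has_type \<Gamma> s N \<Longrightarrow> has_type \<Gamma> t N \<Longrightarrow> has_type \<Gamma> (cross s t) N"
  by (simp_all add: code_defs has_type_numeral)

lemma wff_diff [simp]:
  "has_type \<Gamma> q N \<Longrightarrow> has_type \<Gamma> r N \<Longrightarrow> has_type \<Gamma> a N \<Longrightarrow> has_type \<Gamma> m N \<Longrightarrow> wff \<Gamma> (diff_less q r a m)"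
  "has_type \<Gamma> q N \<Longrightarrow> has_type \<Gamma> r N \<Longrightarrow> has_type \<Gamma> a N \<Longrightarrow> has_type \<Gamma> m N \<Longrightarrow> wff \<Gamma> (diff_leq q r a m)"
  by (simp_all add: diff_defs)

context term_model
begin

lemma subst_ALL': "subst v \<tau> y (ALL' x \<rho> A) = All \<rho> (inst 1 y (abstr 1 v \<tau> (abstr 0 x \<rho> A)))"
  by (simp add: subst_def ALL'_def)

lemma wff_subst_ALL: "wff [] A \<Longrightarrow> has_type [] y \<tau> \<Longrightarrow> wff [] (subst v \<tau> y (ALL' x \<rho> A))"
  by (rule wff_subst[OF wff_ALL'])

lemma Tr_subst_ALL:
  assumes "wff [] A" "has_type [] y \<tau>"
  shows "Tr (subst v \<tau> y (ALL' x \<rho> A)) \<longleftrightarrow>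
    (\<forall>s. has_type [] s \<rho> \<longrightarrow> Tr (inst 0 s (inst 1 y (abstr 1 v \<tau> (abstr 0 x \<rho> A)))))"
  using wff_subst_ALL[OF assms, of v x \<rho>] by (simp add: subst_def ALL'_def Tr_All)

lemma Tr_subst_ALL2:
  assumes "wff [] A" "has_type [] y \<tau>"
  shows "Tr (subst v \<tau> y (ALL' x \<rho> (ALL' z \<sigma> A))) \<longleftrightarrow>
    (\<forall>s t. has_type [] s \<rho> \<longrightarrow> has_type [] t \<sigma> \<longrightarrow>
      Tr (inst 0 t (inst 1 s (inst 2 y (abstr 2 v \<tau> (abstr 1 x \<rho> (abstr 0 z \<sigma> A)))))))"
proof -
  have w: "wff [] (subst v \<tau> y (ALL' x \<rho> (ALL' z \<sigma> A)))"
    by (rule wff_subst_ALL[OF wff_ALL'[OF assms(1)] assms(2)])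
  then have "wff [] (inst 0 s (inst 1 y (abstr 1 v \<tau> (abstr 0 x \<rho> (ALL' z \<sigma> A)))))" if "has_type [] s \<rho>" for s
    unfolding subst_ALL' by (rule wff_inst0[OF _ that])
  then show ?thesis
    unfolding Tr_subst_ALL[OF wff_ALL'[OF assms(1)] assms(2)]
    by (auto simp: ALL'_def Tr_All numeral_2_eq_2)
qed

text \<open>
  The first four premises on \<open>X\<close> and \<open>E\<close> say that these families of formulas commute with the
  substitutions that take place under the quantifiers of \<open>bijection_to_nat\<close>.
\<close>

lemma Tr_no_bijection:
  assumes "\<And>y s t. has_type [] y ty2 \<Longrightarrow> has_type [] s ty1 \<Longrightarrow> has_type [] t ty1 \<Longrightarrow>
      inst 0 t (inst 1 s (inst 2 y (abstr 2 0 ty2 (abstr 1 1 ty1 (abstr 0 2 ty1 (X (Free 1 ty1))))))) = X s"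
    and "\<And>y s t. has_type [] y ty2 \<Longrightarrow> has_type [] s ty1 \<Longrightarrow> has_type [] t ty1 \<Longrightarrow>
      inst 0 t (inst 1 s (inst 2 y (abstr 2 0 ty2 (abstr 1 1 ty1 (abstr 0 2 ty1 (X (Free 2 ty1))))))) = X t"
    and "\<And>y s t. has_type [] y ty2 \<Longrightarrow> has_type [] s ty1 \<Longrightarrow> has_type [] t ty1 \<Longrightarrow>
      inst 0 t (inst 1 s (inst 2 y (abstr 2 0 ty2 (abstr 1 1 ty1 (abstr 0 2 ty1 (E (Free 1 ty1) (Free 2 ty1))))))) = E s t"
    and "\<And>y n t. has_type [] y ty2 \<Longrightarrow> has_type [] n N \<Longrightarrow> has_type [] t ty1 \<Longrightarrow>
      inst 0 t (inst 1 n (inst 2 y (abstr 2 0 ty2 (abstr 1 3 N (abstr 0 1 ty1 (X (Free 1 ty1))))))) = X t"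
    and wX: "\<And>t. has_type [] t ty1 \<Longrightarrow> wff [] (X t)"
    and wE: "\<And>s t. has_type [] s ty1 \<Longrightarrow> has_type [] t ty1 \<Longrightarrow> wff [] (E s t)"
    and P: "\<And>t. has_type [] t ty1 \<Longrightarrow> Tr (X t) \<longleftrightarrow> P (val1 t)"
    and R: "\<And>s t. has_type [] s ty1 \<Longrightarrow> has_type [] t ty1 \<Longrightarrow> Tr (E s t) \<longleftrightarrow> R (val1 s) (val1 t)"
  shows "Tr (no_bijection X E) \<longleftrightarrow> \<not> (\<exists>Y\<in>M2.
      (\<forall>x\<in>M1. \<forall>x'\<in>M1. P x \<longrightarrow> P x' \<longrightarrow> R x x' \<longrightarrow> Y x = Y x') \<and>
      (\<forall>x\<in>M1. \<forall>x'\<in>M1. P x \<longrightarrow> P x' \<longrightarrow> Y x = Y x' \<longrightarrow> R x x') \<and>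
      (\<forall>n. \<exists>x\<in>M1. P x \<and> Y x = n))"
proof -
  let ?y = "Free 0 ty2" and ?x = "Free 1 ty1" and ?x' = "Free 2 ty1" and ?n = "Free 3 N"
  let ?A = "X ?x \<^bold>\<longrightarrow> X ?x' \<^bold>\<longrightarrow> E ?x ?x' \<^bold>\<longrightarrow> ?y \<^bold>\<cdot> ?x \<^bold>= ?y \<^bold>\<cdot> ?x'"
  let ?B = "X ?x \<^bold>\<longrightarrow> X ?x' \<^bold>\<longrightarrow> ?y \<^bold>\<cdot> ?x \<^bold>= ?y \<^bold>\<cdot> ?x' \<^bold>\<longrightarrow> E ?x ?x'"
  let ?C = "Neg (X ?x \<^bold>\<and> ?y \<^bold>\<cdot> ?x \<^bold>= ?n)"
  let ?\<phi> = "ALL' 1 ty1 (ALL' 2 ty1 ?A) \<^bold>\<and> ALL' 1 ty1 (ALL' 2 ty1 ?B) \<^bold>\<and> ALL' 3 N (Neg (ALL' 1 ty1 ?C))"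
  have nb: "no_bijection X E = Neg (Neg (ALL' 0 ty2 (Neg ?\<phi>)))"
    by (simp add: no_bijection_def bijection_to_nat_def Let_def EX'_def)
  have wA: "wff [] ?A" and wB: "wff [] ?B" and wC: "wff [] ?C"
    using wX[of ?x] wX[of ?x'] wE[of ?x ?x'] by auto
  have w\<phi>: "wff [] ?\<phi>"
    using wff_ALL'[OF wff_ALL'[OF wA]] wff_ALL'[OF wff_ALL'[OF wB]] wff_ALL'[of "Neg (ALL' 1 ty1 ?C)"]
      wff_ALL'[OF wC] by auto
  have w: "wff [] (ALL' 0 ty2 (Neg ?\<phi>))" by (rule wff_ALL') (use w\<phi> in simp)
  have val_App: "val (y \<^bold>\<cdot> s) = val (y \<^bold>\<cdot> t)" if "has_type [] y ty2" "has_type [] s ty1" "has_type [] t ty1" "val1 s = val1 t" for y s t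
    using that by (intro val_cong[of y ty1 y]) (auto simp: val1_eq eqv_refl)
  have A: "Tr (subst 0 ty2 y (ALL' 1 ty1 (ALL' 2 ty1 ?A))) \<longleftrightarrow> (\<forall>s t. has_type [] s ty1 \<longrightarrow> has_type [] t ty1 \<longrightarrow>
      P (val1 s) \<longrightarrow> P (val1 t) \<longrightarrow> R (val1 s) (val1 t) \<longrightarrow> val (y \<^bold>\<cdot> s) = val (y \<^bold>\<cdot> t))" if y: "has_type [] y ty2" for y
    unfolding Tr_subst_ALL2[OF wA y]
    by (simp add: y inst_trm_closed[OF y] assms Tr_Imp Tr_Eq del: One_nat_def cong: imp_cong)
  have B: "Tr (subst 0 ty2 y (ALL' 1 ty1 (ALL' 2 ty1 ?B))) \<longleftrightarrow> (\<forall>s t. has_type [] s ty1 \<longrightarrow> has_type [] t ty1 \<longrightarrow>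
      P (val1 s) \<longrightarrow> P (val1 t) \<longrightarrow> val (y \<^bold>\<cdot> s) = val (y \<^bold>\<cdot> t) \<longrightarrow> R (val1 s) (val1 t))" if y: "has_type [] y ty2" for y
    unfolding Tr_subst_ALL2[OF wB y]
    by (simp add: y inst_trm_closed[OF y] assms Tr_Imp Tr_Eq del: One_nat_def cong: imp_cong)
  have C: "Tr (subst 0 ty2 y (ALL' 3 N (Neg (ALL' 1 ty1 ?C)))) \<longleftrightarrow>
      (\<forall>n. has_type [] n N \<longrightarrow> (\<exists>t. has_type [] t ty1 \<and> P (val1 t) \<and> val (y \<^bold>\<cdot> t) = val n))" if y: "has_type [] y ty2" for y
  proof -
    have wC': "wff [] (Neg (ALL' 1 ty1 ?C))" using wff_ALL'[OF wC] by simp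
    have "Tr (inst 0 n (inst 1 y (abstr 1 0 ty2 (abstr 0 3 N (Neg (ALL' 1 ty1 ?C)))))) \<longleftrightarrow>
        (\<exists>t. has_type [] t ty1 \<and> P (val1 t) \<and> val (y \<^bold>\<cdot> t) = val n)" if n: "has_type [] n N" for n
    proof -
      let ?D = "inst 1 n (inst 2 y (abstr 2 0 ty2 (abstr 1 3 N (abstr 0 1 ty1 ?C))))"
      have eq: "inst 0 n (inst 1 y (abstr 1 0 ty2 (abstr 0 3 N (Neg (ALL' 1 ty1 ?C))))) = Neg (All ty1 ?D)"
        by (simp add: ALL'_def numeral_2_eq_2)
      have wD: "wff [] (All ty1 ?D)"
        using wff_inst0[OF wff_subst_ALL[OF wC' y, of 0 3 N, unfolded subst_ALL'] n]
        unfolding eq wff.simps(3) by (rule conjunct1)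
      have "Tr (inst 0 t ?D) \<longleftrightarrow> \<not> (P (val1 t) \<and> val (y \<^bold>\<cdot> t) = val n)" if t: "has_type [] t ty1" for t
        using y n t wX[OF t] by (simp add: assms(4)[OF y n t, simplified] P Tr_Imp Tr_Eq)
      then show ?thesis unfolding eq using wD by (simp add: Tr_Neg Tr_All del: wff.simps inst.simps)
    qed
    then show ?thesis unfolding Tr_subst_ALL[OF wC' y] by simp
  qed
  have Tr_body: "Tr (subst 0 ty2 y ?\<phi>) \<longleftrightarrow> Tr (subst 0 ty2 y (ALL' 1 ty1 (ALL' 2 ty1 ?A))) \<and>
      Tr (subst 0 ty2 y (ALL' 1 ty1 (ALL' 2 ty1 ?B))) \<and>
      Tr (subst 0 ty2 y (ALL' 3 N (Neg (ALL' 1 ty1 ?C))))" if y: "has_type [] y ty2" for y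
  proof -
    have wC': "wff [] (Neg (ALL' 1 ty1 ?C))" using wff_ALL'[OF wC] by simp
    note ws = wff_subst_ALL[OF wff_ALL'[OF wA] y, of 0 1 ty1] wff_subst_ALL[OF wff_ALL'[OF wB] y, of 0 1 ty1]
      wff_subst_ALL[OF wC' y, of 0 3 N]
    have "subst 0 ty2 y ?\<phi> = (subst 0 ty2 y (ALL' 1 ty1 (ALL' 2 ty1 ?A)) \<^bold>\<and>
      subst 0 ty2 y (ALL' 1 ty1 (ALL' 2 ty1 ?B)) \<^bold>\<and> subst 0 ty2 y (ALL' 3 N (Neg (ALL' 1 ty1 ?C))))"
      by (simp only: subst_def abstr.simps inst.simps)
    then show ?thesis using ws Tr_Con by (metis wff.simps(2,3))
  qed
  have "Tr (no_bijection X E) \<longleftrightarrow> (\<forall>y. has_type [] y ty2 \<longrightarrow> \<not> Tr (subst 0 ty2 y ?\<phi>))"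
  proof -
    have "Tr (no_bijection X E) \<longleftrightarrow> Tr (ALL' 0 ty2 (Neg ?\<phi>))"
      unfolding nb using w Tr_Neg by (metis wff.simps(2,3))
    also have "\<dots> \<longleftrightarrow> (\<forall>y. has_type [] y ty2 \<longrightarrow> Tr (subst 0 ty2 y (Neg ?\<phi>)))"
      by (rule Tr_ALL') (use w\<phi> in simp)
    also have "\<dots> \<longleftrightarrow> (\<forall>y. has_type [] y ty2 \<longrightarrow> \<not> Tr (subst 0 ty2 y ?\<phi>))"
    proof -
      have "subst 0 ty2 y (Neg ?\<phi>) = Neg (subst 0 ty2 y ?\<phi>)" for y
        by (simp only: subst_def abstr.simps inst.simps)
      then show ?thesis using Tr_Neg wff_subst[OF w\<phi>] by metis
    qed
    finally show ?thesis .
  qed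
  also have "\<dots> \<longleftrightarrow> \<not> (\<exists>y. has_type [] y ty2 \<and>
      (\<forall>s t. has_type [] s ty1 \<longrightarrow> has_type [] t ty1 \<longrightarrow> P (val1 s) \<longrightarrow> P (val1 t) \<longrightarrow> R (val1 s) (val1 t) \<longrightarrow> val (y \<^bold>\<cdot> s) = val (y \<^bold>\<cdot> t)) \<and>
      (\<forall>s t. has_type [] s ty1 \<longrightarrow> has_type [] t ty1 \<longrightarrow> P (val1 s) \<longrightarrow> P (val1 t) \<longrightarrow> val (y \<^bold>\<cdot> s) = val (y \<^bold>\<cdot> t) \<longrightarrow> R (val1 s) (val1 t)) \<and>
      (\<forall>n. \<exists>t. has_type [] t ty1 \<and> P (val1 t) \<and> val (y \<^bold>\<cdot> t) = n))"
    (is "_ \<longleftrightarrow> \<not> (\<exists>y. has_type [] y ty2 \<and> ?S y)")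
  proof -
    have surj: "(\<forall>n. has_type [] n N \<longrightarrow> Q (val n)) \<longleftrightarrow> (\<forall>n. Q n)" for Q
      by (metis has_type_rep val_rep)
    define T where "T y \<longleftrightarrow> ?S y" for y
    have "Tr (subst 0 ty2 y ?\<phi>) \<longleftrightarrow> T y" if y: "has_type [] y ty2" for y
      unfolding T_def Tr_body[OF y] A[OF y] B[OF y] C[OF y]
        surj[of "\<lambda>n. \<exists>t. has_type [] t ty1 \<and> P (val1 t) \<and> val (y \<^bold>\<cdot> t) = n"] ..
    then show ?thesis unfolding T_def[symmetric] by blast
  qed
  also have "\<dots> \<longleftrightarrow> \<not> (\<exists>Y\<in>M2.
      (\<forall>x\<in>M1. \<forall>x'\<in>M1. P x \<longrightarrow> P x' \<longrightarrow> R x x' \<longrightarrow> Y x = Y x') \<and>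
      (\<forall>x\<in>M1. \<forall>x'\<in>M1. P x \<longrightarrow> P x' \<longrightarrow> Y x = Y x' \<longrightarrow> R x x') \<and>
      (\<forall>n. \<exists>x\<in>M1. P x \<and> Y x = n))" (is "\<not> (\<exists>y. has_type [] y ty2 \<and> ?S y) \<longleftrightarrow> \<not> (\<exists>Y\<in>M2. ?T Y)")
  proof -
    let ?A = "{s. has_type [] s ty1}"
    have M1_ball: "(\<forall>x\<in>M1. Q x) \<longleftrightarrow> (\<forall>s\<in>?A. Q (val1 s))"
      and M1_bex: "(\<exists>x\<in>M1. Q x) \<longleftrightarrow> (\<exists>s\<in>?A. Q (val1 s))" for Q
      by (auto simp: M1_def)
    define SS where "SS y \<longleftrightarrow> ?S y" for y
    define TT where "TT Y \<longleftrightarrow> ?T Y" for Y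
    \<comment> \<open>The clauses only evaluate the map at values of terms of type 1, where the
      functional \<open>Y\<close> and the term \<open>y\<close> agree.\<close>
    have ST: "SS y \<longleftrightarrow> TT Y" if e: "\<And>s. has_type [] s ty1 \<Longrightarrow> Y (val1 s) = val (y \<^bold>\<cdot> s)" for y Y
    proof -
      have "SS y \<longleftrightarrow>
          (\<forall>s\<in>?A. \<forall>t\<in>?A. P (val1 s) \<longrightarrow> P (val1 t) \<longrightarrow> R (val1 s) (val1 t) \<longrightarrow> val (y \<^bold>\<cdot> s) = val (y \<^bold>\<cdot> t)) \<and>
          (\<forall>s\<in>?A. \<forall>t\<in>?A. P (val1 s) \<longrightarrow> P (val1 t) \<longrightarrow> val (y \<^bold>\<cdot> s) = val (y \<^bold>\<cdot> t) \<longrightarrow> R (val1 s) (val1 t)) \<and>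
          (\<forall>n. \<exists>t\<in>?A. P (val1 t) \<and> val (y \<^bold>\<cdot> t) = n)"
        unfolding SS_def by blast
      also have "(\<forall>s\<in>?A. \<forall>t\<in>?A. P (val1 s) \<longrightarrow> P (val1 t) \<longrightarrow> R (val1 s) (val1 t) \<longrightarrow> val (y \<^bold>\<cdot> s) = val (y \<^bold>\<cdot> t)) \<longleftrightarrow>
          (\<forall>s\<in>?A. \<forall>t\<in>?A. P (val1 s) \<longrightarrow> P (val1 t) \<longrightarrow> R (val1 s) (val1 t) \<longrightarrow> Y (val1 s) = Y (val1 t))"
        by (intro ball_cong HOL.refl) (simp add: e)
      also have "(\<forall>s\<in>?A. \<forall>t\<in>?A. P (val1 s) \<longrightarrow> P (val1 t) \<longrightarrow> val (y \<^bold>\<cdot> s) = val (y \<^bold>\<cdot> t) \<longrightarrow> R (val1 s) (val1 t)) \<longleftrightarrow>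
          (\<forall>s\<in>?A. \<forall>t\<in>?A. P (val1 s) \<longrightarrow> P (val1 t) \<longrightarrow> Y (val1 s) = Y (val1 t) \<longrightarrow> R (val1 s) (val1 t))"
        by (intro ball_cong HOL.refl) (simp add: e)
      also have "(\<forall>n. \<exists>t\<in>?A. P (val1 t) \<and> val (y \<^bold>\<cdot> t) = n) \<longleftrightarrow> (\<forall>n. \<exists>t\<in>?A. P (val1 t) \<and> Y (val1 t) = n)"
        by (intro all_cong1 bex_cong HOL.refl) (simp add: e)
      also have "(\<forall>s\<in>?A. \<forall>t\<in>?A. P (val1 s) \<longrightarrow> P (val1 t) \<longrightarrow> R (val1 s) (val1 t) \<longrightarrow> Y (val1 s) = Y (val1 t)) \<and>
          (\<forall>s\<in>?A. \<forall>t\<in>?A. P (val1 s) \<longrightarrow> P (val1 t) \<longrightarrow> Y (val1 s) = Y (val1 t) \<longrightarrow> R (val1 s) (val1 t)) \<and>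
          (\<forall>n. \<exists>t\<in>?A. P (val1 t) \<and> Y (val1 t) = n) \<longleftrightarrow> TT Y"
        unfolding TT_def M1_ball M1_bex ..
      finally show ?thesis .
    qed
    have "(\<exists>y. has_type [] y ty2 \<and> SS y) \<longleftrightarrow> (\<exists>Y\<in>M2. TT Y)"
    proof
      assume "\<exists>y. has_type [] y ty2 \<and> SS y"
      then obtain y where y: "has_type [] y ty2" "SS y" by blast
      obtain Y where "Y \<in> M2" "\<And>s. has_type [] s ty1 \<Longrightarrow> Y (val1 s) = val (y \<^bold>\<cdot> s)"
        using M2_term[OF y(1)] by blast
      then show "\<exists>Y\<in>M2. TT Y" using ST y(2) by blast
    next
      assume "\<exists>Y\<in>M2. TT Y"
      then obtain Y where Y: "Y \<in> M2" "TT Y" by blast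
      obtain y where "has_type [] y ty2" "\<And>s. has_type [] s ty1 \<Longrightarrow> Y (val1 s) = val (y \<^bold>\<cdot> s)"
        using M2E[OF Y(1)] by blast
      then show "\<exists>y. has_type [] y ty2 \<and> SS y" using ST Y(2) by blast
    qed
    then show ?thesis unfolding SS_def TT_def by simp
  qed
  finally show "Tr (no_bijection X E) \<longleftrightarrow> \<not> (\<exists>Y\<in>M2.
      (\<forall>x\<in>M1. \<forall>x'\<in>M1. P x \<longrightarrow> P x' \<longrightarrow> R x x' \<longrightarrow> Y x = Y x') \<and>
      (\<forall>x\<in>M1. \<forall>x'\<in>M1. P x \<longrightarrow> P x' \<longrightarrow> Y x = Y x' \<longrightarrow> R x x') \<and>
      (\<forall>n. \<exists>x\<in>M1. P x \<and> Y x = n))" .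
qed

end

lemma wff_no_bijection:
  assumes "\<And>t. has_type [] t ty1 \<Longrightarrow> wff [] (X t)" "\<And>s t. has_type [] s ty1 \<Longrightarrow> has_type [] t ty1 \<Longrightarrow> wff [] (E s t)"
  shows "wff [] (no_bijection X E)"
  using assms
  by (auto simp: no_bijection_def bijection_to_nat_def Let_def EX'_def intro!: wff_ALL')

lemma wff_NBI: "wff [] NBI" "wff [] NBI_real" "wff [] NBI_baire"
proof -
  have r: "has_type [] (real_nat m) ty1" for m
    unfolding real_nat_def by (rule has_type_AppI[OF has_type_const(4)]) simp
  note [simp del] = num.simps
  show "wff [] NBI" "wff [] NBI_real" "wff [] NBI_baire"
    unfolding NBI_def NBI_real_def NBI_baire_def
    by (rule wff_no_bijection; simp add: in_unit_def is_real_def real_eq_def real_leq_def Let_def has_type_Cons r)+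
qed

context arith_model
begin

section \<open>Truth of the formulas about reals\<close>

lemma val_arith:
  assumes "has_type [] s N" "has_type [] t N"
  shows "val (s \<^bold>+ t) = val s + val t" "val (s \<^bold>* t) = val s * val t" "val (s \<^bold>- t) = val s - val t"
  using assms by (simp_all add: op_eqs val_ops)

lemma val_arith1:
  assumes "has_type [] s N"
  shows "val (Succ \<^bold>\<cdot> s) = val s + 1" "val (pow2 s) = val1 pow2T (val s)" "val (tri s) = val1 triT (val s)"
    "val (tri_root s) = val1 tri_rootT (val s)" "val (parity s) = val1 parityT (val s)"
    "val (half s) = val1 halfT (val s)"
  using assms by (simp_all add: op_eqs val_ops1)

lemma val_num: "val (num 0) = 0" "val (num 1) = 1" "val (num 2) = 1 + 1"
  by (simp_all add: numeral_2_eq_2 val_arith1)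

lemma val_code1:
  assumes "has_type [] s N"
  shows "val (pos s) = md.posc (val s)" "val (neg s) = md.negc (val s)" "val (den s) = md.denc (val s)"
  using assms val_num(2)
  by (simp_all add: pos_def neg_def den_def proj1_def proj2_def md.posc_def md.negc_def md.denc_def
      md.p1_def md.p2_def val_arith val_arith1 del: num.simps One_nat_def)

lemma val_code:
  assumes "has_type [] s N" "has_type [] t N"
  shows "val (pair s t) = md.pr (val s) (val t)" "val (cross s t) = md.crossc (val s) (val t)"
  using assms by (simp_all add: pair_def cross_def md.pr_def md.crossc_def val_code1 val_arith val_arith1)

text \<open>Strict inequality is formalised through the successor of the left side, hence the added
  1, which discreteness removes.\<close>

lemma Tr_diff_less:
  assumes "has_type [] q N" "has_type [] r N" "has_type [] a N" "has_type [] k N"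
  shows "Tr (diff_less q r a k) \<longleftrightarrow> md.rc (val q) - md.rc (val r) < emb (val a) * md.eps (val k)"
proof -
  have "Tr (diff_less q r a k) \<longleftrightarrow> md.crossc (val q) (val r) * val1 pow2T (val k) + 1 \<le>
      md.crossc (val r) (val q) * val1 pow2T (val k) + val a * (md.denc (val q) * md.denc (val r))"
    using assms by (simp add: diff_less_def lt_def le_def Tr_Eq val_arith val_arith1 val_code val_code1 md.le_minus)
  then show ?thesis unfolding md.less_iff_add1_le[symmetric] md.cross_less_iff .
qed

lemma Tr_diff_leq:
  assumes "has_type [] q N" "has_type [] r N" "has_type [] a N" "has_type [] k N"
  shows "Tr (diff_leq q r a k) \<longleftrightarrow> md.rc (val q) - md.rc (val r) \<le> emb (val a) * md.eps (val k)"
proof -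
  have "Tr (diff_leq q r a k) \<longleftrightarrow> md.crossc (val q) (val r) * val1 pow2T (val k) \<le>
      md.crossc (val r) (val q) * val1 pow2T (val k) + val a * (md.denc (val q) * md.denc (val r))"
    using assms by (simp add: diff_leq_def le_def Tr_Eq val_arith val_arith1 val_code val_code1 md.le_minus)
  then show ?thesis unfolding md.cross_le_iff .
qed

lemma wff_real [simp]:
  assumes "has_type [] x ty1" "has_type [] y ty1"
  shows "wff [] (is_real x)" "wff [] (real_eq x y)" "wff [] (real_leq x y)"
  using assms by (simp_all add: is_real_def real_eq_def real_leq_def Let_def has_type_Cons del: num.simps)

lemma Tr_is_real:
  assumes x: "has_type [] x ty1"
  shows "Tr (is_real x) \<longleftrightarrow> md.realp (val1 x)"
proof -
  note [simp] = x inst_trm_closed[OF x] has_type_weaken[OF x] has_type_Cons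
  have "Tr (is_real x) \<longleftrightarrow> (\<forall>n. has_type [] n N \<longrightarrow> (\<forall>i. has_type [] i N \<longrightarrow>
      Tr (diff_less (x \<^bold>\<cdot> n) (x \<^bold>\<cdot> (n \<^bold>+ i)) (num 1) n) \<and> Tr (diff_less (x \<^bold>\<cdot> (n \<^bold>+ i)) (x \<^bold>\<cdot> n) (num 1) n)))"
    by (simp add: is_real_def Let_def Tr_All Tr_Imp del: num.simps One_nat_def)
  also have "\<dots> \<longleftrightarrow> (\<forall>n. has_type [] n N \<longrightarrow> (\<forall>i. has_type [] i N \<longrightarrow>
      md.rc (val1 x (val n)) - md.rc (val1 x (val n + val i)) < md.eps (val n) \<and>
      md.rc (val1 x (val n + val i)) - md.rc (val1 x (val n)) < md.eps (val n)))"
    by (simp add: Tr_diff_less val_num val_arith val1_val[symmetric] del: num.simps One_nat_def cong: imp_cong)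
  also have "\<dots> \<longleftrightarrow> md.realp (val1 x)"
    unfolding md.realp_def by (metis has_type_rep val_rep)
  finally show ?thesis .
qed

lemma Tr_real_leq:
  assumes x: "has_type [] x ty1" and y: "has_type [] y ty1"
  shows "Tr (real_leq x y) \<longleftrightarrow> md.rleq (val1 x) (val1 y)"
proof -
  note [simp] = x y inst_trm_closed[OF x] inst_trm_closed[OF y] has_type_Cons
  have "Tr (real_leq x y) \<longleftrightarrow> (\<forall>n. has_type [] n N \<longrightarrow> Tr (diff_leq (x \<^bold>\<cdot> n) (y \<^bold>\<cdot> n) (num 2) n))"
    by (simp add: real_leq_def Let_def Tr_All del: num.simps)
  also have "\<dots> \<longleftrightarrow> (\<forall>n. has_type [] n N \<longrightarrow> md.rc (val1 x (val n)) - md.rc (val1 y (val n)) \<le> 2 * md.eps (val n))"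
  proof -
    have "emb (val (num 2)) = 2" unfolding val_num emb_hom by simp
    then show ?thesis by (simp add: Tr_diff_leq val1_val[symmetric] del: num.simps cong: imp_cong)
  qed
  also have "\<dots> \<longleftrightarrow> md.rleq (val1 x) (val1 y)"
    unfolding md.rleq_def by (metis has_type_rep val_rep)
  finally show ?thesis .
qed

lemma Tr_real_eq:
  assumes x: "has_type [] x ty1" and y: "has_type [] y ty1"
  shows "Tr (real_eq x y) \<longleftrightarrow> md.req (val1 x) (val1 y)"
proof -
  note [simp] = x y inst_trm_closed[OF x] inst_trm_closed[OF y] has_type_Cons
  have "Tr (real_eq x y) \<longleftrightarrow> (\<forall>n. has_type [] n N \<longrightarrow>
      Tr (diff_leq (x \<^bold>\<cdot> n) (y \<^bold>\<cdot> n) (num 2) n) \<and> Tr (diff_leq (y \<^bold>\<cdot> n) (x \<^bold>\<cdot> n) (num 2) n))"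
    by (simp add: real_eq_def Let_def Tr_All Tr_Imp del: num.simps)
  also have "\<dots> \<longleftrightarrow> Tr (real_leq x y) \<and> Tr (real_leq y x)"
    by (simp add: real_leq_def Let_def Tr_All del: num.simps) blast
  finally show ?thesis unfolding md.req_def Tr_real_leq[OF x y] Tr_real_leq[OF y x] .
qed

lemma real_nat:
  "has_type [] (real_nat m) ty1" "inst_trm k u (real_nat m) = real_nat m" "abstr_trm k x \<rho> (real_nat m) = real_nat m"
  "val1 (real_nat m) = (\<lambda>_. md.pr (val (num (2 * m))) 0)"
proof -
  show ty: "has_type [] (real_nat m) ty1"
    unfolding real_nat_def by (rule has_type_AppI[OF has_type_const(4)]) simp
  then show "inst_trm k u (real_nat m) = real_nat m" by (rule inst_trm_closed)
  show "abstr_trm k x \<rho> (real_nat m) = real_nat m"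
    by (rule abstr_trm_fresh) (simp add: real_nat_def pair_def op_eqs)
  have "val (real_nat m \<^bold>\<cdot> n) = md.pr (val (num (2 * m))) 0" if n: "has_type [] n N" for n
  proof -
    have p: "has_type [] (pair (num (2 * m)) Zero) N" by simp
    have "val (real_nat m \<^bold>\<cdot> n) = val (pair (num (2 * m)) Zero)"
      by (rule val_eqv) (use ty n p eqv_Pi[OF p n] in \<open>simp_all add: real_nat_def\<close>)
    then show ?thesis by (simp add: val_code)
  qed
  then show "val1 (real_nat m) = (\<lambda>_. md.pr (val (num (2 * m))) 0)"
    by (simp add: val1_def fun_eq_iff)
qed

lemma in_unit:
  assumes x: "has_type [] x ty1"
  shows "wff [] (in_unit x)" "Tr (in_unit x) \<longleftrightarrow> md.unitp (val1 x)"
proof -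
  have w: "wff [] (is_real x)" "wff [] (real_leq (real_nat 0) x)" "wff [] (real_leq x (real_nat 1))"
    using x real_nat(1) by simp_all
  then show "wff [] (in_unit x)" by (simp add: in_unit_def)
  have n: "val1 (real_nat 0) = (\<lambda>_. md.pr 0 0)" "val1 (real_nat 1) = (\<lambda>_. md.pr (1 + 1) 0)"
    unfolding real_nat(4) mult_0_right nat_mult_1_right val_num by simp_all
  have "Tr (in_unit x) \<longleftrightarrow> Tr (is_real x) \<and> Tr (real_leq (real_nat 0) x) \<and> Tr (real_leq x (real_nat 1))"
    unfolding in_unit_def using w Tr_Con by (metis wff.simps(2,3))
  then show "Tr (in_unit x) \<longleftrightarrow> md.unitp (val1 x)"
    unfolding md.unitp_def n[symmetric] Tr_is_real[OF x] Tr_real_leq[OF real_nat(1) x] Tr_real_leq[OF x real_nat(1)] .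
qed

lemma bijection_Collect: "md.bijection {x \<in> M1. P x} E Y \<longleftrightarrow>
    (\<forall>x\<in>M1. \<forall>x'\<in>M1. P x \<longrightarrow> P x' \<longrightarrow> E x x' \<longrightarrow> Y x = Y x') \<and>
    (\<forall>x\<in>M1. \<forall>x'\<in>M1. P x \<longrightarrow> P x' \<longrightarrow> Y x = Y x' \<longrightarrow> E x x') \<and>
    (\<forall>n. \<exists>x\<in>M1. P x \<and> Y x = n)"
proof -
  have ball: "(\<forall>x\<in>{x \<in> M1. P x}. Q x) \<longleftrightarrow> (\<forall>x\<in>M1. P x \<longrightarrow> Q x)"
    and bex: "(\<exists>x\<in>{x \<in> M1. P x}. Q x) \<longleftrightarrow> (\<exists>x\<in>M1. P x \<and> Q x)" for Q by blast+
  have swap: "(P x \<longrightarrow> (\<forall>x'\<in>M1. Q x')) \<longleftrightarrow> (\<forall>x'\<in>M1. P x \<longrightarrow> Q x')" for x Q by blast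
  show ?thesis unfolding md.bijection_def ball bex swap ..
qed

lemma NBI_iff: "Tr NBI \<longleftrightarrow> \<not> (\<exists>Y\<in>M2. md.bijection md.unit_interval md.req Y)"
proof -
  note S = Tr_no_bijection[where X = in_unit and E = real_eq and P = md.unitp and R = md.req]
  note [simp] = in_unit_def is_real_def real_eq_def real_leq_def Let_def real_nat(2,3)
  have 1: "Tr NBI \<longleftrightarrow> \<not> (\<exists>Y\<in>M2.
      (\<forall>x\<in>M1. \<forall>x'\<in>M1. md.unitp x \<longrightarrow> md.unitp x' \<longrightarrow> md.req x x' \<longrightarrow> Y x = Y x') \<and>
      (\<forall>x\<in>M1. \<forall>x'\<in>M1. md.unitp x \<longrightarrow> md.unitp x' \<longrightarrow> Y x = Y x' \<longrightarrow> md.req x x') \<and>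
      (\<forall>n. \<exists>x\<in>M1. md.unitp x \<and> Y x = n))"
    unfolding NBI_def
    by (rule S; (rule in_unit wff_real(2) Tr_real_eq; assumption | simp del: num.simps))+
  show "Tr NBI \<longleftrightarrow> \<not> (\<exists>Y\<in>M2. md.bijection md.unit_interval md.req Y)"
    unfolding 1 md.unit_interval_def bijection_Collect ..
qed

lemma NBI_real_iff: "Tr NBI_real \<longleftrightarrow> \<not> (\<exists>Y\<in>M2. md.bijection md.reals md.req Y)"
proof -
  note S = Tr_no_bijection[where X = is_real and E = real_eq and P = md.realp and R = md.req]
  note [simp] = is_real_def real_eq_def Let_def
  have 1: "Tr NBI_real \<longleftrightarrow> \<not> (\<exists>Y\<in>M2.
      (\<forall>x\<in>M1. \<forall>x'\<in>M1. md.realp x \<longrightarrow> md.realp x' \<longrightarrow> md.req x x' \<longrightarrow> Y x = Y x') \<and>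
      (\<forall>x\<in>M1. \<forall>x'\<in>M1. md.realp x \<longrightarrow> md.realp x' \<longrightarrow> Y x = Y x' \<longrightarrow> md.req x x') \<and>
      (\<forall>n. \<exists>x\<in>M1. md.realp x \<and> Y x = n))"
    unfolding NBI_real_def
    by (rule S; (rule Tr_is_real wff_real(1,2) Tr_real_eq; assumption | simp del: num.simps))+
  show "Tr NBI_real \<longleftrightarrow> \<not> (\<exists>Y\<in>M2. md.bijection md.reals md.req Y)"
    unfolding 1 md.reals_def bijection_Collect ..
qed

lemma Tr_eq_at1:
  assumes "has_type [] s ty1" "has_type [] t ty1"
  shows "Tr (eq_at ty1 s t) \<longleftrightarrow> (\<forall>n. val1 s n = val1 t n)"
  using val1_eq[OF assms] by (auto simp: eqv_def fun_eq_iff)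

lemma NBI_baire_iff:
  "Tr NBI_baire \<longleftrightarrow> \<not> (\<exists>Y\<in>M2. md.bijection M1 (\<lambda>f g. \<forall>n. f n = g n) Y)"
proof -
  note S = Tr_no_bijection[where X = "\<lambda>x. Neg Fls" and E = "eq_at ty1" and P = "\<lambda>_. True"
      and R = "\<lambda>f g. \<forall>n. f n = g n"]
  have 1: "Tr NBI_baire \<longleftrightarrow> \<not> (\<exists>Y\<in>M2.
      (\<forall>x\<in>M1. \<forall>x'\<in>M1. True \<longrightarrow> True \<longrightarrow> (\<forall>n. x n = x' n) \<longrightarrow> Y x = Y x') \<and>
      (\<forall>x\<in>M1. \<forall>x'\<in>M1. True \<longrightarrow> True \<longrightarrow> Y x = Y x' \<longrightarrow> (\<forall>n. x n = x' n)) \<and>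
      (\<forall>n. \<exists>x\<in>M1. True \<and> Y x = n))"
    unfolding NBI_baire_def
    by (rule S; (rule wff_eq_at Tr_eq_at1; assumption | simp add: Tr_Imp eq_at_def Let_def))+
  show "Tr NBI_baire \<longleftrightarrow> \<not> (\<exists>Y\<in>M2. md.bijection M1 (\<lambda>f g. \<forall>n. f n = g n) Y)"
    using bijection_Collect[of "\<lambda>_. True"] unfolding 1 by simp
qed

text \<open>The statement on sequences passes through the real line: a bijection on sequences yields
  one on the reals and then one on the unit interval.\<close>

lemma Tr_NBI: "Tr (NBI \<^bold>\<longleftrightarrow> NBI_real)" "Tr (NBI \<^bold>\<longrightarrow> NBI_baire)"
proof -
  have "Tr NBI \<longleftrightarrow> Tr NBI_real"
    unfolding NBI_iff NBI_real_iff md.bijection_real_unit ..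
  then show "Tr (NBI \<^bold>\<longleftrightarrow> NBI_real)" by (simp add: Tr_Imp wff_NBI)
  have "Tr NBI \<longrightarrow> Tr NBI_baire"
    unfolding NBI_iff NBI_baire_iff md.bijection_real_unit using md.bijection_baire_real by blast
  then show "Tr (NBI \<^bold>\<longrightarrow> NBI_baire)" by (simp add: Tr_Imp wff_NBI)
qed

end

section \<open>Return from truth to provability\<close>

lemma ACA0_refutation:
  assumes "wff [] A" "\<not> (ACA0\<omega> \<^bold>\<turnstile> A)"
  obtains Tr where "term_model Tr" "\<not> Tr A"
proof (rule henkin_completeness[OF assms(1)])
  show "\<not> deriv ACA0\<omega> {} A" using assms(2) by (simp add: proves_def)
  fix Tr
  assume H: "\<not> Tr A" "\<not> Tr Fls"
    "\<And>B C. wff [] B \<Longrightarrow> wff [] C \<Longrightarrow> Tr (B \<^bold>\<longrightarrow> C) \<longleftrightarrow> (Tr B \<longrightarrow> Tr C)"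
    "\<And>\<rho> B. wff [] (All \<rho> B) \<Longrightarrow> Tr (All \<rho> B) \<longleftrightarrow> (\<forall>t. has_type [] t \<rho> \<longrightarrow> Tr (inst 0 t B))"
    "\<And>B. B \<in> ACA0\<omega> \<Longrightarrow> wff [] B \<Longrightarrow> Tr B"
  have "wff [] Exists2"
    by (simp add: Exists2_def Let_def ALL'_def EX'_def le_def op_eqs has_type_ops)
  then have "term_model Tr"
    by unfold_locales (use H in \<open>auto simp: ACA0\<omega>_def\<close>)
  then show thesis using H(1) that by blast
qed

text \<open>If any truth predicate were a counterexample, the selected \<open>Tr0\<close> would be
  one too; but its arithmetic is that of the class operations, so \<open>Tr_NBI\<close> applies to
  it.\<close>

lemma Tr_all_models:
  assumes "term_model Tr"
  shows "Tr (NBI \<^bold>\<longleftrightarrow> NBI_real) \<and> Tr (NBI \<^bold>\<longrightarrow> NBI_baire)"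
proof (rule ccontr)
  let ?P = "\<lambda>Tr. term_model Tr \<and> \<not> (Tr (NBI \<^bold>\<longleftrightarrow> NBI_real) \<and> Tr (NBI \<^bold>\<longrightarrow> NBI_baire))"
  assume "\<not> (Tr (NBI \<^bold>\<longleftrightarrow> NBI_real) \<and> Tr (NBI \<^bold>\<longrightarrow> NBI_baire))"
  with assms have "?P Tr" by (rule conjI)
  then have "?P Tr0" unfolding Tr0_def by (rule someI[where P = ?P])
  then have "term_model Tr0" "\<not> (Tr0 (NBI \<^bold>\<longleftrightarrow> NBI_real) \<and> Tr0 (NBI \<^bold>\<longrightarrow> NBI_baire))"
    by (rule conjunct1, rule conjunct2)
  then show False using arith_model.Tr_NBI[OF arith_model_Tr0[OF \<open>term_model Tr0\<close>]] by (simp only: simp_thms)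
qed

theorem theorem3:
  shows "(ACA0\<omega> \<^bold>\<turnstile> NBI \<^bold>\<longleftrightarrow> NBI_real) \<and> (ACA0\<omega> \<^bold>\<turnstile> NBI \<^bold>\<longrightarrow> NBI_baire)"
proof -
  have "wff [] (NBI \<^bold>\<longleftrightarrow> NBI_real)" "wff [] (NBI \<^bold>\<longrightarrow> NBI_baire)"
    using wff_NBI by simp_all
  note wff = this
  show ?thesis
  proof
    show "ACA0\<omega> \<^bold>\<turnstile> NBI \<^bold>\<longleftrightarrow> NBI_real"
      by (rule ccontr, erule ACA0_refutation[OF wff(1)]) (drule Tr_all_models, erule notE, erule conjunct1)
    show "ACA0\<omega> \<^bold>\<turnstile> NBI \<^bold>\<longrightarrow> NBI_baire"
      by (rule ccontr, erule ACA0_refutation[OF wff(2)]) (drule Tr_all_models, erule notE, erule conjunct2)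
  qed
qed

end
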